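(* Let $m\in\mathbb{N}$, let $V\subset\mathbb{R}^m$ be a closed convex body that is centrally symmetric with respect to the origin, let $N\in\{0,1,2,\ldots\}$, let $D_N=\sum_{|\alpha|=N}b_\alpha D^\alpha$ be a linear differential operator with constant coefficients $b_\alpha\in\mathbb{C}$ (with $D_0$ the identity operator), and let $p\in(0,\infty]$. Then $\lim_{n\to\infty}M_{p,D_N,n,m,V}$ (over $n\in\mathbb{N}$) exists and $$E_{p,D_N,m,V}=\lim_{n\to\infty}M_{p,D_N,n,m,V}.$$ In addition, there exists a nontrivial function $f_0\in B_V\cap L_p(\mathbb{R}^m)$ such that $$\frac{\|D_N(f_0)\|_{L_\infty(\mathbb{R}^m)}}{\|f_0\|_{L_p(\mathbb{R}^m)}}=\lim_{n\to\infty}M_{p,D_N,n,m,V}.$$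
   Context: Polar and dual norm: $V^*:=\{y\in\mathbb{R}^m:\ |t\cdot y|\le 1\ \text{for all } t\in V\}$, and for $z\in\mathbb{C}^m$, $\|z\|_V^*:=\sup_{t\in V}\left|\sum_{j=1}^m t_jz_j\right|$. Function spaces: for measurable $E\subseteq\mathbb{R}^m$, $L_r(E)$ is the space of measurable complex-valued $F$ with finite quasinorm $\|F\|_{L_r(E)}=\left(\int_E|F(x)|^r\,dx\right)^{1/r}$ for $0<r<\infty$, and $\|F\|_{L_\infty(E)}=\operatorname{ess\,sup}_{x\in E}|F(x)|$. For $p=\infty$, $m/p$ is understood as $0$. Polynomials: $\mathcal{P}_{n,m}$ is the set of all polynomials in $m$ variables with complex coefficients of total degree at most $n$. Entire functions: an entire function $f:\mathbb{C}^m\to\mathbb{C}$ has exponential type $V$ if for any $\varepsilon>0$ there is a constant $C_0(\varepsilon,f)$ such that $|f(z)|\le C_0(\varepsilon,f)\exp\left((1+\varepsilon)\|z\|_V^*\right)$ for all $z\in\mathbb{C}^m$. The class of all such functions is $B_V$; the same symbol denotes $f\in B_V$ and its restriction to $\mathbb{R}^m$ (as in $B_V\cap L_p(\mathbb{R}^m)$). Differential operators: for a multi-index $\alpha=(\alpha_1,\ldots,\alpha_m)$ of nonnegative integers, $|\alpha|=\sum_j\alpha_j$ and $D^\alpha=\frac{\partial^{\alpha_1}}{\partial y_1^{\alpha_1}}\cdots\frac{\partial^{\alpha_m}}{\partial y_m^{\alpha_m}}$. Sharp constants: $$M_{p,D_N,n,m,V}:=n^{-N-m/p}\sup_{P\in\mathcal{P}_{n,m}\setminus\{0\}}\frac{|D_N(P)(0)|}{\|P\|_{L_p(V^*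 )}},\qquad E_{p,D_N,m,V}:=\sup_{f\in(B_V\cap L_p(\mathbb{R}^m))\setminus\{0\}}\frac{\|D_N(f)\|_{L_\infty(\mathbb{R}^m)}}{\|f\|_{L_p(\mathbb{R}^m)}}.$$ *)

theory Defs
  imports "HOL-Analysis.Analysis" "HOL-Probability.Essential_Supremum"
begin

text \<open>
  The space \<open>\<real>\<^sup>m\<close> is \<^typ>\<open>real^'m\<close> with \<open>m = CARD('m)\<close>. The order on the index type serves only to
  list the coordinates as \<open>1, \<dots>, m\<close>, which fixes the order of differentiation in \<open>D\<^sup>\<alpha>\<close>.
\<close>

definition polar :: "(real^'m) set \<Rightarrow> (real^'m) set" where
  "polar V = {y. \<forall>t\<in>V. \<bar>t \<bullet> y\<bar> \<le> 1}"

text \<open>The supremum is over a bounded set of reals as soon as \<open>V\<close> is bounded and nonempty.\<close>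

definition dual_norm :: "(real^'m) set \<Rightarrow> complex^'m \<Rightarrow> real" where
  "dual_norm V z = (SUP t\<in>V. cmod (\<Sum>j\<in>UNIV. complex_of_real (t $ j) * z $ j))"


text \<open>
  Quasinorms take values in \<^typ>\<open>ennreal\<close>, so that functions outside \<open>L\<^sub>p\<close> get the value \<open>\<infinity>\<close>
  and suprema of ratios need no boundedness side condition.
\<close>

definition ennreal_powr :: "ennreal \<Rightarrow> real \<Rightarrow> ennreal" where
  "ennreal_powr x a = (if x = \<infinity> then \<infinity> else ennreal (enn2real x powr a))"

definition Lp_norm :: "ennreal \<Rightarrow> (real^'m) set \<Rightarrow> (real^'m \<Rightarrow> complex) \<Rightarrow> ennreal" where
  "Lp_norm p E F =
     (if p = \<infinity> then esssup (lebesgue_on E) (\<lambda>x. ennreal (cmod (F x)))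
      else ennreal_powr (\<integral>\<^sup>+x. ennreal (cmod (F x) powr enn2real p) \<partial>lebesgue_on E)
             (1 / enn2real p))"

definition Lp_space :: "ennreal \<Rightarrow> (real^'m) set \<Rightarrow> (real^'m \<Rightarrow> complex) set" where
  "Lp_space p E = {F. F \<in> borel_measurable (lebesgue_on E) \<and> Lp_norm p E F < \<infinity>}"


text \<open>Multi-indices are elements of \<^typ>\<open>nat^'m\<close>.\<close>

definition mi_size :: "nat^'m \<Rightarrow> nat" where
  "mi_size \<alpha> = (\<Sum>j\<in>UNIV. \<alpha> $ j)"

text \<open>By the next two lemmas, the sums over multi-indices below are genuine finite sums.\<close>

lemma finite_mi_size_le: "finite {\<alpha> :: nat^'m. mi_size \<alpha> \<le> n}"
proof (rule finite_subset)
  show "{\<alpha> :: nat^'m. mi_size \<alpha> \<le> n} \<subseteq> vec_lambda ` (UNIV \<rightarrow>\<^sub>E {..n})"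
  proof
    fix \<alpha> :: "nat^'m" assume "\<alpha> \<in> {\<alpha>. mi_size \<alpha> \<le> n}"
    then have "\<alpha> $ j \<le> n" for j
      using member_le_sum[of j UNIV "\<lambda>j. \<alpha> $ j"] by (simp add: mi_size_def)
    then have "vec_nth \<alpha> \<in> UNIV \<rightarrow>\<^sub>E {..n}" by auto
    then show "\<alpha> \<in> vec_lambda ` (UNIV \<rightarrow>\<^sub>E {..n})"
      by (metis image_eqI vec_nth_inverse)
  qed
  show "finite (vec_lambda ` ((UNIV :: 'm set) \<rightarrow>\<^sub>E {..n}) :: (nat^'m) set)"
    by (intro finite_imageI finite_PiE) auto
qed

lemma finite_mi_size_eq: "finite {\<alpha> :: nat^'m. mi_size \<alpha> = n}"
  by (rule finite_subset[OF _ finite_mi_size_le[of n]]) auto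

text \<open>Polynomials are represented by their functions on \<open>\<real>\<^sup>m\<close>.\<close>

definition polys :: "nat \<Rightarrow> (real^'m \<Rightarrow> complex) set" where
  "polys n = {P. \<exists>c :: nat^'m \<Rightarrow> complex.
     P = (\<lambda>x. \<Sum>\<alpha> | mi_size \<alpha> \<le> n. c \<alpha> * (\<Prod>j\<in>UNIV. complex_of_real (x $ j) ^ (\<alpha> $ j)))}"


definition entire :: "(complex^'m \<Rightarrow> complex) \<Rightarrow> bool" where
  "entire f \<longleftrightarrow> (\<forall>z. \<exists>f'. (f has_derivative f') (at z) \<and> (\<forall>c h. f' (c *s h) = c * f' h))"

definition exp_type :: "(real^'m) set \<Rightarrow> (complex^'m \<Rightarrow> complex) set" where
  "exp_type V = {f. entire f \<and>
     (\<forall>\<epsilon>>0. \<exists>C. \<forall>z. cmod (f z) \<le> C * exp ((1 + \<epsilon>) * dual_norm V z))}"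

definition restrict_real :: "(complex^'m \<Rightarrow> complex) \<Rightarrow> real^'m \<Rightarrow> complex" where
  "restrict_real f x = f (\<chi> j. complex_of_real (x $ j))"


definition partial_deriv :: "'m \<Rightarrow> (real^'m \<Rightarrow> complex) \<Rightarrow> real^'m \<Rightarrow> complex" where
  "partial_deriv j F y = vector_derivative (\<lambda>t. F (y + t *\<^sub>R axis j 1)) (at 0)"

definition multi_deriv ::
    "nat^'m::{finite,linorder} \<Rightarrow> (real^'m::{finite,linorder} \<Rightarrow> complex) \<Rightarrow> real^'m::{finite,linorder} \<Rightarrow> complex" where
  "multi_deriv \<alpha> F =
     foldr (\<lambda>j. partial_deriv j ^^ (\<alpha> $ j)) (sorted_list_of_set UNIV) F"

definition diff_op ::
    "nat \<Rightarrow> (nat^'m::{finite,linorder} \<Rightarrow> complex) \<Rightarrow> (real^'m::{finite,linorder} \<Rightarrow> complex) \<Rightarrow> real^'m::{finite,linorder} \<Rightarrow> complex" where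
  "diff_op N b F y = (\<Sum>\<alpha> | mi_size \<alpha> = N. b \<alpha> * multi_deriv \<alpha> F y)"


definition M_const ::
    "ennreal \<Rightarrow> nat \<Rightarrow> (nat^'m::{finite,linorder} \<Rightarrow> complex) \<Rightarrow> nat \<Rightarrow> (real^'m::{finite,linorder}) set \<Rightarrow> ennreal" where
  "M_const p N b n V =
     ennreal (real n powr (- real N - (if p = \<infinity> then 0 else real CARD('m) / enn2real p))) *
     (SUP P \<in> polys n - {\<lambda>_. 0}. ennreal (cmod (diff_op N b P 0)) / Lp_norm p (polar V) P)"

definition E_const ::
    "ennreal \<Rightarrow> nat \<Rightarrow> (nat^'m::{finite,linorder} \<Rightarrow> complex) \<Rightarrow> (real^'m::{finite,linorder}) set \<Rightarrow> ennreal" where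
  "E_const p N b V =
     (SUP f \<in> {f \<in> exp_type V. restrict_real f \<in> Lp_space p UNIV} - {\<lambda>_. 0}.
        Lp_norm \<infinity> UNIV (diff_op N b (restrict_real f)) / Lp_norm p UNIV (restrict_real f))"

end

theory Submission
  imports "HOL-Complex_Analysis.Complex_Analysis" "HOL-Real_Asymp.Real_Asymp" Defs
begin

text \<open>
  Let \<open>K = V\<^sup>*\<close>. Rescaling by \<open>n\<close> turns the constant for polynomials of degree \<open>n\<close> into the supremum of
  \<open>|D\<^sub>N Q(0)| / \<parallel>Q\<parallel>\<close> with the norm taken in \<open>L\<^sub>p(n K)\<close>.

  A Nikolskii inequality and the Bernstein--Walsh inequality make near-extremal polynomials \<open>Q\<^sub>n\<close> locally bounded on
  \<open>\<complex>\<^sup>m\<close>. By Montel's theorem a subsequence converges to an entire function \<open>f\<close>; the Bernstein--Walsh inequality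
  gives \<open>f \<in> B\<^sub>V\<close>, Fatou's lemma gives \<open>\<parallel>f\<parallel>\<^sub>p \<le> 1\<close>, and \<open>|D\<^sub>N f(0)|\<close> is the limit superior of the constants.

  Conversely, let \<open>f \<in> B\<^sub>V \<inter> L\<^sub>p\<close> and let \<open>F\<close> be a translate of \<open>f\<close>, dilated by a factor less than one. Then \<open>F\<close>
  is exponentially well approximated on \<open>n K\<close> by polynomials of degree \<open>n\<close>. On every line through the origin this is a
  statement about one variable: the Borel transform of \<open>F\<close> extends holomorphically across the imaginary axis outside of
  \<open>[-\<i>, \<i>]\<close>, so \<open>F\<close> is an integral of exponentials over an ellipse close to that segment, and there the exponential
  is replaced by its truncated Chebyshev expansion. Hence \<open>|D\<^sub>N f(x)|\<close> is at most \<open>\<parallel>f\<parallel>\<^sub>p\<close> times the limit inferior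
  of the constants. Applied to the limit function above, this shows that both limits agree.
\<close>

text \<open>The polynomial constants test a derivative at the single point 0 against a norm over a
  bounded body, the other constant tests a sup norm against a norm over the whole space; translation
  invariance of B_V and L_p bridges the two. For p < 1 the triangle inequality fails, so norms are
  compared through pointwise bounds, where an error exponentially small in n beats the volume of
  order n^m of the body. That error is exponentially small only because the dilated function has
  type strictly below one, which leaves room between its type and the degree n; the dilation factor
  enters the final inequality as a power with exponent N + m/p and tends to one. For x + i y the
  Bernstein--Walsh inequality is used on a real segment in direction y of length about n / ||y||, so
  its exponent is ||y|| up to a factor arbitrarily close to one: hence the limit has type V and not
  some multiple of V. If the constants tend to 0, the limit function may vanish; then an explicit
  nontrivial member of the class serves as f_0, for finite p a power of a product of sinc
  functions.\<close>

no_notation fps_nth (infixl \<open>$\<close> 75)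

section \<open>Polynomials of one variable and Chebyshev expansions\<close>

definition joukowski :: "complex \<Rightarrow> complex" where
  "joukowski s = (s + 1 / s) / 2"

text \<open>The preimages of \<open>c\<close> are the roots of r^2 - 2 c r + 1; their product is 1,
  so one of them lies in the closed unit disc.\<close>

lemma joukowski_surj_disc:
  obtains r where "r \<noteq> 0" "cmod r \<le> 1" "joukowski r = c"
proof -
  define d where "d = csqrt (c\<^sup>2 - 1)"
  have "d\<^sup>2 = c\<^sup>2 - 1" by (simp add: d_def)
  then have 1: "(c + d) * (c - d) = 1" by (simp add: algebra_simps power2_eq_square)
  then have nz: "c + d \<noteq> 0" "c - d \<noteq> 0" by auto
  with 1 have inv: "1 / (c + d) = c - d" "1 / (c - d) = c + d"
    by (metis nonzero_mult_div_cancel_left, metis nonzero_mult_div_cancel_right)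
  show thesis
  proof (cases "cmod (c + d) \<le> 1")
    case True
    with inv nz show thesis by (intro that[of "c + d"]) (auto simp: joukowski_def)
  next
    case False
    have "cmod (c + d) * cmod (c - d) = 1" using 1 by (metis norm_mult norm_one)
    moreover have "1 * cmod (c - d) \<le> cmod (c + d) * cmod (c - d)"
      using False by (intro mult_right_mono) auto
    ultimately have "cmod (c - d) \<le> 1" by simp
    with inv nz show thesis by (intro that[of "c - d"]) (auto simp: joukowski_def)
  qed
qed

text \<open>With \<open>u = - ln (cmod r)\<close> the triangle inequality gives |J(r)| \<ge> sinh u
  \<ge> u. This replaces the exact growth factor 1 / |r| of Bernstein--Walsh by an exponential in
  the point itself.\<close>

lemma inverse_norm_le_exp_joukowski:
  assumes "r \<noteq> 0" "cmod r \<le> 1"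
  shows "1 / cmod r \<le> exp (cmod (joukowski r))"
proof -
  define u where "u = - ln (cmod r)"
  have u: "exp u = 1 / cmod r" "u \<ge> 0" using assms by (auto simp: u_def exp_minus field_simps)
  have "cmod (1 / r) - cmod r \<le> cmod (r + 1 / r)"
    by (metis add.commute norm_diff_ineq)
  then have "exp u - exp (- u) \<le> 2 * cmod (joukowski r)"
    using u assms by (simp add: joukowski_def norm_divide exp_minus)
  then have "sinh u \<le> cmod (joukowski r)" by (simp add: sinh_field_def)
  moreover have "u \<le> sinh u"
    using real_le_x_sinh[of u] u(2) by (simp add: sinh_field_def exp_minus)
  ultimately show ?thesis unfolding u(1)[symmetric] by simp
qed

text \<open>The maximum principle applied to \<open>r\<^sup>n q (T (r + 1/r) / 2)\<close> in the unit disc.\<close>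

lemma bernstein_walsh:
  fixes q :: "complex poly"
  assumes deg: "degree q \<le> n" and T: "0 < T"
    and M: "\<And>t. \<bar>t\<bar> \<le> T \<Longrightarrow> cmod (poly q (complex_of_real t)) \<le> M"
  shows "cmod (poly q \<zeta>) \<le> M * exp (real n * cmod \<zeta> / T)"
proof -
  \<comment> \<open>This is r^n q(T J(r)) with the denominators cleared, so that it is visibly
    holomorphic at 0 as well.\<close>
  define h where "h r = (\<Sum>j\<le>n. coeff q j * of_real T ^ j * r ^ (n - j) * ((r\<^sup>2 + 1) / 2) ^ j)" for r
  have q: "poly q x = (\<Sum>j\<le>n. coeff q j * x ^ j)" for x
    unfolding poly_altdef using deg
    by (intro sum.mono_neutral_left) (auto simp: coeff_eq_0)
  have h: "h r = r ^ n * poly q (of_real T * joukowski r)" if "r \<noteq> 0" for r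
    unfolding h_def q sum_distrib_left
  proof (intro sum.cong refl)
    fix j assume "j \<in> {..n}"
    then have "r ^ n = r ^ (n - j) * r ^ j" by (simp flip: power_add)
    moreover have "r * joukowski r = (r\<^sup>2 + 1) / 2"
      using that by (simp add: joukowski_def power2_eq_square field_simps)
    then have "r ^ j * joukowski r ^ j = ((r\<^sup>2 + 1) / 2) ^ j" by (metis power_mult_distrib)
    ultimately show "coeff q j * of_real T ^ j * r ^ (n - j) * ((r\<^sup>2 + 1) / 2) ^ j =
        r ^ n * (coeff q j * (of_real T * joukowski r) ^ j)"
      by (simp add: power_mult_distrib mult_ac)
  qed
  have hM: "cmod (h r) \<le> M" if "cmod r \<le> 1" for r
  proof (rule maximum_modulus_frontier[of h "cball 0 1"])
    show "h holomorphic_on interior (cball 0 1)" unfolding h_def by (intro holomorphic_intros) auto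
    show "continuous_on (closure (cball 0 1)) h" unfolding h_def by (intro continuous_intros) auto
    show "cmod (h z) \<le> M" if "z \<in> frontier (cball 0 1)" for z
    proof -
      have z: "cmod z = 1" using that by (auto simp: frontier_def)
      then have "z * cnj z = 1" using complex_norm_square[of z] by simp
      then have "1 / z = cnj z" by (metis mult_zero_left nonzero_mult_div_cancel_left zero_neq_one)
      \<comment> \<open>On the unit circle 1/z is the conjugate of z, so the argument of
        \<open>q\<close> is real and lies in [-T, T].\<close>
      then have j: "joukowski z = of_real (Re z)"
        by (simp add: joukowski_def complex_add_cnj)
      have "z \<noteq> 0" using z by auto
      have "\<bar>T * Re z\<bar> \<le> T" using abs_Re_le_cmod[of z] z T by (simp add: abs_mult)
      from M[OF this] show ?thesis
        unfolding h[OF \<open>z \<noteq> 0\<close>] j by (simp add: norm_mult norm_power z)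
    qed
  qed (use that in auto)
  obtain r where r: "r \<noteq> 0" "cmod r \<le> 1" "joukowski r = \<zeta> / of_real T"
    by (rule joukowski_surj_disc)
  have Tc: "of_real T * joukowski r = \<zeta>" using r T by simp
  have M0: "0 \<le> M" using order_trans[OF norm_ge_zero M[of 0]] T by simp
  have "cmod r ^ n * cmod (poly q \<zeta>) \<le> M"
    using hM[OF r(2)] h[OF r(1)] Tc by (simp add: norm_mult norm_power)
  then have "cmod (poly q \<zeta>) \<le> M * (1 / cmod r) ^ n"
    using r(1) by (simp add: power_divide mult.commute pos_le_divide_eq)
  also have "\<dots> \<le> M * exp (cmod (joukowski r)) ^ n"
    using inverse_norm_le_exp_joukowski[OF r(1,2)] M0 by (intro mult_left_mono power_mono) auto
  also have "exp (cmod (joukowski r)) ^ n = exp (real n * cmod \<zeta> / T)"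
    unfolding r(3) exp_of_nat_mult[symmetric] using T by (simp add: norm_divide)
  finally show ?thesis .
qed

section \<open>Chebyshev polynomials and the Laurent expansion of the exponential\<close>

text \<open>These are twice the Chebyshev polynomials, built from their three-term
  recurrence.\<close>

lemma joukowski_power_poly:
  "\<exists>p :: complex poly. degree p \<le> k \<and> (\<forall>s. s \<noteq> 0 \<longrightarrow> poly p (joukowski s) = s ^ k + 1 / s ^ k)"
proof (induction k rule: less_induct)
  case (less k)
  consider "k = 0" | "k = 1" | l where "k = Suc (Suc l)" 
    by (metis One_nat_def not0_implies_Suc)
  then show ?case
  proof cases
    case 1
    then show ?thesis by (intro exI[of _ "[:2:]"]) auto
  next
    case 2
    then show ?thesis by (intro exI[of _ "[:0, 2:]"]) (auto simp: joukowski_def)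
  next
    case (3 l)
    obtain p where p: "degree p \<le> l" "\<And>s. s \<noteq> 0 \<Longrightarrow> poly p (joukowski s) = s ^ l + 1 / s ^ l"
      using less[of l] 3 by auto
    obtain q where q: "degree q \<le> Suc l" "\<And>s. s \<noteq> 0 \<Longrightarrow> poly q (joukowski s) = s ^ Suc l + 1 / s ^ Suc l"
      using less[of "Suc l"] 3 by auto
    have "degree ([:0, 2:] * q) \<le> k"
      using degree_mult_le[of "[:0,2:]" q] q(1) 3 by simp
    then have "degree ([:0, 2:] * q - p) \<le> k"
      using p(1) 3 by (intro degree_diff_le) auto
    moreover have "poly ([:0, 2:] * q - p) (joukowski s) = s ^ k + 1 / s ^ k" if "s \<noteq> 0" for s
      using that unfolding 3 by (simp add: p(2) q(2)) (simp add: joukowski_def field_simps)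
    ultimately show ?thesis by blast
  qed
qed

text \<open>The value I_k(2 X) of a modified Bessel function; it is the coefficient of s^k and of
  s^(-k) in the Laurent series of exp (X (s + 1/s)).\<close>

definition bessel_coeff :: "complex \<Rightarrow> nat \<Rightarrow> complex" where
  "bessel_coeff X k = (\<Sum>b. X ^ (2 * b + k) / (fact b * fact (b + k)))"

lemma has_sum_exp: "((\<lambda>a. x ^ a / fact a) has_sum exp x) (UNIV :: nat set)" for x :: complex
  using norm_summable_imp_has_sum[OF summable_norm_exp exp_converges, of x]
  by (simp add: scaleR_conv_of_real divide_inverse mult.commute)

lemma abs_summable_exp: "(\<lambda>a. norm (x ^ a / fact a)) summable_on (UNIV :: nat set)" for x :: complex
  unfolding summable_on_iff_abs_summable_on_complex[symmetric] by (rule has_sum_imp_summable[OF has_sum_exp])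

text \<open>Multiply the series of exp (X s) and exp (X / s) and collect the terms by the difference
  of the two indices. Equal coefficients at opposite powers make the Laurent series a Chebyshev
  series in J(s).\<close>

lemma exp_joukowski_sums:
  fixes X s :: complex
  assumes s: "s \<noteq> 0"
  shows
      "(\<lambda>k. bessel_coeff X (Suc k) * (s ^ Suc k + 1 / s ^ Suc k)) sums
         (exp (X * (s + 1 / s)) - bessel_coeff X 0)"
proof -
  define f where "f = (\<lambda>(a, b). (X * s) ^ a / fact a * ((X / s) ^ b / fact b))"
  have "(\<lambda>ab. norm (f ab)) summable_on UNIV \<times> UNIV"
    unfolding Infinite_Sum.abs_summable_on_Sigma_iff
  proof (intro conjI ballI)
    fix a show "(\<lambda>y. norm (f (a, y))) summable_on UNIV"
      unfolding f_def prod.case norm_mult by (rule summable_on_cmult_right[OF abs_summable_exp])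
  next
    have "(\<lambda>x. norm ((X * s) ^ x / fact x) * infsum (\<lambda>y. norm ((X / s) ^ y / fact y)) UNIV) summable_on UNIV"
      using abs_summable_exp[of "X * s"] by (intro summable_on_cmult_left)
    then show "(\<lambda>x. norm (\<Sum>\<^sub>\<infinity>y. norm (f (x, y)))) summable_on UNIV"
      unfolding f_def prod.case norm_mult infsum_cmult_right[OF abs_summable_exp]
      by (simp add: infsum_nonneg abs_mult)
  qed
  then have summ: "f summable_on UNIV \<times> UNIV" by (rule Infinite_Sum.abs_summable_summable)
  have E: "(f has_sum exp (X * (s + 1 / s))) (UNIV \<times> UNIV)"
  proof (rule has_sum_SigmaI[OF _ _ summ])
    fix a show "((\<lambda>y. f (a, y)) has_sum ((X * s) ^ a / fact a * exp (X / s))) UNIV"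
      unfolding f_def prod.case by (rule has_sum_cmult_right[OF has_sum_exp])
  next
    have "((\<lambda>a. (X * s) ^ a / fact a * exp (X / s)) has_sum (exp (X * s) * exp (X / s))) UNIV"
      by (rule has_sum_cmult_left[OF has_sum_exp])
    then show "((\<lambda>a. (X * s) ^ a / fact a * exp (X / s)) has_sum exp (X * (s + 1 / s))) UNIV"
      by (simp add: exp_add[symmetric] ring_distribs)
  qed
  \<comment> \<open>The diagonal belongs to \<open>P\<close>, so the powers s^k start at k = 0
    there, while in \<open>Q\<close> the powers 1 / s^k start at k = 1.\<close>
  define P where "P = {(a, b). a \<ge> (b::nat)}"
  define Q where "Q = {(a, b). a < (b::nat)}"
  have sP: "f summable_on P" and sQ: "f summable_on Q"
    using summ summable_on_subset_banach by (metis UNIV_Times_UNIV subset_UNIV)+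
  have PQ: "P \<union> Q = UNIV \<times> UNIV" "P \<inter> Q = {}" by (auto simp: P_def Q_def)
  have sumPQ: "infsum f P + infsum f Q = exp (X * (s + 1 / s))"
    using has_sum_Un_disjoint[OF has_sum_infsum[OF sP] has_sum_infsum[OF sQ] PQ(2)] E PQ(1)
      has_sum_unique by metis
  have bess: "((\<lambda>b. X ^ (2 * b + k) / (fact b * fact (b + k))) has_sum bessel_coeff X k) UNIV"
    if "(\<lambda>b. X ^ (2 * b + k) / (fact b * fact (b + k))) summable_on UNIV" for k
    unfolding bessel_coeff_def sums_unique[OF has_sum_imp_sums[OF has_sum_infsum[OF that]], symmetric]
    by (rule has_sum_infsum[OF that])
  have fP: "((\<lambda>(k, b). s ^ k * (X ^ (2 * b + k) / (fact b * fact (b + k)))) has_sum infsum f P) (UNIV \<times> UNIV)"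
    using has_sum_infsum[OF sP]
  proof (subst has_sum_reindex_bij_witness[where i = "\<lambda>(a, b). (a - b, b)" and j = "\<lambda>(k, b). (k + b, b)" 
          and T = P and h = f and s' = "infsum f P"])
    show "f (case ab of (k, b) \<Rightarrow> (k + b, b)) = (case ab of (k, b) \<Rightarrow> s ^ k * (X ^ (2 * b + k) / (fact b * fact (b + k))))" for ab
      using s by (cases ab) (simp add: f_def power_mult_distrib power_divide power_add mult_2 mult_2_right add.commute mult_ac)
  qed (auto simp: P_def)
  have fQ: "((\<lambda>(k, b). 1 / s ^ Suc k * (X ^ (2 * b + Suc k) / (fact b * fact (b + Suc k)))) has_sum infsum f Q) (UNIV \<times> UNIV)"
    using has_sum_infsum[OF sQ]
  proof (subst has_sum_reindex_bij_witness[where i = "\<lambda>(a, b). (b - Suc a, a)" and j = "\<lambda>(k, b). (b, b + Suc k)" 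
          and T = Q and h = f and s' = "infsum f Q"])
    show "f (case ab of (k, b) \<Rightarrow> (b, b + Suc k)) = (case ab of (k, b) \<Rightarrow> 1 / s ^ Suc k * (X ^ (2 * b + Suc k) / (fact b * fact (b + Suc k))))" for ab
      using s by (cases ab) (simp add: f_def power_mult_distrib power_divide power_add mult_2 mult_2_right mult_ac del: fact_Suc)
  qed (auto simp: Q_def)
  have sk: "(\<lambda>b. X ^ (2 * b + k) / (fact b * fact (b + k))) summable_on UNIV" for k
  proof -
    have 1: "(\<lambda>b. s ^ k * (X ^ (2 * b + k) / (fact b * fact (b + k)))) summable_on UNIV"
      using summable_on_SigmaD1[OF has_sum_imp_summable[OF fP, unfolded UNIV_Times_UNIV[symmetric]]] by auto
    have 2: "s ^ k \<noteq> 0" using s by simp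
    show ?thesis by (rule iffD1[OF summable_on_cmult_right'[OF 2] 1])
  qed
  have "((\<lambda>k. s ^ k * bessel_coeff X k) has_sum infsum f P) UNIV"
    by (rule has_sum_Sigma'[OF fP]) (simp only: prod.case has_sum_cmult_right[OF bess[OF sk]])
  then have 1: "(\<lambda>k. s ^ k * bessel_coeff X k) sums infsum f P" by (rule has_sum_imp_sums)
  have "((\<lambda>k. 1 / s ^ Suc k * bessel_coeff X (Suc k)) has_sum infsum f Q) UNIV"
    by (rule has_sum_Sigma'[OF fQ]) (simp only: prod.case has_sum_cmult_right[OF bess[OF sk]])
  then have 2: "(\<lambda>k. 1 / s ^ Suc k * bessel_coeff X (Suc k)) sums infsum f Q" by (rule has_sum_imp_sums)
  \<comment> \<open>The term of index 0 occurs in \<open>P\<close> only and is split off, so that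
    the two series can be added term by term.\<close>
  have 3: "(\<lambda>k. s ^ Suc k * bessel_coeff X (Suc k)) sums (infsum f P - bessel_coeff X 0)"
    using 1 by (subst sums_Suc_iff) simp
  have "(\<lambda>k. s ^ Suc k * bessel_coeff X (Suc k) + 1 / s ^ Suc k * bessel_coeff X (Suc k)) sums
      (infsum f P - bessel_coeff X 0 + infsum f Q)" by (rule sums_add[OF 3 2])
  then show ?thesis unfolding sumPQ[symmetric] by (simp add: algebra_simps)
qed

text \<open>Cauchy's estimate for a Laurent coefficient. As the coefficient is given by its series,
  the integral formula is obtained by integrating the series of exp (X / \<xi>) term by term over
  the circle.\<close>

lemma norm_bessel_coeff_le:
  assumes r: "0 < r" and M: "\<And>s. cmod s = r \<Longrightarrow> cmod (exp (X * (s + 1 / s))) \<le> M"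
  shows "cmod (bessel_coeff X k) \<le> M / r ^ k"
proof -
  \<comment> \<open>Summed over \<open>b\<close>, these give exp (X (\<xi> + 1 / \<xi>)) / \<xi>^(k
    + 1); each single term is covered by Cauchy's formula for the derivative of order b + k.\<close>
  define F where "F b \<xi> = X ^ b / fact b * (exp (X * \<xi>) / (\<xi> - 0) ^ Suc (b + k))" for b \<xi>
  have hd: "(deriv ^^ j) (\<lambda>z. exp (X * z)) 0 = X ^ j" for j
  proof -
    have "deriv exp = (exp :: complex \<Rightarrow> complex)" by (intro ext DERIV_imp_deriv DERIV_exp)
    then have e: "(deriv ^^ j) exp = (exp :: complex \<Rightarrow> complex)" by (induction j) simp_all
    have "(deriv ^^ j) (\<lambda>z. exp (X * z)) 0 = X ^ j * (deriv ^^ j) exp (X * 0)"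
      by (rule higher_deriv_compose_linear[of exp UNIV UNIV]) (auto intro: holomorphic_on_exp)
    then show ?thesis unfolding e by simp
  qed
  have alg: "x / f * (p / g * y) = p * (x * y / (f * g))" for x f p g y :: complex
    by simp
  have FI: "(F b has_contour_integral (2 * pi * \<i>) * (X ^ (2 * b + k) / (fact b * fact (b + k)))) (circlepath 0 r)" for b
  proof -
    have 1: "((\<lambda>u. exp (X * u) / (u - 0) ^ Suc (b + k)) has_contour_integral
        (2 * pi * \<i>) / fact (b + k) * (deriv ^^ (b + k)) (\<lambda>z. exp (X * z)) 0) (circlepath 0 r)"
      by (rule Cauchy_has_contour_integral_higher_derivative_circlepath)
        (use r in \<open>auto intro!: continuous_intros holomorphic_intros\<close>)
    have 2: "X ^ b / fact b * ((2 * pi * \<i>) / fact (b + k) * X ^ (b + k)) =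
        (2 * pi * \<i>) * (X ^ (2 * b + k) / (fact b * fact (b + k)))"
      using alg[of "X ^ b" "fact b" "2 * pi * \<i>" "fact (b + k)" "X ^ (b + k)"]
      unfolding power_add[symmetric] by (simp only: mult_2 add.assoc)
    show ?thesis
      unfolding F_def 2[symmetric] by (rule has_contour_integral_lmul[OF 1[unfolded hd]])
  qed
  have ul: "uniform_limit (sphere 0 r) (\<lambda>n \<xi>. \<Sum>b<n. F b \<xi>) (\<lambda>\<xi>. suminf (\<lambda>b. F b \<xi>)) sequentially"
  proof (rule Weierstrass_m_test)
    define B where "B = exp (cmod X * r) / r ^ Suc k"
    show "summable (\<lambda>b. cmod (X / of_real r) ^ b / fact b * B)"
      using summable_norm_exp[of "X / of_real r"]
      by (intro summable_mult2) (simp add: norm_power divide_inverse mult.commute)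
    fix b and \<xi> :: complex assume xi: "\<xi> \<in> sphere 0 r"
    then have n: "cmod \<xi> = r" by simp
    have "cmod (exp (X * \<xi>)) \<le> exp (cmod (X * \<xi>))" by (rule norm_exp)
    then have "cmod (exp (X * \<xi>)) \<le> exp (cmod X * r)" by (simp add: norm_mult n)
    then have "cmod (F b \<xi>) \<le> (cmod X ^ b / fact b) * (exp (cmod X * r) / r ^ Suc (b + k))"
      using r n by (simp add: F_def norm_mult norm_divide norm_power divide_simps mult_left_mono)
    also have "\<dots> = cmod (X / of_real r) ^ b / fact b * B"
      using r by (simp add: B_def norm_divide power_divide power_add field_simps)
    finally show "cmod (F b \<xi>) \<le> cmod (X / of_real r) ^ b / fact b * B" .
  qed
  have lim: "(\<Sum>b. F b \<xi>) = exp (X * (\<xi> + 1 / \<xi>)) / \<xi> ^ Suc k" if "\<xi> \<in> sphere 0 r" for \<xi>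
  proof -
    have nz: "\<xi> \<noteq> 0" using that r by auto
    have "(\<lambda>b. (X / \<xi>) ^ b / fact b) sums exp (X / \<xi>)"
      using has_sum_imp_sums[OF has_sum_exp] .
    then have "(\<lambda>b. (X / \<xi>) ^ b / fact b * (exp (X * \<xi>) / \<xi> ^ Suc k)) sums (exp (X / \<xi>) * (exp (X * \<xi>) / \<xi> ^ Suc k))"
      by (rule sums_mult2)
    moreover have "(X / \<xi>) ^ b / fact b * (exp (X * \<xi>) / \<xi> ^ Suc k) = F b \<xi>" for b
      using nz by (simp add: F_def power_divide power_add)
    ultimately have "(\<lambda>b. F b \<xi>) sums (exp (X / \<xi>) * (exp (X * \<xi>) / \<xi> ^ Suc k))" by simp
    then have "(\<Sum>b. F b \<xi>) = exp (X / \<xi>) * (exp (X * \<xi>) / \<xi> ^ Suc k)" by (rule sums_unique[symmetric])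
    also have "\<dots> = exp (X * (\<xi> + 1 / \<xi>)) / \<xi> ^ Suc k" 
      by (simp add: exp_add distrib_left)
    finally show ?thesis .
  qed
  have partial: "((\<lambda>\<xi>. \<Sum>b<n. F b \<xi>) has_contour_integral
      (\<Sum>b<n. (2 * pi * \<i>) * (X ^ (2 * b + k) / (fact b * fact (b + k))))) (circlepath 0 r)" for n
    by (intro has_contour_integral_sum FI) auto
  have pint: "\<forall>\<^sub>F n in sequentially. (\<lambda>\<xi>. \<Sum>b<n. F b \<xi>) contour_integrable_on circlepath 0 r"
    by (intro always_eventually allI has_contour_integral_integrable[OF partial])
  note lims = contour_integral_uniform_limit_circlepath[OF pint ul _ r]
  have int: "(\<lambda>\<xi>. suminf (\<lambda>b. F b \<xi>)) contour_integrable_on circlepath 0 r"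
    by (rule lims) simp
  have "(\<lambda>n. contour_integral (circlepath 0 r) (\<lambda>\<xi>. \<Sum>b<n. F b \<xi>)) \<longlonglongrightarrow>
      contour_integral (circlepath 0 r) (\<lambda>\<xi>. suminf (\<lambda>b. F b \<xi>))"
    by (rule lims) simp
  then have "(\<lambda>b. (2 * pi * \<i>) * (X ^ (2 * b + k) / (fact b * fact (b + k)))) sums
      contour_integral (circlepath 0 r) (\<lambda>\<xi>. suminf (\<lambda>b. F b \<xi>))"
    unfolding sums_def contour_integral_unique[OF partial] .
  from sums_mult[OF this, of "1 / (2 * pi * \<i>)"]
  have "bessel_coeff X k = contour_integral (circlepath 0 r) (\<lambda>\<xi>. suminf (\<lambda>b. F b \<xi>)) / (2 * pi * \<i>)"
    unfolding bessel_coeff_def by (intro sums_unique[symmetric]) simp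
  moreover have "cmod (contour_integral (circlepath 0 r) (\<lambda>\<xi>. suminf (\<lambda>b. F b \<xi>))) \<le> M / r ^ Suc k * (2 * pi * r)"
  proof (rule has_contour_integral_bound_circlepath[OF has_contour_integral_integral[OF int]])
    have "0 \<le> M" using order_trans[OF norm_ge_zero M[of "of_real r"]] r by simp
    then show "0 \<le> M / r ^ Suc k" using r by simp
    fix x assume "cmod (x - 0) = r"
    then show "cmod (\<Sum>b. F b x) \<le> M / r ^ Suc k"
      using M[of x] r by (simp add: lim norm_divide norm_power del: norm_exp_eq_Re power_Suc) (simp add: divide_right_mono norm_exp_eq_Re norm_mult norm_power)
  qed (rule r)
  moreover have "M / r ^ Suc k * (2 * pi * r) = M / r ^ k * (2 * pi)" using r by simp
  ultimately show ?thesis by (simp add: norm_divide norm_mult pos_divide_le_eq del: power_Suc)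
qed

text \<open>The derivative of x - \<theta> sinh x at 0 is 1 - \<theta>. Here a type strictly below
  one becomes a positive rate of decay.\<close>

lemma sinh_less_mult:
  fixes \<theta> :: real
  assumes "0 < \<theta>" "\<theta> < 1"
  obtains x where "x > 0" "\<theta> * sinh x < x"
proof -
  have "((\<lambda>x. x - \<theta> * sinh x) has_real_derivative (1 - \<theta> * cosh 0)) (at 0)"
    by (auto intro!: derivative_eq_intros)
  from DERIV_pos_inc_right[OF this] assms obtain d where d: "d > 0"
    "\<And>h. 0 < h \<Longrightarrow> h < d \<Longrightarrow> 0 < h - \<theta> * sinh h" by auto
  show thesis using d(2)[of "d/2"] d(1) that[of "d/2"] by auto
qed

text \<open>The truncated Chebyshev expansion, estimated on an ellipse slightly larger than \<open>[-1, 1]\<close>.\<close>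

lemma chebyshev_exp_approx:
  fixes \<theta> :: real
  assumes \<theta>: "0 < \<theta>" "\<theta> < 1"
  obtains R \<kappa> A where "R > 1" "\<kappa> > 0" "A > 0"
    "\<And>n. \<exists>\<Lambda> :: complex poly. degree \<Lambda> \<le> n \<and>
       (\<forall>s. cmod s = R \<longrightarrow>
         cmod (exp (\<i> * of_real (\<theta> * n) * joukowski s) - poly \<Lambda> (joukowski s)) \<le> A * exp (- \<kappa> * n))"
proof -
  obtain x where x: "x > 0" "\<theta> * sinh x < x" using sinh_less_mult[OF \<theta>] .
  \<comment> \<open>The coefficients are estimated on |s| = exp x and the Chebyshev polynomials on
    |s| = exp \<eta>. The tail is then of order exp (n (\<theta> sinh x + \<eta> - x)), and half of
    the gain x - \<theta> sinh x as \<open>\<eta>\<close> leaves exactly exp (- \<eta> n).\<close>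
  define \<eta> where "\<eta> = (x - \<theta> * sinh x) / 2"
  have "\<theta> * sinh x > 0" using x \<theta> by simp
  with x have \<eta>: "0 < \<eta>" "\<eta> < x" unfolding \<eta>_def by simp_all
  define q where "q = exp (\<eta> - x)"
  have q: "0 < q" "q < 1" using \<eta> by (auto simp: q_def)
  define A where "A = 2 / (1 - q)"
  show thesis
  proof
    show "exp \<eta> > 1" "\<eta> > 0" "A > 0" using \<eta> q by (auto simp: A_def)
    fix n :: nat
    \<comment> \<open>Since J(s) is half of s + 1/s, the exponent \<theta> n is halved too.\<close>
    define X where "X = \<i> * of_real (\<theta> * n) / 2"
    obtain p :: "nat \<Rightarrow> complex poly" where p: "\<And>k. degree (p k) \<le> k"
      "\<And>k s. s \<noteq> 0 \<Longrightarrow> poly (p k) (joukowski s) = s ^ k + 1 / s ^ k"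
      using joukowski_power_poly by metis
    define \<Lambda> where "\<Lambda> = [:bessel_coeff X 0:] + (\<Sum>k<n. smult (bessel_coeff X (Suc k)) (p (Suc k)))"
    have "degree \<Lambda> \<le> n"
      unfolding \<Lambda>_def
      by (intro degree_add_le degree_sum_le) (auto intro: order_trans[OF degree_smult_le] order_trans[OF p(1)])
    moreover have "cmod (exp (\<i> * of_real (\<theta> * n) * joukowski s) - poly \<Lambda> (joukowski s)) \<le> A * exp (- \<eta> * n)"
      if s: "cmod s = exp \<eta>" for s
    proof -
      have nz: "s \<noteq> 0" using s by auto
      have e: "exp (X * (s + 1 / s)) = exp (\<i> * of_real (\<theta> * n) * joukowski s)"
        by (simp add: X_def joukowski_def)
      define c where "c k = bessel_coeff X (Suc k) * (s ^ Suc k + 1 / s ^ Suc k)" for k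
      have "c sums (exp (\<i> * of_real (\<theta> * n) * joukowski s) - bessel_coeff X 0)"
        unfolding c_def e[symmetric] by (rule exp_joukowski_sums[OF nz])
      from sums_split_initial_segment[OF this, of n]
      have tail: "(\<lambda>k. c (k + n)) sums (exp (\<i> * of_real (\<theta> * n) * joukowski s) - poly \<Lambda> (joukowski s))"
        by (simp add: \<Lambda>_def poly_sum p(2)[OF nz] c_def algebra_simps del: power_Suc)
      define S where "S = exp (\<theta> * n * sinh x)"
      \<comment> \<open>On |z| = exp x the real part of X (z + 1/z) is - \<theta> n / 2 times Im z
        (1 - exp (- 2 x)), hence at most \<theta> n sinh x.\<close>
      have bes: "cmod (bessel_coeff X k) \<le> S / exp x ^ k" for k
      proof (rule norm_bessel_coeff_le)
        fix z assume z: "cmod z = exp x"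
        then have "z \<noteq> 0" by auto
        have "1 / z = cnj z / of_real ((cmod z)\<^sup>2)"
          using \<open>z \<noteq> 0\<close> by (simp add: complex_norm_square divide_simps del: of_real_power)
        then have "Im (1 / z) = - Im z / (exp x)\<^sup>2" by (simp add: z Im_divide_of_real del: of_real_power)
        then have "Re (X * (z + 1 / z)) = - (\<theta> * n / 2) * (Im z - Im z / (exp x)\<^sup>2)"
          by (simp add: X_def)
        also have "\<dots> \<le> \<theta> * n / 2 * (\<bar>Im z\<bar> * (1 - 1 / (exp x)\<^sup>2))"
        proof -
          have "1 - 1 / (exp x)\<^sup>2 \<ge> 0" using x by simp
          then have "- (Im z * (1 - 1 / (exp x)\<^sup>2)) \<le> \<bar>Im z\<bar> * (1 - 1 / (exp x)\<^sup>2)"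
            by (metis abs_ge_minus_self abs_mult abs_of_nonneg)
          then have "\<theta> * n / 2 * - (Im z * (1 - 1 / (exp x)\<^sup>2)) \<le> \<theta> * n / 2 * (\<bar>Im z\<bar> * (1 - 1 / (exp x)\<^sup>2))"
            using \<theta> by (intro mult_left_mono) auto
          then show ?thesis by (simp add: algebra_simps)
        qed
        also have "\<dots> \<le> \<theta> * n / 2 * (exp x * (1 - 1 / (exp x)\<^sup>2))"
          using abs_Im_le_cmod[of z] z \<theta> x by (intro mult_left_mono mult_right_mono) auto
        also have "exp x * (1 - 1 / (exp x)\<^sup>2) = 2 * sinh x"
          by (simp add: sinh_field_def exp_minus field_simps power2_eq_square)
        finally show "cmod (exp (X * (z + 1 / z))) \<le> S" by (simp add: S_def)
      qed simp
      have R1: "1 \<le> exp \<eta>" using \<eta> by simp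
      have cb: "cmod (c k) \<le> 2 * S * q ^ Suc k" for k
      proof -
        have "cmod (s ^ Suc k + 1 / s ^ Suc k) \<le> cmod (s ^ Suc k) + cmod (1 / s ^ Suc k)" by (rule norm_triangle_ineq)
        also have "\<dots> = exp \<eta> ^ Suc k + 1 / exp \<eta> ^ Suc k" by (simp only: norm_divide norm_power s norm_one)
        also have "1 / exp \<eta> ^ Suc k \<le> exp \<eta> ^ Suc k"
          using one_le_power[OF R1, of "Suc k"] by (metis divide_le_eq_1 dual_order.trans zero_less_one less_le_trans)
        finally have "cmod (s ^ Suc k + 1 / s ^ Suc k) \<le> 2 * exp \<eta> ^ Suc k" by simp
        then have "cmod (c k) \<le> S / exp x ^ Suc k * (2 * exp \<eta> ^ Suc k)"
          unfolding c_def norm_mult by (intro mult_mono bes) (auto simp: S_def)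
        also have "\<dots> = 2 * S * (exp \<eta> / exp x) ^ Suc k" by (simp only: power_divide) simp
        finally show ?thesis by (simp only: q_def exp_diff)
      qed
      have gs: "(\<lambda>k. 2 * S * q ^ Suc (k + n)) sums (2 * S * q ^ Suc n * (1 / (1 - q)))"
      proof -
        have "(\<lambda>k. q ^ k) sums (1 / (1 - q))" using q by (intro geometric_sums) auto
        from sums_mult[OF this, of "2 * S * q ^ Suc n"] show ?thesis by (simp add: power_add mult_ac)
      qed
      have "cmod (exp (\<i> * of_real (\<theta> * n) * joukowski s) - poly \<Lambda> (joukowski s)) = cmod (\<Sum>k. c (k + n))"
        by (simp only: sums_unique[OF tail])
      also have "\<dots> \<le> (\<Sum>k. 2 * S * q ^ Suc (k + n))"
        by (intro norm_suminf_le cb sums_summable[OF gs])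
      also have "\<dots> = 2 * S * q ^ Suc n * (1 / (1 - q))" using gs by (rule sums_unique[symmetric])
      also have "\<dots> \<le> 2 * S * q ^ n * (1 / (1 - q))"
        using q by (intro mult_right_mono mult_left_mono power_decreasing) (auto simp: S_def)
      also have "\<dots> = A * (S * q ^ n)" by (simp add: A_def)
      also have "S * q ^ n = exp (- \<eta> * n)"
        unfolding S_def q_def exp_of_nat_mult[symmetric] exp_add[symmetric]
        by (simp add: \<eta>_def algebra_simps)
      finally show ?thesis .
    qed
    ultimately show "\<exists>\<Lambda> :: complex poly. degree \<Lambda> \<le> n \<and>
       (\<forall>s. cmod s = exp \<eta> \<longrightarrow>
         cmod (exp (\<i> * of_real (\<theta> * n) * joukowski s) - poly \<Lambda> (joukowski s)) \<le> A * exp (- \<eta> * n))"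
      by blast
  qed
qed

section \<open>Borel and Laplace transforms\<close>

text \<open>A crude Stirling bound; the induction step is e \<le> (1 + 1/j)^(j + 1). The factor j
  would do for positive j, and j + 1 also covers j = 0.\<close>

lemma fact_exp_le: "fact j * exp (real j) \<le> exp 1 * (real j + 1) * real j ^ j"
proof -
  have "fact (Suc j) * exp (real (Suc j)) \<le> exp 1 * real (Suc j) * real (Suc j) ^ Suc j" for j
  proof (induction j)
    case 0
    then show ?case by simp
  next
    case (Suc j)
    let ?x = "real (Suc j)"
    have "exp 1 \<le> ((?x + 1) / ?x) ^ Suc (Suc j)"
    proof -
      have "ln (?x / (?x + 1)) \<le> ?x / (?x + 1) - 1" by (rule ln_le_minus_one) auto
      also have "ln (?x / (?x + 1)) = - ln ((?x + 1) / ?x)" by (simp add: ln_div)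
      finally have "1 \<le> (?x + 1) * ln ((?x + 1) / ?x)" by (simp add: field_simps)
      then have "exp 1 \<le> exp (real (Suc (Suc j)) * ln ((?x + 1) / ?x))" by simp
      also have "\<dots> = ((?x + 1) / ?x) ^ Suc (Suc j)" unfolding exp_of_nat_mult by (simp del: power_Suc)
      finally show ?thesis .
    qed
    then have *: "exp 1 * ?x ^ Suc (Suc j) \<le> (?x + 1) ^ Suc (Suc j)"
      by (simp only: power_divide) (simp add: pos_le_divide_eq del: power_Suc)
    have "fact (Suc (Suc j)) * exp (real (Suc (Suc j))) = (?x + 1) * exp 1 * (fact (Suc j) * exp ?x)"
    proof -
      have "exp (real (Suc (Suc j))) = exp 1 * exp ?x" by (simp flip: exp_add)
      then show ?thesis by (simp add: fact_Suc[of "Suc j"] mult_ac del: fact_Suc)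
    qed
    also have "\<dots> \<le> (?x + 1) * exp 1 * (exp 1 * ?x * ?x ^ Suc j)"
      by (rule mult_left_mono[OF Suc.IH]) auto
    also have "\<dots> = (?x + 1) * exp 1 * (exp 1 * ?x ^ Suc (Suc j))" by (simp add: mult_ac)
    also have "\<dots> \<le> (?x + 1) * exp 1 * (?x + 1) ^ Suc (Suc j)"
      by (rule mult_left_mono[OF *]) auto
    finally show ?case by (simp add: algebra_simps)
  qed note pos = this
  show ?thesis
  proof (cases j)
    case 0
    then show ?thesis by simp
  next
    case (Suc i)
    have "exp 1 * real j * real j ^ j \<le> exp 1 * (real j + 1) * real j ^ j"
      by (intro mult_right_mono mult_left_mono) auto
    with pos[of i] Suc show ?thesis using order_trans by blast
  qed
qed

text \<open>Cauchy's inequality on the circle of radius j / \<sigma>, which minimises exp (\<sigma>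
  r) / r^j, followed by the Stirling bound. The factor j + 1 does not affect the region of
  convergence of the Borel series. For j = 0 the optimal radius degenerates, hence the separate
  case.\<close>

lemma exp_type_higher_deriv_bound:
  assumes hol: "h holomorphic_on UNIV" and \<sigma>: "0 < \<sigma>"
    and growth: "\<And>z. cmod (h z) \<le> C * exp (\<sigma> * cmod z)"
  shows "cmod ((deriv ^^ j) h w) \<le> C * exp 1 * (real j + 1) * \<sigma> ^ j * exp (\<sigma> * cmod w)"
proof -
  have C: "0 \<le> C" using growth[of 0] order_trans[OF norm_ge_zero] by fastforce
  show ?thesis
  proof (cases "j = 0")
    case True
    have "C * exp (\<sigma> * cmod w) \<le> C * exp 1 * exp (\<sigma> * cmod w)"
      using C by (intro mult_right_mono mult_right_mono[of 1 _ C, simplified]) (auto simp: mult_le_cancel_left1)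
    with growth[of w] True show ?thesis by simp
  next
    case False
    define r where "r = real j / \<sigma>"
    have r: "r > 0" using False \<sigma> by (simp add: r_def)
    have "cmod ((deriv ^^ j) h w) \<le> fact j * (C * exp (\<sigma> * (r + cmod w))) / r ^ j"
    proof (rule Cauchy_inequality)
      fix x assume "cmod (w - x) = r"
      then have "cmod x \<le> r + cmod w"
        by (metis norm_triangle_sub norm_minus_commute add.commute)
      then have "exp (\<sigma> * cmod x) \<le> exp (\<sigma> * (r + cmod w))" using \<sigma> by simp
      with growth[of x] C show "cmod (h x) \<le> C * exp (\<sigma> * (r + cmod w))"
        by (meson mult_left_mono order_trans)
    qed (use hol r in \<open>auto intro: holomorphic_on_subset holomorphic_on_imp_continuous_on\<close>)
    also have "\<dots> = C * exp (\<sigma> * cmod w) * (fact j * exp (real j)) * \<sigma> ^ j / real j ^ j"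
    proof -
      have "\<sigma> * (r + cmod w) = real j + \<sigma> * cmod w" using \<sigma> by (simp add: r_def field_simps)
      then show ?thesis by (simp add: r_def power_divide exp_add)
    qed
    also have "\<dots> \<le> C * exp (\<sigma> * cmod w) * (exp 1 * (real j + 1) * real j ^ j) * \<sigma> ^ j / real j ^ j"
      using C \<sigma> by (intro divide_right_mono mult_right_mono mult_left_mono fact_exp_le) auto
    also have "\<dots> = C * exp 1 * (real j + 1) * \<sigma> ^ j * exp (\<sigma> * cmod w)"
      using False by simp
    finally show ?thesis .
  qed
qed

lemma summable_Suc_mult_power:
  assumes "0 \<le> (q::real)" "q < 1"
  shows "summable (\<lambda>j. (real j + 1) * q ^ j)"
proof -
  have "summable (\<lambda>n. diffs (\<lambda>n. 1) n * q ^ n)"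
  proof (rule termdiff_converges[where K = 1])
    show "summable (\<lambda>n. 1 * x ^ n)" if "norm x < 1" for x :: real
      using that by (simp add: summable_geometric)
  qed (use assms in auto)
  then show ?thesis by (simp add: diffs_def add.commute)
qed

text \<open>The expansion at infinity of the Borel transform of \<open>h\<close>; for type \<sigma>
  it converges outside the closed disc of radius \<sigma>.\<close>

definition borel_series :: "(complex \<Rightarrow> complex) \<Rightarrow> complex \<Rightarrow> complex" where
  "borel_series h x = (\<Sum>j. (deriv ^^ j) h 0 / x ^ Suc j)"

context
  fixes h :: "complex \<Rightarrow> complex" and C \<sigma> :: real
  assumes hol: "h holomorphic_on UNIV" and \<sigma>: "0 < \<sigma>"
    and growth: "\<And>z. cmod (h z) \<le> C * exp (\<sigma> * cmod z)"
begin

lemma C_nonneg: "0 \<le> C" using growth[of 0] order_trans[OF norm_ge_zero] by fastforce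

lemma borel_term_le:
  assumes "\<sigma> < s" "s \<le> cmod x"
  shows "cmod ((deriv ^^ j) h 0 / x ^ Suc j) \<le> C * exp 1 / s * ((real j + 1) * (\<sigma> / s) ^ j)"
proof -
  have s: "s > 0" using assms \<sigma> by auto
  have "cmod ((deriv ^^ j) h 0 / x ^ Suc j) = cmod ((deriv ^^ j) h 0) / cmod x ^ Suc j"
    by (simp only: norm_divide norm_power)
  also have "\<dots> \<le> (C * exp 1 * (real j + 1) * \<sigma> ^ j) / s ^ Suc j"
    using exp_type_higher_deriv_bound[OF hol \<sigma> growth, of j 0] assms s C_nonneg \<sigma>
    by (intro frac_le power_mono) auto
  finally show ?thesis by (simp add: power_divide mult_ac)
qed

lemma summable_borel_bound:
  assumes "\<sigma> < s"
  shows "summable (\<lambda>j. C * exp 1 / s * ((real j + 1) * (\<sigma> / s) ^ j))"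
  using assms \<sigma> by (intro summable_mult summable_Suc_mult_power) auto

lemma borel_series_sums:
  assumes "\<sigma> < cmod x"
  shows "(\<lambda>j. (deriv ^^ j) h 0 / x ^ Suc j) sums borel_series h x"
  unfolding borel_series_def
  using summable_comparison_test'[OF summable_borel_bound[OF assms] borel_term_le[OF assms order_refl]]
  by (rule summable_sums)

lemma borel_series_bound:
  assumes "\<sigma> < s" "s \<le> cmod x"
  shows "cmod (borel_series h x) \<le> (\<Sum>j. C * exp 1 / s * ((real j + 1) * (\<sigma> / s) ^ j))"
  unfolding borel_series_def
  by (intro norm_suminf_le borel_term_le summable_borel_bound assms)

lemma borel_series_uniform:
  assumes "\<sigma> < s" 
  shows "uniform_limit {x. s \<le> cmod x} (\<lambda>n x. \<Sum>j<n. (deriv ^^ j) h 0 / x ^ Suc j) (borel_series h) sequentially"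
  unfolding borel_series_def[abs_def]
  by (intro Weierstrass_m_test[OF _ summable_borel_bound[OF assms]]) (use borel_term_le[OF assms] in auto)

lemma borel_series_holomorphic: "borel_series h holomorphic_on {x. \<sigma> < cmod x}"
proof (rule holomorphic_uniform_sequence)
  show "open {x. \<sigma> < cmod x}" by (intro open_Collect_less continuous_intros)
  show "(\<lambda>x. \<Sum>j<n. (deriv ^^ j) h 0 / x ^ Suc j) holomorphic_on {x. \<sigma> < cmod x}" for n
    using \<sigma> by (intro holomorphic_intros) auto
  fix x assume x: "x \<in> {x. \<sigma> < cmod x}"
  define d where "d = (cmod x - \<sigma>) / 2"
  have sub: "(\<sigma> + d) \<le> cmod y" if "y \<in> cball x d" for y
  proof -
    have "cmod x - cmod y \<le> d" using that norm_triangle_ineq2[of x y] by (auto simp: dist_norm)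
    then show ?thesis by (simp add: d_def field_simps)
  qed
  have d: "d > 0" using x by (simp add: d_def)
  have "uniform_limit (cball x d) (\<lambda>n x. \<Sum>j<n. (deriv ^^ j) h 0 / x ^ Suc j) (borel_series h) sequentially"
    using sub d by (intro uniform_limit_on_subset[OF borel_series_uniform[of "\<sigma> + d"]]) auto
  moreover have "cball x d \<subseteq> {x. \<sigma> < cmod x}" using sub d by fastforce
  ultimately show "\<exists>d>0. cball x d \<subseteq> {x. \<sigma> < cmod x} \<and>
      uniform_limit (cball x d) (\<lambda>n x. \<Sum>j<n. (deriv ^^ j) h 0 / x ^ Suc j) (borel_series h) sequentially"
    using d by blast
qed

end

section \<open>Laplace integrals along the imaginary axis\<close>

text \<open>The integral of h(w) exp (- w x) dw over the segment from 0 to i n, parametrised by w =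
  i u.\<close>

definition laplace_partial :: "(complex \<Rightarrow> complex) \<Rightarrow> nat \<Rightarrow> complex \<Rightarrow> complex" where
  "laplace_partial h n x =
     integral {0..real n} (\<lambda>u. \<i> * h (\<i> * of_real u) * exp (- \<i> * of_real u * x))"

lemma norm_integral_exp_le:
  fixes f :: "real \<Rightarrow> complex"
  assumes f: "continuous_on {a..b} f" and ab: "a \<le> b" and \<delta>: "0 < \<delta>"
    and bound: "\<And>u. u \<in> {a..b} \<Longrightarrow> cmod (f u) \<le> M * exp (- \<delta> * u)"
  shows "cmod (integral {a..b} f) \<le> M * (exp (- \<delta> * a) - exp (- \<delta> * b)) / \<delta>"
proof -
  have I: "((\<lambda>u. M * exp (- \<delta> * u)) has_integral
      (- M * exp (- \<delta> * b) / \<delta> - (- M * exp (- \<delta> * a) / \<delta>))) {a..b}"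
    using ab \<delta> by (intro fundamental_theorem_of_calculus)
      (auto intro!: derivative_eq_intros simp: has_real_derivative_iff_has_vector_derivative[symmetric])
  have "cmod (integral {a..b} f) \<le> integral {a..b} (\<lambda>u. M * exp (- \<delta> * u))"
    by (rule integral_norm_bound_integral)
      (use bound I in \<open>auto intro: integrable_continuous_interval f has_integral_integrable\<close>)
  also have "\<dots> = M * (exp (- \<delta> * a) - exp (- \<delta> * b)) / \<delta>"
    using integral_unique[OF I] by (simp add: diff_divide_distrib algebra_simps)
  finally show ?thesis .
qed

context
  fixes h :: "complex \<Rightarrow> complex" and M :: real
  assumes hol: "h holomorphic_on UNIV"
    and M: "\<And>y. cmod (h (\<i> * of_real y)) \<le> M"
begin

private definition K where "K x u = \<i> * h (\<i> * of_real u) * exp (- \<i> * of_real u * x)"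

lemma cont_h: "continuous_on A h"
  using hol holomorphic_on_imp_continuous_on continuous_on_subset by blast

lemma K_cont: "continuous_on A (K x)"
  unfolding K_def by (intro continuous_intros continuous_on_compose2[OF cont_h[of UNIV]]) auto

lemma K_bound: "cmod (K x u) \<le> M * exp (- (- Im x) * u)"
  using M[of u] by (simp add: K_def norm_mult mult_right_mono mult.commute)

lemma laplace_partial_holomorphic: "laplace_partial h n holomorphic_on UNIV"
  unfolding laplace_partial_def[abs_def] cbox_interval[symmetric]
proof (rule leibniz_rule_holomorphic)
  show "((\<lambda>x. \<i> * h (\<i> * of_real u) * exp (- \<i> * of_real u * x)) has_field_derivative
      \<i> * h (\<i> * of_real u) * exp (- \<i> * of_real u * x) * (- \<i> * of_real u)) (at x within UNIV)" for x u
    by (auto intro!: derivative_eq_intros)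
  show "(\<lambda>u. \<i> * h (\<i> * of_real u) * exp (- \<i> * of_real u * x)) integrable_on cbox 0 (real n)" for x
    using integrable_continuous[OF K_cont] unfolding K_def .
  show "continuous_on (UNIV \<times> cbox 0 (real n))
     (\<lambda>(x, u). \<i> * h (\<i> * of_real u) * exp (- \<i> * of_real u * x) * (- \<i> * of_real u))"
    unfolding case_prod_beta
    by (intro continuous_intros continuous_on_compose2[OF cont_h[of UNIV]]) auto
qed auto

text \<open>The tail of an integrand bounded by M exp (- \<delta> u). Uniformity in the half-plane
  yields holomorphy of the limit, and \<open>m = 0\<close> yields the bound M / |Im x| up to the
  real axis.\<close>

lemma laplace_partial_diff:
  assumes "0 < \<delta>" "Im x \<le> - \<delta>" "m \<le> n"
  shows "cmod (laplace_partial h n x - laplace_partial h m x) \<le> M * exp (- \<delta> * real m) / \<delta>"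
proof -
  have M0: "0 \<le> M" using order_trans[OF norm_ge_zero M] .
  have "integral {0..real n} (K x) = integral {0..real m} (K x) + integral {real m..real n} (K x)"
    using assms by (subst Henstock_Kurzweil_Integration.integral_combine)
      (auto intro: integrable_continuous_interval K_cont)
  then have "laplace_partial h n x - laplace_partial h m x = integral {real m..real n} (K x)"
    by (simp add: laplace_partial_def K_def[abs_def])
  also have "cmod \<dots> \<le> M * (exp (- \<delta> * real m) - exp (- \<delta> * real n)) / \<delta>"
  proof (rule norm_integral_exp_le[OF K_cont _ assms(1)])
    fix u assume "u \<in> {real m..real n}"
    then have "- (- Im x) * u \<le> - \<delta> * u" using assms by (intro mult_right_mono) auto
    then have "M * exp (- (- Im x) * u) \<le> M * exp (- \<delta> * u)" using M0 by (intro mult_left_mono) auto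
    with K_bound[of x u] show "cmod (K x u) \<le> M * exp (- \<delta> * u)" by linarith
  qed (use assms in auto)
  also have "\<dots> \<le> M * exp (- \<delta> * real m) / \<delta>"
    using assms M0 by (intro divide_right_mono mult_left_mono) auto
  finally show ?thesis .
qed

definition laplace :: "complex \<Rightarrow> complex" where "laplace x = lim (\<lambda>n. laplace_partial h n x)"

lemma uniformly_convergent_laplace:
  assumes \<delta>: "0 < \<delta>"
  shows "uniform_limit {x. Im x \<le> - \<delta>} (laplace_partial h) laplace sequentially"
proof -
  have M0: "0 \<le> M" using order_trans[OF norm_ge_zero M] .
  have "uniformly_Cauchy_on {x. Im x \<le> - \<delta>} (laplace_partial h)"
  proof (rule uniformly_Cauchy_onI')
    fix e :: real assume e: "e > 0"
    have "(\<lambda>m. M * exp (- \<delta> * real m) / \<delta>) \<longlonglongrightarrow> 0"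
      using \<delta> by real_asymp
    then have "eventually (\<lambda>m. M * exp (- \<delta> * real m) / \<delta> < e) sequentially"
      using e by (rule order_tendstoD)
    then obtain N where N: "M * exp (- \<delta> * real m) / \<delta> < e" if "m \<ge> N" for m
      by (auto simp: eventually_sequentially)
    have "dist (laplace_partial h m x) (laplace_partial h n x) < e"
      if "x \<in> {x. Im x \<le> - \<delta>}" "m \<ge> N" "n > m" for x m n
      using laplace_partial_diff[OF \<delta>, of x m n] N[OF that(2)] that
      by (simp add: dist_norm norm_minus_commute)
    then show "\<exists>N. \<forall>x\<in>{x. Im x \<le> - \<delta>}. \<forall>m\<ge>N. \<forall>n>m. dist (laplace_partial h m x) (laplace_partial h n x) < e"
      by blast
  qed
  then have "uniformly_convergent_on {x. Im x \<le> - \<delta>} (laplace_partial h)"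
    by (rule Cauchy_uniformly_convergent)
  then show ?thesis unfolding uniformly_convergent_uniform_limit_iff laplace_def[abs_def] .
qed

lemma laplace_holomorphic: "laplace holomorphic_on {x. Im x < 0}"
proof (rule holomorphic_uniform_sequence)
  show "open {x. Im x < 0}" by (rule open_halfspace_Im_lt)
  show "laplace_partial h n holomorphic_on {x. Im x < 0}" for n
    using laplace_partial_holomorphic holomorphic_on_subset by blast
  fix x assume x: "x \<in> {x. Im x < 0}"
  define d where "d = - Im x / 2"
  have d: "d > 0" using x by (simp add: d_def)
  have sub: "cball x d \<subseteq> {x. Im x \<le> - d}"
  proof
    fix y assume "y \<in> cball x d"
    then have "cmod (y - x) \<le> d" by (simp add: dist_norm norm_minus_commute)
    then have "Im (y - x) \<le> d" using abs_Im_le_cmod[of "y - x"] by linarith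
    then show "y \<in> {x. Im x \<le> - d}" by (simp add: d_def)
  qed
  show "\<exists>d>0. cball x d \<subseteq> {x. Im x < 0} \<and> uniform_limit (cball x d) (laplace_partial h) laplace sequentially"
    using d sub by (intro exI[of _ d] conjI uniform_limit_on_subset[OF uniformly_convergent_laplace[OF d]]) auto
qed

lemma laplace_tendsto:
  assumes "Im x < 0"
  shows "(\<lambda>n. laplace_partial h n x) \<longlonglongrightarrow> laplace x"
  using tendsto_uniform_limitI[OF uniformly_convergent_laplace[of "- Im x"], of x] assms by simp

lemma laplace_bound:
  assumes "Im x < 0"
  shows "cmod (laplace x) \<le> M / \<bar>Im x\<bar>"
proof (rule tendsto_le[OF _ tendsto_const tendsto_norm[OF laplace_tendsto[OF assms]]])
  have "cmod (laplace_partial h n x) \<le> M / \<bar>Im x\<bar>" for n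
    using laplace_partial_diff[of "- Im x" x 0 n] assms by (simp add: laplace_partial_def)
  then show "\<forall>\<^sub>F n in sequentially. cmod (laplace_partial h n x) \<le> M / \<bar>Im x\<bar>" by simp
qed simp

end

text \<open>\<open>J\<close> integrations by parts in one stroke: the function - exp (- i u x) S(i
  u) is a primitive of the integrand up to the remainder, because x S - S' telescopes to h minus the
  J-th derivative over x^J.\<close>

lemma laplace_partial_by_parts:
  fixes x :: complex and J :: nat
  assumes hol: "h holomorphic_on UNIV" and x: "x \<noteq> 0"
  defines "S \<equiv> \<lambda>w. \<Sum>j<J. (deriv ^^ j) h w / x ^ Suc j"
  shows "laplace_partial h n x = S 0 - exp (- \<i> * of_real n * x) * S (\<i> * of_real n) +
    integral {0..real n} (\<lambda>u. \<i> * exp (- \<i> * of_real u * x) * ((deriv ^^ J) h (\<i> * of_real u) / x ^ J))"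
proof -
  have hd: "((deriv ^^ j) h has_field_derivative (deriv ^^ Suc j) h w) (at w)" for j w
    using holomorphic_derivI[OF holomorphic_higher_deriv[OF hol open_UNIV] open_UNIV, of w] by simp
  have hdc: "continuous_on A ((deriv ^^ j) h)" for A j
    by (intro holomorphic_on_imp_continuous_on holomorphic_on_subset[OF holomorphic_higher_deriv[OF hol open_UNIV]]) auto
  define S' where "S' w = (\<Sum>j<J. (deriv ^^ Suc j) h w / x ^ Suc j)" for w
  have dS: "(S has_field_derivative S' w) (at w)" for w
    unfolding S_def S'_def by (intro DERIV_sum DERIV_cdivide hd)
  have tele: "x * S w - S' w = h w - (deriv ^^ J) h w / x ^ J" for w
  proof -
    have "x * S w = (\<Sum>j<J. (deriv ^^ j) h w / x ^ j)"
      unfolding S_def sum_distrib_left using x by (intro sum.cong) auto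
    then have "x * S w - S' w = (\<Sum>j<J. (deriv ^^ j) h w / x ^ j - (deriv ^^ Suc j) h w / x ^ Suc j)"
      by (simp only: S'_def sum_subtractf)
    also have "\<dots> = (deriv ^^ 0) h w / x ^ 0 - (deriv ^^ J) h w / x ^ J"
      by (rule sum_lessThan_telescope')
    finally show ?thesis by simp
  qed
  define E where "E u = exp (- \<i> * of_real u * x)" for u :: real
  define g where "g v = - exp (- \<i> * v * x) * S (\<i> * v)" for v
  define R where "R u = \<i> * E u * ((deriv ^^ J) h (\<i> * of_real u) / x ^ J)" for u
  define F where "F u = \<i> * h (\<i> * of_real u) * E u" for u
  have dg: "((\<lambda>u. g (of_real u)) has_vector_derivative (F u - R u)) (at u within A)" for u A
  proof (rule has_vector_derivative_real_field)
    let ?v = "complex_of_real u"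
    have "((\<lambda>v. S (\<i> * v)) has_field_derivative S' (\<i> * ?v) * \<i>) (at ?v)"
      by (rule DERIV_chain2[OF dS]) (auto intro!: derivative_eq_intros)
    moreover have "((\<lambda>v. - exp (- \<i> * v * x)) has_field_derivative \<i> * x * exp (- \<i> * ?v * x)) (at ?v)"
      by (auto intro!: derivative_eq_intros)
    ultimately show "(g has_field_derivative F u - R u) (at ?v)"
    proof -
      assume S1: "((\<lambda>v. S (\<i> * v)) has_field_derivative S' (\<i> * ?v) * \<i>) (at ?v)"
        and E1: "((\<lambda>v. - exp (- \<i> * v * x)) has_field_derivative \<i> * x * exp (- \<i> * ?v * x)) (at ?v)"
      have "- exp (- \<i> * ?v * x) * (S' (\<i> * ?v) * \<i>) + \<i> * x * exp (- \<i> * ?v * x) * S (\<i> * ?v)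
          = \<i> * E u * (x * S (\<i> * ?v) - S' (\<i> * ?v))"
        by (simp add: E_def algebra_simps)
      also have "\<dots> = F u - R u" unfolding tele F_def R_def by (simp add: algebra_simps)
      finally show ?thesis using DERIV_mult'[OF E1 S1] unfolding g_def[abs_def] by simp
    qed
  qed
  have "((\<lambda>u. F u - R u) has_integral (g (of_real (real n)) - g (of_real 0))) {0..real n}"
    by (intro fundamental_theorem_of_calculus dg) auto
  moreover have "R integrable_on {0..real n}"
    unfolding R_def E_def using x
    by (intro integrable_continuous_interval continuous_intros continuous_on_compose2[OF hdc[of UNIV]]) auto
  ultimately have "((\<lambda>u. F u - R u + R u) has_integral
      (g (of_real (real n)) - g (of_real 0) + integral {0..real n} R)) {0..real n}"
    by (intro has_integral_add integrable_integral)
  then have "integral {0..real n} F = g (of_real (real n)) - g (of_real 0) + integral {0..real n} R"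
    by (intro integral_unique) simp
  then show ?thesis
    unfolding laplace_partial_def F_def[abs_def] R_def[abs_def] E_def[abs_def] g_def by simp
qed

text \<open>For Im x < - \<sigma> the kernel decays faster than any derivative of \<open>h\<close>
  grows. Letting n tend to infinity first removes the boundary term; letting J tend to infinity then
  removes the remainder, since |x| > \<sigma>.\<close>

lemma laplace_eq_borel_series_far:
  assumes hol: "h holomorphic_on UNIV" and \<sigma>: "0 < \<sigma>"
    and growth: "\<And>z. cmod (h z) \<le> C * exp (\<sigma> * cmod z)"
    and M: "\<And>y. cmod (h (\<i> * of_real y)) \<le> M"
    and x: "Im x < - \<sigma>"
  shows "laplace h x = borel_series h x"
proof -
  have C: "0 \<le> C" by (rule C_nonneg[OF hol \<sigma> growth])
  have nz: "x \<noteq> 0" using x \<sigma> by auto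
  define \<delta> where "\<delta> = - Im x - \<sigma>"
  have \<delta>: "0 < \<delta>" using x by (simp add: \<delta>_def)
  have cx: "\<sigma> < cmod x" using abs_Im_le_cmod[of x] x \<sigma> by linarith
  define B where "B J = C * exp 1 * (real J + 1) * \<sigma> ^ J / cmod x ^ J" for J
  define S where "S J w = (\<Sum>j<J. (deriv ^^ j) h w / x ^ Suc j)" for J w
  have key: "cmod (laplace h x - S J 0) \<le> B J / \<delta>" for J
  proof -
    define k where "k = (\<Sum>j<J. C * exp 1 * (real j + 1) * \<sigma> ^ j / cmod x ^ Suc j)"
    have e: "cmod (exp (- \<i> * of_real u * x)) = exp (- (- Im x) * u)" for u
      by (simp add: mult.commute)
    have db: "cmod ((deriv ^^ j) h (\<i> * of_real u)) \<le> C * exp 1 * (real j + 1) * \<sigma> ^ j * exp (\<sigma> * u)"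
      if "u \<ge> 0" for u j
      using exp_type_higher_deriv_bound[OF hol \<sigma> growth, of j "\<i> * of_real u"] that
      by (simp add: norm_mult)
    have est: "cmod (laplace_partial h n x - S J 0) \<le> k * exp (- \<delta> * real n) + B J / \<delta>" for n
    proof -
      let ?R = "\<lambda>u. \<i> * exp (- \<i> * of_real u * x) * ((deriv ^^ J) h (\<i> * of_real u) / x ^ J)"
      have eq: "laplace_partial h n x - S J 0 =
          - (exp (- \<i> * of_real n * x) * S J (\<i> * of_real n)) + integral {0..real n} ?R"
        unfolding laplace_partial_by_parts[OF hol nz, of n J] S_def by simp
      have 1: "cmod (laplace_partial h n x - S J 0) \<le>
          cmod (exp (- \<i> * of_real n * x) * S J (\<i> * of_real n)) + cmod (integral {0..real n} ?R)"
        unfolding eq by (rule order_trans[OF norm_triangle_ineq]) simp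
      have 2: "cmod (exp (- \<i> * of_real n * x) * S J (\<i> * of_real n)) \<le> k * exp (- \<delta> * real n)"
      proof -
        have "cmod (S J (\<i> * of_real n)) \<le> (\<Sum>j<J. C * exp 1 * (real j + 1) * \<sigma> ^ j * exp (\<sigma> * n) / cmod x ^ Suc j)"
          unfolding S_def
        proof (intro sum_norm_le)
          fix j
          show "cmod ((deriv ^^ j) h (\<i> * of_real n) / x ^ Suc j) \<le> C * exp 1 * (real j + 1) * \<sigma> ^ j * exp (\<sigma> * n) / cmod x ^ Suc j"
            using db[of "real n" j] by (simp only: norm_divide norm_power) (intro divide_right_mono, auto)
        qed
        also have "\<dots> = k * exp (\<sigma> * n)" unfolding k_def sum_distrib_right by (intro sum.cong) auto
        finally have "cmod (S J (\<i> * of_real n)) \<le> k * exp (\<sigma> * n)" .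
        then have "exp (- (- Im x) * n) * cmod (S J (\<i> * of_real n)) \<le> exp (- (- Im x) * n) * (k * exp (\<sigma> * n))"
          by (intro mult_left_mono) auto
        also have "\<dots> = k * exp (- \<delta> * real n)" by (simp add: \<delta>_def algebra_simps flip: exp_add)
        finally show ?thesis unfolding norm_mult using e[of "real n"] by (simp add: mult.commute)
      qed
      have 3: "cmod (integral {0..real n} ?R) \<le> B J * (exp (- \<delta> * 0) - exp (- \<delta> * real n)) / \<delta>"
      proof (rule norm_integral_exp_le[OF _ _ \<delta>])
        have hdc: "continuous_on UNIV ((deriv ^^ J) h)"
          by (intro holomorphic_on_imp_continuous_on holomorphic_higher_deriv[OF hol open_UNIV])
        show "continuous_on {0..real n} ?R" using nz
          by (intro continuous_intros continuous_on_compose2[OF hdc]) auto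
        fix u assume "u \<in> {0..real n}"
        then have "cmod (?R u) \<le> exp (- (- Im x) * u) * (C * exp 1 * (real J + 1) * \<sigma> ^ J * exp (\<sigma> * u) / cmod x ^ J)"
          unfolding norm_mult norm_divide norm_power norm_ii mult_1 e using db[of u J]
          by (intro mult_left_mono divide_right_mono) auto
        also have "\<dots> = B J * exp (- \<delta> * u)" by (simp add: B_def \<delta>_def algebra_simps flip: exp_add)
        finally show "cmod (?R u) \<le> B J * exp (- \<delta> * u)" .
      qed auto
      have 4: "B J * (exp (- \<delta> * 0) - exp (- \<delta> * real n)) / \<delta> \<le> B J / \<delta>"
      proof -
        have "B J * (1 - exp (- \<delta> * real n)) \<le> B J * 1"
          using C \<sigma> by (intro mult_left_mono) (auto simp: B_def)
        then show ?thesis using \<delta> by (simp add: divide_right_mono)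
      qed
      show ?thesis using 1 2 3 4 by linarith
    qed
    have "(\<lambda>n. k * exp (- \<delta> * real n) + B J / \<delta>) \<longlonglongrightarrow> k * 0 + B J / \<delta>"
      using \<delta> by (intro tendsto_intros) real_asymp
    moreover have "(\<lambda>n. cmod (laplace_partial h n x - S J 0)) \<longlonglongrightarrow> cmod (laplace h x - S J 0)"
      using x \<sigma> by (intro tendsto_intros laplace_tendsto[OF hol M]) auto
    ultimately show ?thesis using est by (intro tendsto_le[of sequentially]) auto
  qed
  have "B \<longlonglongrightarrow> 0"
  proof -
    have "0 < cmod x" using nz by simp
    then have q: "\<sigma> / cmod x < 1" using cx by (subst pos_divide_less_eq) simp_all
    have q0: "0 \<le> \<sigma> / cmod x" using \<sigma> by simp
    have "summable (\<lambda>j. C * exp 1 * ((real j + 1) * (\<sigma> / cmod x) ^ j))"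
      by (rule summable_mult[OF summable_Suc_mult_power[OF q0 q]])
    moreover have "B = (\<lambda>j. C * exp 1 * ((real j + 1) * (\<sigma> / cmod x) ^ j))"
      by (rule ext) (simp add: B_def power_divide)
    ultimately show ?thesis by (simp only: summable_LIMSEQ_zero)
  qed
  then have "(\<lambda>J. B J / \<delta>) \<longlonglongrightarrow> 0 / \<delta>" using \<delta> by (intro tendsto_divide tendsto_const) simp_all
  then have "(\<lambda>J. B J / \<delta>) \<longlonglongrightarrow> 0" by simp
  then have "(\<lambda>J. laplace h x - S J 0) \<longlonglongrightarrow> 0"
    by (rule Lim_null_comparison[OF always_eventually[OF allI[OF key]]])
  moreover have "(\<lambda>J. S J 0) \<longlonglongrightarrow> borel_series h x"
    using borel_series_sums[OF hol \<sigma> growth cx] unfolding S_def sums_def .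
  ultimately have "(\<lambda>J. laplace h x - S J 0 + S J 0) \<longlonglongrightarrow> 0 + borel_series h x"
    by (rule tendsto_add)
  then show ?thesis by (simp add: LIMSEQ_const_iff)
qed

text \<open>The logarithm straightens the region to a convex half-strip.\<close>

lemma connected_lower_annulus:
  assumes "0 < \<sigma>"
  shows "connected {x. Im x < 0 \<and> \<sigma> < cmod x}"
proof -
  have "{x. Im x < 0 \<and> \<sigma> < cmod x} = exp ` ({u. ln \<sigma> < Re u} \<inter> {u. - pi < Im u} \<inter> {u. Im u < 0})"
  proof (intro set_eqI iffI)
    fix x assume x: "x \<in> {x. Im x < 0 \<and> \<sigma> < cmod x}"
    then have nz: "x \<noteq> 0" by auto
    have "ln \<sigma> < Re (Ln x)" using x nz assms by simp
    moreover have "- pi < Im (Ln x)" using mpi_less_Im_Ln[OF nz] .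
    moreover have "Im (Ln x) < 0"
      using Im_Ln_pos_le[OF nz] Im_Ln_le_pi[OF nz] x by auto
    ultimately show "x \<in> exp ` ({u. ln \<sigma> < Re u} \<inter> {u. - pi < Im u} \<inter> {u. Im u < 0})"
      using exp_Ln[OF nz] by (intro image_eqI[of _ _ "Ln x"]) auto
  next
    fix x assume "x \<in> exp ` ({u. ln \<sigma> < Re u} \<inter> {u. - pi < Im u} \<inter> {u. Im u < 0})"
    then obtain u where u: "x = exp u" "ln \<sigma> < Re u" "- pi < Im u" "Im u < 0" by auto
    have "sin (- Im u) > 0" using u by (intro sin_gt_zero) auto
    then have "Im x < 0" using u by (simp add: Im_exp mult_pos_neg)
    moreover have "\<sigma> < cmod x" using u assms by (metis norm_exp_eq_Re exp_less_mono exp_ln)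
    ultimately show "x \<in> {x. Im x < 0 \<and> \<sigma> < cmod x}" by simp
  qed
  moreover have "convex ({u. ln \<sigma> < Re u} \<inter> {u. - pi < Im u} \<inter> {u. Im u < 0})"
    by (intro convex_Int convex_halfspace_Re_gt convex_halfspace_Im_gt convex_halfspace_Im_lt)
  ultimately show ?thesis
    by (simp only:) (rule connected_continuous_image[OF continuous_on_exp[OF continuous_on_id] convex_connected])
qed

text \<open>Analytic continuation from the half-plane of \<open>laplace_eq_borel_series_far\<close>.
  The integral converges in the whole lower half-plane thanks to \<open>M\<close>, the series
  outside the disc thanks to the growth bound.\<close>

lemma laplace_eq_borel_series:
  assumes hol: "h holomorphic_on UNIV" and \<sigma>: "0 < \<sigma>"
    and growth: "\<And>z. cmod (h z) \<le> C * exp (\<sigma> * cmod z)"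
    and M: "\<And>y. cmod (h (\<i> * of_real y)) \<le> M"
    and x: "Im x < 0" "\<sigma> < cmod x"
  shows "laplace h x = borel_series h x"
proof -
  have op: "open {x. Im x < 0 \<and> \<sigma> < cmod x}"
    by (intro open_Collect_conj open_Collect_less continuous_intros)
  show ?thesis
  proof (rule analytic_continuation_open[of "{x. Im x < - \<sigma>}" "{x. Im x < 0 \<and> \<sigma> < cmod x}" "laplace h" "borel_series h"])
    show "open {x. Im x < - \<sigma>}" by (rule open_halfspace_Im_lt)
    have "- \<i> * of_real (2 * \<sigma>) \<in> {x. Im x < - \<sigma>}" using \<sigma> by simp
    then show "{x. Im x < - \<sigma>} \<noteq> {}" by blast
    show "{x. Im x < - \<sigma>} \<subseteq> {x. Im x < 0 \<and> \<sigma> < cmod x}"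
    proof
      fix x assume "x \<in> {x. Im x < - \<sigma>}"
      then show "x \<in> {x. Im x < 0 \<and> \<sigma> < cmod x}" using abs_Im_le_cmod[of x] \<sigma> by auto
    qed
    show "laplace h z = borel_series h z" if "z \<in> {x. Im x < - \<sigma>}" for z
      using laplace_eq_borel_series_far[OF hol \<sigma> growth M, of z] that by simp
    show "laplace h holomorphic_on {x. Im x < 0 \<and> \<sigma> < cmod x}"
      by (rule holomorphic_on_subset[OF laplace_holomorphic[OF hol M]]) auto
    show "borel_series h holomorphic_on {x. Im x < 0 \<and> \<sigma> < cmod x}"
      by (rule holomorphic_on_subset[OF borel_series_holomorphic[OF hol \<sigma> growth]]) auto
    show "connected {x. Im x < 0 \<and> \<sigma> < cmod x}" by (rule connected_lower_annulus[OF \<sigma>])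
    show "x \<in> {x. Im x < 0 \<and> \<sigma> < cmod x}" using x by simp
  qed (rule op)
qed

section \<open>The Borel transform off the real segment\<close>

lemma higher_deriv_reflect:
  assumes "h holomorphic_on UNIV"
  shows "(deriv ^^ j) (\<lambda>z. h (- z)) 0 = (- 1) ^ j * (deriv ^^ j) h (0 :: complex)"
proof -
  have "(deriv ^^ j) (\<lambda>w. h ((- 1) * w)) 0 = (- 1) ^ j * (deriv ^^ j) h ((- 1) * 0)"
    by (rule higher_deriv_compose_linear[OF assms open_UNIV open_UNIV]) auto
  then show ?thesis unfolding mult_minus1 minus_zero .
qed

text \<open>The Borel transform continues along the imaginary directions because, up to a rotation, it is a
  Laplace transform there; boundedness on the imaginary axis makes the latter converge.\<close>

lemma borel_transform_exists:
  assumes hol: "h holomorphic_on UNIV" and \<sigma>: "0 < \<sigma>"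
    and growth: "\<And>z. cmod (h z) \<le> C * exp (\<sigma> * cmod z)"
    and M: "\<And>y. cmod (h (\<i> * of_real y)) \<le> M"
  obtains B where "B holomorphic_on {x. Im x \<noteq> 0 \<or> \<sigma> < cmod x}"
    "\<And>x. \<sigma> < cmod x \<Longrightarrow> B x = borel_series h x"
    "\<And>x. Im x \<noteq> 0 \<Longrightarrow> cmod (B x) \<le> M / \<bar>Im x\<bar>"
proof -
  \<comment> \<open>The Laplace integral of the reflected function runs along the other half of the
    imaginary axis; evaluated at -x it serves the upper half-plane.\<close>
  define g where "g z = h (- z)" for z
  have g: "g holomorphic_on UNIV" "\<And>z. cmod (g z) \<le> C * exp (\<sigma> * cmod z)"
    "\<And>y. cmod (g (\<i> * of_real y)) \<le> M"
  proof -
    have "h \<circ> uminus holomorphic_on UNIV"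
      by (intro holomorphic_on_compose_gen[OF _ hol] holomorphic_intros) auto
    then show "g holomorphic_on UNIV" by (simp add: g_def[abs_def] o_def)
    show "cmod (g z) \<le> C * exp (\<sigma> * cmod z)" for z using growth[of "- z"] by (simp add: g_def)
    show "cmod (g (\<i> * of_real y)) \<le> M" for y using M[of "- y"] by (simp add: g_def)
  qed
  have refl: "borel_series g (- x) = - borel_series h x" if "\<sigma> < cmod x" for x
  proof -
    have "(- 1) ^ j * (deriv ^^ j) h 0 / (- x) ^ Suc j = - ((deriv ^^ j) h 0 / x ^ Suc j)" for j
      using that \<sigma> by (cases "even j") (auto simp: power_minus_odd)
    then have 1: "(\<lambda>j. (deriv ^^ j) g 0 / (- x) ^ Suc j) = (\<lambda>j. - ((deriv ^^ j) h 0 / x ^ Suc j))"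
      unfolding g_def[abs_def] higher_deriv_reflect[OF hol] by blast
    have 2: "(\<lambda>j. (deriv ^^ j) g 0 / (- x) ^ Suc j) sums borel_series g (- x)"
      using that by (intro borel_series_sums[OF g(1) \<sigma> g(2)]) auto
    have 3: "(\<lambda>j. - ((deriv ^^ j) h 0 / x ^ Suc j)) sums (- borel_series h x)"
      by (intro sums_minus borel_series_sums[OF hol \<sigma> growth that])
    show ?thesis by (rule sums_unique2[OF 2[unfolded 1] 3])
  qed
  \<comment> \<open>Outside the disc both Laplace branches agree with the series, by
    \<open>laplace_eq_borel_series\<close> for \<open>h\<close> and for \<open>g\<close> and by
    \<open>refl\<close>; hence \<open>B\<close> is holomorphic on each of three open pieces.\<close>
  define B where "B x = (if \<sigma> < cmod x then borel_series h x else
      if Im x < 0 then laplace h x else - laplace g (- x))" for x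
  have low: "B x = laplace h x" if "Im x < 0" for x
    using laplace_eq_borel_series[OF hol \<sigma> growth M that] that by (simp add: B_def)
  have up: "B x = - laplace g (- x)" if "Im x > 0" for x
    using laplace_eq_borel_series[OF g(1) \<sigma> g(2,3), of "- x"] refl[of x] that by (simp add: B_def)
  have "B holomorphic_on {x. \<sigma> < cmod x}"
    using borel_series_holomorphic[OF hol \<sigma> growth]
    by (rule holomorphic_transform) (auto simp: B_def)
  moreover have "B holomorphic_on {x. Im x < 0}"
    using laplace_holomorphic[OF hol M] by (rule holomorphic_transform) (auto simp: low)
  moreover have "B holomorphic_on {x. Im x > 0}"
  proof -
    have "laplace g \<circ> uminus holomorphic_on {x. Im x > 0}"
      by (intro holomorphic_on_compose_gen[OF _ laplace_holomorphic[OF g(1,3)]] holomorphic_intros) auto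
    then have "(\<lambda>x. - laplace g (- x)) holomorphic_on {x. Im x > 0}"
      by (intro holomorphic_on_minus) (simp add: o_def)
    then show ?thesis by (rule holomorphic_transform) (auto simp: up)
  qed
  moreover have o: "open {x. \<sigma> < cmod x}" "open {x. Im x < 0}" "open {x. Im x > 0}"
    by (intro open_Collect_less continuous_intros)+
  ultimately have "B holomorphic_on ({x. \<sigma> < cmod x} \<union> ({x. Im x < 0} \<union> {x. Im x > 0}))"
    by (intro holomorphic_on_Un open_Un)
  moreover have "{x. \<sigma> < cmod x} \<union> ({x. Im x < 0} \<union> {x. Im x > 0}) = {x. Im x \<noteq> 0 \<or> \<sigma> < cmod x}"
    by auto
  ultimately have B: "B holomorphic_on {x. Im x \<noteq> 0 \<or> \<sigma> < cmod x}" by simp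
  show thesis
  proof
    show "B holomorphic_on {x. Im x \<noteq> 0 \<or> \<sigma> < cmod x}" by (rule B)
    show "\<sigma> < cmod x \<Longrightarrow> B x = borel_series h x" for x by (simp add: B_def)
    show "cmod (B x) \<le> M / \<bar>Im x\<bar>" if "Im x \<noteq> 0" for x
    proof (cases "Im x < 0")
      case True
      then show ?thesis using laplace_bound[OF hol M True] low by simp
    next
      case False
      then have "Im x > 0" using that by simp
      then show ?thesis using laplace_bound[OF g(1,3), of "- x"] up by simp
    qed
  qed
qed

section \<open>Contour integrals over a Joukowski ellipse\<close>

lemma joukowski_of_circle:
  assumes "cmod z = 1" "R \<noteq> 0"
  shows "Re (joukowski (of_real R * z)) = (R + 1 / R) / 2 * Re z"
    "Im (joukowski (of_real R * z)) = (R - 1 / R) / 2 * Im z"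
proof -
  have "z * cnj z = 1" using complex_norm_square[of z] assms(1) by simp
  then have "1 / z = cnj z" by (metis mult_zero_left nonzero_mult_div_cancel_left zero_neq_one)
  then have "1 / (of_real R * z) = cnj z / of_real R" by (metis divide_divide_eq_left mult.commute)
  then have *: "joukowski (of_real R * z) = (of_real R * z + cnj z / of_real R) / 2" by (simp add: joukowski_def)
  show "Re (joukowski (of_real R * z)) = (R + 1 / R) / 2 * Re z"
    "Im (joukowski (of_real R * z)) = (R - 1 / R) / 2 * Im z"
    unfolding * by (simp_all add: Re_divide_of_real Im_divide_of_real field_simps)
qed

text \<open>With z = s / R on the unit circle, |J(s)|^2 = a^2 + (Re z)^2, so a small imaginary part
  forces modulus at least 1. In the first case the Borel transform is controlled by its Laplace
  integral, in the second by its series.\<close>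

lemma joukowski_ellipse_dichotomy:
  assumes R: "R > 1" and s: "cmod s = R"
  defines "a \<equiv> (R - 1 / R) / 2"
  shows "a\<^sup>2 \<le> \<bar>Im (joukowski s)\<bar> \<or> 1 \<le> cmod (joukowski s)"
proof -
  define z where "z = s / of_real R"
  have z: "cmod z = 1" "s = of_real R * z" using R s by (auto simp: z_def norm_divide)
  have xy: "(Re z)\<^sup>2 + (Im z)\<^sup>2 = 1" using z(1) by (metis cmod_power2 one_power2)
  have a: "a > 0" using R by (simp add: a_def field_simps) (metis less_1_mult mult.commute)
  have q: "((R + 1 / R) / 2)\<^sup>2 = 1 + a\<^sup>2" using R by (simp add: a_def field_simps power2_eq_square)
  have "R \<noteq> 0" using R by simp
  note J = joukowski_of_circle[OF z(1) this, folded z(2) a_def]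
  show ?thesis
  proof (cases "a\<^sup>2 \<le> \<bar>Im (joukowski s)\<bar>")
    case False
    then have "a * \<bar>Im z\<bar> < a * a" using J R a by (simp add: abs_mult power2_eq_square)
    then have "\<bar>Im z\<bar> < a" using a by simp
    then have "(Im z)\<^sup>2 \<le> a\<^sup>2" using power_mono[of "\<bar>Im z\<bar>" a 2] by simp
    have "(cmod (joukowski s))\<^sup>2 = (1 + a\<^sup>2) * (Re z)\<^sup>2 + a\<^sup>2 * (Im z)\<^sup>2"
      unfolding cmod_power2 J power_mult_distrib q ..
    also have "\<dots> = a\<^sup>2 * ((Re z)\<^sup>2 + (Im z)\<^sup>2) + (Re z)\<^sup>2" by (simp add: algebra_simps)
    also have "\<dots> \<ge> 1" using xy \<open>(Im z)\<^sup>2 \<le> a\<^sup>2\<close> by simp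
    finally have "1 \<le> (cmod (joukowski s))\<^sup>2" .
    then show ?thesis using abs_le_square_iff[of 1 "cmod (joukowski s)"] by simp
  qed auto
qed

lemma has_field_derivative_joukowski:
  assumes "s \<noteq> 0"
  shows "(joukowski has_field_derivative (1 - 1 / s\<^sup>2) / 2) (at s)"
proof -
  have "((\<lambda>s. (s + inverse s) / 2) has_field_derivative (1 + - (inverse s ^ Suc (Suc 0))) / 2) (at s)"
    using assms by (intro DERIV_cdivide DERIV_add DERIV_ident DERIV_inverse)
  then show ?thesis
    by (simp add: joukowski_def[abs_def] inverse_eq_divide power2_eq_square)
qed

text \<open>The sum is the contour integral of \<open>\<psi>\<close> against the Borel transform of \<open>h\<close>; the contour is
  shrunk to a thin ellipse around the segment outside of which the transform is holomorphic.\<close>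

lemma exp_type_functional_bound:
  fixes R \<sigma> C M :: real
  assumes R: "R > 1" and \<sigma>: "0 < \<sigma>" "\<sigma> < 1"
  obtains A where "A \<ge> 0"
    "\<And>h \<psi> \<epsilon>. \<lbrakk>h holomorphic_on UNIV; \<And>z. cmod (h z) \<le> C * exp (\<sigma> * cmod z);
       \<And>y. cmod (h (\<i> * of_real y)) \<le> M; \<psi> holomorphic_on UNIV;
       \<And>s. cmod s = R \<Longrightarrow> cmod (\<psi> (joukowski s)) \<le> \<epsilon>\<rbrakk> \<Longrightarrow>
      \<exists>S. (\<lambda>j. (deriv ^^ j) h 0 * ((deriv ^^ j) \<psi> 0 / fact j)) sums S \<and> cmod S \<le> A * \<epsilon>"
proof -
  define a where "a = (R - 1 / R) / 2"
  have a: "a > 0" using R by (simp add: a_def field_simps) (metis less_1_mult mult.commute)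
  define A1 where "A1 = (\<Sum>j. C * exp 1 / 1 * ((real j + 1) * (\<sigma> / 1) ^ j))"
  \<comment> \<open>A bound for the Borel transform on the whole ellipse that depends on
    \<open>h\<close> only through \<open>C\<close>, \<open>\<sigma>\<close> and \<open>M\<close>.
    The 0 is included because \<open>A\<close> must be nonnegative before any \<open>h\<close> is
    given.\<close>
  define A where "A = max 0 (max (M / a\<^sup>2) A1)"
  \<comment> \<open>The factor R is the length of the circle of radius R divided by 2 pi; the
    derivative of the Joukowski map is at most 1 in modulus there.\<close>
  show thesis
  proof (rule that[of "A * R"])
    show "0 \<le> A * R" using R by (simp add: A_def)
    fix h \<psi> :: "complex \<Rightarrow> complex" and \<epsilon> :: real
    assume hol: "h holomorphic_on UNIV" and growth: "\<And>z. cmod (h z) \<le> C * exp (\<sigma> * cmod z)"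
      and M: "\<And>y. cmod (h (\<i> * of_real y)) \<le> M" and \<psi>: "\<psi> holomorphic_on UNIV"
      and \<epsilon>: "\<And>s. cmod s = R \<Longrightarrow> cmod (\<psi> (joukowski s)) \<le> \<epsilon>"
    define \<Omega> where "\<Omega> = {x. Im x \<noteq> 0 \<or> \<sigma> < cmod x}"
    obtain B where B: "B holomorphic_on \<Omega>" "\<And>x. \<sigma> < cmod x \<Longrightarrow> B x = borel_series h x"
      "\<And>x. Im x \<noteq> 0 \<Longrightarrow> cmod (B x) \<le> M / \<bar>Im x\<bar>"
      unfolding \<Omega>_def by (rule borel_transform_exists[OF hol \<sigma>(1) growth M]) blast
    have open\<Omega>: "open \<Omega>"
    proof -
      have "\<Omega> = {x. Im x < 0} \<union> {x. Im x > 0} \<union> {x. \<sigma> < cmod x}" by (auto simp: \<Omega>_def)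
      then show ?thesis by (auto intro!: open_Un open_Collect_less continuous_intros)
    qed
    have M0: "0 \<le> M" using order_trans[OF norm_ge_zero M] .
    have BA: "cmod (B (joukowski s)) \<le> A" if s: "cmod s = R" for s
    proof (cases "a\<^sup>2 \<le> \<bar>Im (joukowski s)\<bar>")
      case True
      then have nz: "Im (joukowski s) \<noteq> 0" using a by (metis abs_0 not_less zero_less_power)
      have "cmod (B (joukowski s)) \<le> M / \<bar>Im (joukowski s)\<bar>" by (rule B(3)[OF nz])
      also have "\<dots> \<le> M / a\<^sup>2" using True a M0 by (intro divide_left_mono mult_pos_pos) (auto simp: nz)
      finally show ?thesis by (simp add: A_def)
    next
      case False
      with joukowski_ellipse_dichotomy[OF R s] have 1: "1 \<le> cmod (joukowski s)" by (simp add: a_def)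
      have "cmod (B (joukowski s)) \<le> A1"
        using 1 \<sigma> borel_series_bound[OF hol \<sigma>(1) growth \<sigma>(2) 1] by (simp add: B(2) A1_def)
      then show ?thesis by (simp add: A_def)
    qed
    define \<Gamma> where "\<Gamma> = joukowski \<circ> circlepath 0 R"
    have jh: "joukowski holomorphic_on - {0}"
      unfolding joukowski_def[abs_def] by (intro holomorphic_intros) auto
    have vp: "valid_path \<Gamma>" unfolding \<Gamma>_def
      using R by (intro valid_path_compose_holomorphic[OF _ jh]) auto
    \<comment> \<open>Points of the ellipse and of the unit circle with the same parameter are
      joined by segments. Their imaginary parts have the same sign, and where both vanish the
      segment is real and stays at modulus at least 1 > \<sigma>.\<close>
    have hom: "homotopic_loops \<Omega> \<Gamma> (circlepath 0 1)"
    proof (rule homotopic_loops_linear)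
      show "path \<Gamma>" using vp by (rule valid_path_imp_path)
      show "path (circlepath 0 1)" by simp
      show "pathfinish \<Gamma> = pathstart \<Gamma>"
        unfolding \<Gamma>_def pathfinish_compose pathstart_compose by simp
      show "pathfinish (circlepath 0 1) = pathstart (circlepath 0 1)" by simp
      fix t :: real
      define z where "z = exp (2 * of_real pi * \<i> * of_real t)"
      have z: "cmod z = 1" by (simp add: z_def)
      have Rnz: "R \<noteq> 0" using R by simp
      have G: "\<Gamma> t = joukowski (of_real R * z)" "circlepath 0 1 t = z"
        by (auto simp: \<Gamma>_def circlepath z_def)
      show "closed_segment (\<Gamma> t) (circlepath 0 1 t) \<subseteq> \<Omega>"
      proof
        fix x assume "x \<in> closed_segment (\<Gamma> t) (circlepath 0 1 t)"
        then obtain u where u: "0 \<le> u" "u \<le> 1" "x = (1 - u) *\<^sub>R \<Gamma> t + u *\<^sub>R z"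
          unfolding G(2) by (auto simp: in_segment)
        have "Im x = (1 - u) * (a * Im z) + u * Im z"
          unfolding u(3) G(1) by (simp add: joukowski_of_circle[OF z Rnz] a_def)
        then have Im: "Im x = ((1 - u) * a + u) * Im z" by (simp add: algebra_simps)
        have pos: "(1 - u) * a + u > 0"
        proof (cases "u = 0")
          case False
          have "(1 - u) * a \<ge> 0" using u a by simp
          then show ?thesis using False u by linarith
        qed (use a in simp)
        show "x \<in> \<Omega>"
        proof (cases "Im z = 0")
          case False
          then show ?thesis using Im pos by (simp add: \<Omega>_def)
        next
          case True
          then have rz: "\<bar>Re z\<bar> = 1" using z by (simp add: cmod_def)
          define q where "q = (R + 1 / R) / 2"
          have "Re x = ((1 - u) * q + u) * Re z"
            unfolding u(3) G(1) q_def by (simp only: joukowski_of_circle[OF z Rnz] plus_complex.sel scaleR_complex.sel distrib_right mult.assoc)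
          then have rx: "\<bar>Re x\<bar> = \<bar>(1 - u) * q + u\<bar>" using rz by (simp add: abs_mult)
          have "q \<ge> 1"
          proof -
            have "(R - 1)\<^sup>2 \<ge> 0" by simp
            then show ?thesis using R by (simp add: q_def field_simps power2_eq_square)
          qed
          then have "(1 - u) * 1 \<le> (1 - u) * q" using u by (intro mult_left_mono) auto
          then have "1 \<le> (1 - u) * q + u" unfolding mult_1_right by linarith
          then have "1 \<le> \<bar>Re x\<bar>" unfolding rx by (rule order_trans) (rule abs_ge_self)
          then have "\<sigma> < cmod x" using abs_Re_le_cmod[of x] \<sigma> by linarith
          then show ?thesis by (simp add: \<Omega>_def)
        qed
      qed
    qed
    have \<psi>B: "(\<lambda>x. \<psi> x * B x) holomorphic_on \<Omega>"
      using B(1) holomorphic_on_subset[OF \<psi>] by (intro holomorphic_on_mult) auto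
    have eq: "contour_integral \<Gamma> (\<lambda>x. \<psi> x * B x) = contour_integral (circlepath 0 1) (\<lambda>x. \<psi> x * B x)"
      by (rule Cauchy_theorem_homotopic_loops[OF hom open\<Omega> \<psi>B vp]) auto
    \<comment> \<open>On the unit circle the transform equals its series, and termwise integration
      produces the Taylor coefficients of \<open>\<psi>\<close> by Cauchy's formula.\<close>
    define F where "F j x = (deriv ^^ j) h 0 * (\<psi> x / (x - 0) ^ Suc j)" for j x
    have FI: "(F j has_contour_integral (deriv ^^ j) h 0 * ((2 * pi * \<i>) / fact j * (deriv ^^ j) \<psi> 0)) (circlepath 0 1)" for j
      unfolding F_def
      by (intro has_contour_integral_lmul Cauchy_has_contour_integral_higher_derivative_circlepath)
        (auto intro: holomorphic_on_subset[OF \<psi>] holomorphic_on_imp_continuous_on)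
    have ul: "uniform_limit (sphere 0 1) (\<lambda>n x. \<Sum>j<n. F j x) (\<lambda>x. \<Sum>j. F j x) sequentially"
    proof -
      have "compact (\<psi> ` sphere 0 1)"
        by (intro compact_continuous_image holomorphic_on_imp_continuous_on holomorphic_on_subset[OF \<psi>]) auto
      then obtain k where k: "\<And>x. x \<in> sphere 0 1 \<Longrightarrow> cmod (\<psi> x) \<le> k"
        using compact_imp_bounded bounded_iff by (metis imageI)
      show ?thesis
      proof (rule Weierstrass_m_test)
        show "summable (\<lambda>j. k * (C * exp 1 / 1 * ((real j + 1) * (\<sigma> / 1) ^ j)))"
          by (intro summable_mult[OF summable_borel_bound[OF hol \<sigma>(1) growth \<sigma>(2)]])
        fix j and x :: complex assume x: "x \<in> sphere 0 1"
        have "cmod (F j x) = cmod (\<psi> x) * cmod ((deriv ^^ j) h 0 / x ^ Suc j)"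
          by (simp add: F_def norm_mult norm_divide)
        also have "\<dots> \<le> k * (C * exp 1 / 1 * ((real j + 1) * (\<sigma> / 1) ^ j))"
          using x by (intro mult_mono k borel_term_le[OF hol \<sigma>(1) growth \<sigma>(2)]) (auto intro: order_trans[OF _ k])
        finally show "cmod (F j x) \<le> k * (C * exp 1 / 1 * ((real j + 1) * (\<sigma> / 1) ^ j))" .
      qed
    qed
    have Fsum: "(\<Sum>j. F j x) = \<psi> x * B x" if "x \<in> sphere 0 1" for x
    proof -
      have "(\<lambda>j. \<psi> x * ((deriv ^^ j) h 0 / x ^ Suc j)) sums (\<psi> x * borel_series h x)"
        using that \<sigma> by (intro sums_mult borel_series_sums[OF hol \<sigma>(1) growth]) auto
      moreover have "(\<lambda>j. \<psi> x * ((deriv ^^ j) h 0 / x ^ Suc j)) = (\<lambda>j. F j x)"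
        by (auto simp: F_def)
      ultimately show ?thesis using B(2)[of x] that \<sigma> by (simp add: sums_iff)
    qed
    have pint: "((\<lambda>x. \<Sum>j<n. F j x) has_contour_integral
        (\<Sum>j<n. (deriv ^^ j) h 0 * ((2 * pi * \<i>) / fact j * (deriv ^^ j) \<psi> 0))) (circlepath 0 1)" for n
      by (intro has_contour_integral_sum FI) auto
    have "(\<lambda>n. contour_integral (circlepath 0 1) (\<lambda>x. \<Sum>j<n. F j x)) \<longlonglongrightarrow>
        contour_integral (circlepath 0 1) (\<lambda>x. \<Sum>j. F j x)"
      by (rule contour_integral_uniform_limit_circlepath(2)[OF _ ul])
        (auto intro!: always_eventually has_contour_integral_integrable[OF pint])
    moreover have "contour_integral (circlepath 0 1) (\<lambda>x. \<Sum>j. F j x) =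
        contour_integral (circlepath 0 1) (\<lambda>x. \<psi> x * B x)"
      by (intro contour_integral_eq Fsum) auto
    ultimately have lim: "(\<lambda>j. (deriv ^^ j) h 0 * ((2 * pi * \<i>) / fact j * (deriv ^^ j) \<psi> 0)) sums
        contour_integral \<Gamma> (\<lambda>x. \<psi> x * B x)"
      unfolding eq sums_def contour_integral_unique[OF pint] by simp
    define I where "I = contour_integral \<Gamma> (\<lambda>x. \<psi> x * B x)"
    have \<epsilon>0: "0 \<le> \<epsilon>" using order_trans[OF norm_ge_zero \<epsilon>[of "of_real R"]] R by simp
    have A0: "0 \<le> A" by (simp add: A_def)
    have "cmod I \<le> \<epsilon> * A * (2 * pi * R)"
    proof -
      have pimg: "path_image (circlepath 0 R) \<subseteq> - {0}" using R by auto
      have ja: "joukowski analytic_on - {0}" using jh by (subst analytic_on_open) auto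
      \<comment> \<open>The integral over the ellipse is pulled back to a circle, where the length
        estimate is available.\<close>
      have Ieq: "I = contour_integral (circlepath 0 R) (\<lambda>s. deriv joukowski s * (\<psi> (joukowski s) * B (joukowski s)))"
        unfolding I_def \<Gamma>_def by (rule contour_integral_comp_analyticW[OF ja _ pimg]) simp
      show ?thesis unfolding Ieq
      proof (rule has_contour_integral_bound_circlepath[OF has_contour_integral_integral])
        define U where "U = - {0} \<inter> joukowski -` \<Omega>"
        have U: "open U" unfolding U_def
          by (rule continuous_open_preimage[OF holomorphic_on_imp_continuous_on[OF jh] _ open\<Omega>]) auto
        have "joukowski holomorphic_on U" by (rule holomorphic_on_subset[OF jh]) (auto simp: U_def)
        then have "((\<lambda>x. \<psi> x * B x) \<circ> joukowski) holomorphic_on U"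
          by (rule holomorphic_on_compose_gen[OF _ \<psi>B]) (auto simp: U_def)
        then have "(\<lambda>s. \<psi> (joukowski s) * B (joukowski s)) holomorphic_on U" by (simp only: o_def)
        moreover have "deriv joukowski holomorphic_on U"
          by (rule holomorphic_on_subset[OF holomorphic_deriv[OF jh]]) (auto simp: U_def)
        ultimately have hU: "(\<lambda>s. deriv joukowski s * (\<psi> (joukowski s) * B (joukowski s))) holomorphic_on U"
          by (intro holomorphic_on_mult[of "deriv joukowski"])
        show "(\<lambda>s. deriv joukowski s * (\<psi> (joukowski s) * B (joukowski s))) contour_integrable_on circlepath 0 R"
        proof (rule contour_integrable_holomorphic_simple[OF hU U])
          show "path_image (circlepath 0 R) \<subseteq> U"
          proof
            fix s assume "s \<in> path_image (circlepath 0 R)"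
            then have s: "cmod s = R" using R by simp
            have "joukowski s \<in> \<Omega>"
            proof (cases "a\<^sup>2 \<le> \<bar>Im (joukowski s)\<bar>")
              case True
              have "0 < a\<^sup>2" using a by simp
              with True have "Im (joukowski s) \<noteq> 0" by linarith
              then show ?thesis by (simp add: \<Omega>_def)
            next
              case False
              then have "1 \<le> cmod (joukowski s)"
                using joukowski_ellipse_dichotomy[OF R s, folded a_def] by blast
              then show ?thesis using \<sigma> by (simp add: \<Omega>_def)
            qed
            moreover have "s \<noteq> 0" using s R by auto
            ultimately show "s \<in> U" by (simp add: U_def)
          qed
        qed simp
        fix s assume "cmod (s - 0) = R"
        then have s: "cmod s = R" "s \<noteq> 0" using R by auto
        have "cmod (deriv joukowski s) \<le> 1"
        proof -
          have 1: "deriv joukowski s = (1 - 1 / s\<^sup>2) / 2"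
            by (rule DERIV_imp_deriv[OF has_field_derivative_joukowski[OF s(2)]])
          have 2: "cmod (1 - 1 / s\<^sup>2) \<le> 1 + 1 / R\<^sup>2"
            using norm_triangle_ineq4[of 1 "1 / s\<^sup>2"] s by (simp add: norm_divide norm_power)
          have 3: "1 / R\<^sup>2 \<le> 1" using R by simp
          show ?thesis unfolding 1 norm_divide using 2 3 by simp
        qed
        moreover have "cmod (\<psi> (joukowski s)) * cmod (B (joukowski s)) \<le> \<epsilon> * A"
          by (rule mult_mono[OF \<epsilon>[OF s(1)] BA[OF s(1)] \<epsilon>0 norm_ge_zero])
        ultimately have "cmod (deriv joukowski s) * (cmod (\<psi> (joukowski s)) * cmod (B (joukowski s))) \<le> 1 * (\<epsilon> * A)"
          by (rule mult_mono) simp_all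
        then show "cmod (deriv joukowski s * (\<psi> (joukowski s) * B (joukowski s))) \<le> \<epsilon> * A"
          by (simp add: norm_mult)
      qed (use R \<epsilon>0 A0 in auto)
    qed
    moreover have n2: "cmod (2 * pi * \<i>) = 2 * pi" by (simp add: norm_mult)
    moreover have "\<epsilon> * A * (2 * pi * R) = A * R * \<epsilon> * (2 * pi)" by (simp only: mult_ac)
    ultimately have "cmod (I / (2 * pi * \<i>)) \<le> A * R * \<epsilon>"
      unfolding norm_divide n2 by (subst pos_divide_le_eq) simp_all
    moreover have "(\<lambda>j. (deriv ^^ j) h 0 * ((deriv ^^ j) \<psi> 0 / fact j)) sums (I / (2 * pi * \<i>))"
    proof -
      have gen: "x * (c / f * y) / c = x * (y / f)" if "c \<noteq> 0" for x c f y :: complex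
        using that by simp
      have nz: "2 * pi * \<i> \<noteq> (0 :: complex)" by simp
      show ?thesis
        using sums_divide[OF lim, of "2 * pi * \<i>"] unfolding I_def gen[OF nz] .
    qed
    ultimately show "\<exists>S. (\<lambda>j. (deriv ^^ j) h 0 * ((deriv ^^ j) \<psi> 0 / fact j)) sums S \<and> cmod S \<le> A * R * \<epsilon>"
      by blast
  qed
qed

text \<open>The pairing of \<open>exp_type_functional_bound\<close> replaces x^j by the j-th
  derivative of \<open>h\<close> at 0. Applied to exp (i t x) - \<Lambda>(x), the exponential gives
  h(i t) by Taylor's formula, and \<open>\<Lambda>\<close> gives finitely many derivatives at
  0.\<close>

lemma exp_type_polynomial_functional_bound:
  fixes R \<sigma> C M :: real
  assumes R: "R > 1" and \<sigma>: "0 < \<sigma>" "\<sigma> < 1"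
  obtains A where "A \<ge> 0"
    "\<And>h \<Lambda> n t \<epsilon>. \<lbrakk>h holomorphic_on UNIV; \<And>z. cmod (h z) \<le> C * exp (\<sigma> * cmod z);
       \<And>y. cmod (h (\<i> * of_real y)) \<le> M; degree \<Lambda> \<le> n;
       \<And>s. cmod s = R \<Longrightarrow> cmod (exp (\<i> * of_real t * joukowski s) - poly \<Lambda> (joukowski s)) \<le> \<epsilon>\<rbrakk> \<Longrightarrow>
      cmod (h (\<i> * of_real t) - (\<Sum>j\<le>n. coeff \<Lambda> j * (deriv ^^ j) h 0)) \<le> A * \<epsilon>"
proof -
  obtain A where A: "A \<ge> 0" "\<And>h \<psi> \<epsilon>. \<lbrakk>h holomorphic_on UNIV; \<And>z. cmod (h z) \<le> C * exp (\<sigma> * cmod z);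
       \<And>y. cmod (h (\<i> * of_real y)) \<le> M; \<psi> holomorphic_on UNIV;
       \<And>s. cmod s = R \<Longrightarrow> cmod (\<psi> (joukowski s)) \<le> \<epsilon>\<rbrakk> \<Longrightarrow>
      \<exists>S. (\<lambda>j. (deriv ^^ j) h 0 * ((deriv ^^ j) \<psi> 0 / fact j)) sums S \<and> cmod S \<le> A * \<epsilon>"
    by (rule exp_type_functional_bound[OF R \<sigma>, of C M]) blast
  show thesis
  proof (rule that[OF A(1)])
    fix h :: "complex \<Rightarrow> complex" and \<Lambda> :: "complex poly" and n and t \<epsilon> :: real
    assume hol: "h holomorphic_on UNIV" and growth: "\<And>z. cmod (h z) \<le> C * exp (\<sigma> * cmod z)"
      and M: "\<And>y. cmod (h (\<i> * of_real y)) \<le> M" and deg: "degree \<Lambda> \<le> n"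
      and \<epsilon>: "\<And>s. cmod s = R \<Longrightarrow> cmod (exp (\<i> * of_real t * joukowski s) - poly \<Lambda> (joukowski s)) \<le> \<epsilon>"
    define \<psi> where "\<psi> x = exp (\<i> * of_real t * x) - poly \<Lambda> x" for x
    have "(\<lambda>x. poly \<Lambda> x) has_fps_expansion fps_of_poly \<Lambda>"
      by (auto simp: has_fps_expansion_def)
    then have "\<psi> has_fps_expansion (fps_exp (\<i> * of_real t) - fps_of_poly \<Lambda>)"
      unfolding \<psi>_def[abs_def] by (intro fps_expansion_intros)
    from fps_nth_fps_expansion[OF this]
    have co: "(deriv ^^ j) \<psi> 0 / fact j = (\<i> * of_real t) ^ j / fact j - coeff \<Lambda> j" for j
      by simp
    have "\<psi> holomorphic_on UNIV" unfolding \<psi>_def[abs_def] by (intro holomorphic_intros)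
    from A(2)[OF hol growth M this, of \<epsilon>] \<epsilon> obtain S where
      S: "(\<lambda>j. (deriv ^^ j) h 0 * ((deriv ^^ j) \<psi> 0 / fact j)) sums S" "cmod S \<le> A * \<epsilon>"
      unfolding \<psi>_def by blast
    have "(\<lambda>j. (deriv ^^ j) h 0 / fact j * (\<i> * of_real t - 0) ^ j) sums h (\<i> * of_real t)"
      by (rule holomorphic_power_series[of _ _ "\<bar>t\<bar> + 1"]) (auto intro: holomorphic_on_subset[OF hol] simp: norm_mult)
    moreover have "(\<lambda>j. coeff \<Lambda> j * (deriv ^^ j) h 0) sums (\<Sum>j\<le>n. coeff \<Lambda> j * (deriv ^^ j) h 0)"
      using deg by (intro sums_finite) (auto simp: coeff_eq_0)
    ultimately have 1: "(\<lambda>j. (deriv ^^ j) h 0 / fact j * (\<i> * of_real t - 0) ^ j - coeff \<Lambda> j * (deriv ^^ j) h 0) sums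
        (h (\<i> * of_real t) - (\<Sum>j\<le>n. coeff \<Lambda> j * (deriv ^^ j) h 0))"
      by (rule sums_diff)
    have 2: "(\<lambda>j. (deriv ^^ j) h 0 / fact j * (\<i> * of_real t - 0) ^ j - coeff \<Lambda> j * (deriv ^^ j) h 0) =
       (\<lambda>j. (deriv ^^ j) h 0 * ((deriv ^^ j) \<psi> 0 / fact j))"
      unfolding co by (auto simp: algebra_simps)
    have "h (\<i> * of_real t) - (\<Sum>j\<le>n. coeff \<Lambda> j * (deriv ^^ j) h 0) = S"
      by (rule sums_unique2[OF 1[unfolded 2] S(1)])
    then show "cmod (h (\<i> * of_real t) - (\<Sum>j\<le>n. coeff \<Lambda> j * (deriv ^^ j) h 0)) \<le> A * \<epsilon>"
      using S(2) by simp
  qed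
qed

section \<open>Entire functions of several variables\<close>

lemma norm_vec_smult: "norm (c *s v) = norm c * norm (v :: complex^'n::finite)"
  unfolding norm_vec_def vector_smult_component norm_mult by (rule L2_set_right_distrib[symmetric]) simp

lemma bounded_linear_vec_smult: "bounded_linear (\<lambda>c. c *s (v :: complex^'n::finite))"
proof (rule bounded_linear_intro[where K = "norm v"])
  show "(x + y) *s v = x *s v + y *s v" for x y by (rule vector_sadd_rdistrib)
  show "(r *\<^sub>R x) *s v = r *\<^sub>R (x *s v)" for r x by (simp add: vec_eq_iff)
  show "norm (x *s v) \<le> norm x * norm v" for x by (simp add: norm_vec_smult)
qed

text \<open>Complex homogeneity of the derivative makes the restriction to each complex line
  holomorphic; this is the bridge to one-variable function theory.\<close>

lemma entire_has_derivative_line: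
  fixes f :: "complex^'n::finite \<Rightarrow> complex"
  assumes "entire f"
  obtains f' where "(f has_derivative f') (at z)" "\<And>c h. f' (c *s h) = c * f' h"
    "\<And>v. f' v = deriv (\<lambda>\<zeta>. f (z + \<zeta> *s v)) 0"
    "\<And>v. ((\<lambda>\<zeta>. f (z + \<zeta> *s v)) has_field_derivative f' v) (at 0)"
proof -
  obtain f' where f': "(f has_derivative f') (at z)" "\<And>c h. f' (c *s h) = c * f' h"
    using assms unfolding entire_def by blast
  have d: "((\<lambda>\<zeta>. f (z + \<zeta> *s v)) has_field_derivative f' v) (at 0)" for v
  proof -
    have "((\<lambda>\<zeta>. z + \<zeta> *s v) has_derivative (\<lambda>c. c *s v)) (at 0)"
      using bounded_linear_imp_has_derivative[OF bounded_linear_vec_smult[of v]]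
      by (auto intro!: derivative_eq_intros)
    moreover have "(f has_derivative f') (at (z + 0 *s v))" using f'(1) by simp
    ultimately have "((\<lambda>\<zeta>. f (z + \<zeta> *s v)) has_derivative (\<lambda>c. f' (c *s v))) (at 0)"
      by (rule has_derivative_compose)
    moreover have "(\<lambda>c. c * f' v) = (*) (f' v)" by (rule ext) (rule mult.commute)
    ultimately show ?thesis unfolding has_field_derivative_def f'(2) by simp
  qed
  show thesis by (rule that[OF f' DERIV_imp_deriv[OF d, symmetric] d])
qed

lemma entire_line_holomorphic:
  fixes f :: "complex^'n::finite \<Rightarrow> complex"
  assumes "entire f"
  shows "(\<lambda>\<zeta>. f (z + \<zeta> *s v)) holomorphic_on A"
proof -
  have "\<exists>D. ((\<lambda>\<zeta>. f (z + \<zeta> *s v)) has_field_derivative D) (at w)" for w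
  proof -
    obtain f' where "((\<lambda>\<zeta>. f ((z + w *s v) + \<zeta> *s v)) has_field_derivative f' v) (at 0)"
      using entire_has_derivative_line[OF assms, of "z + w *s v"] by metis
    then have "((\<lambda>\<zeta>. f (z + (w + \<zeta>) *s v)) has_field_derivative f' v) (at 0)"
      by (simp add: vector_sadd_rdistrib add.assoc)
    then have "((\<lambda>\<zeta>. f (z + (\<zeta> + w) *s v)) has_field_derivative f' v) (at 0)"
      by (simp add: add.commute)
    then show ?thesis using DERIV_shift[of "\<lambda>\<zeta>. f (z + \<zeta> *s v)" "f' v" 0 w] by auto
  qed
  then show ?thesis
    unfolding holomorphic_on_def field_differentiable_def by (meson has_field_derivative_at_within)
qed

lemma entire_continuous_on:
  fixes f :: "complex^'n::finite \<Rightarrow> complex"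
  assumes "entire f"
  shows "continuous_on A f"
proof (rule continuous_at_imp_continuous_on, rule ballI)
  fix z
  from assms obtain f' where "(f has_derivative f') (at z)" unfolding entire_def by blast
  then show "isCont f z" by (rule has_derivative_continuous)
qed

lemma entire_const: "entire (\<lambda>z :: complex^'n::finite. c)"
  unfolding entire_def by (intro allI exI[of _ "\<lambda>_. 0"] conjI has_derivative_const) simp

lemma entire_nth: "entire (\<lambda>z :: complex^'n::finite. z $ j)"
  unfolding entire_def
  by (auto intro!: exI[of _ "\<lambda>h. h $ j"] bounded_linear_imp_has_derivative bounded_linear_vec_nth)

lemma entire_add:
  assumes "entire f" "entire (g :: complex^'n::finite \<Rightarrow> complex)"
  shows "entire (\<lambda>z. f z + g z)"
  unfolding entire_def
proof
  fix z
  obtain f' where "(f has_derivative f') (at z)" "\<And>c h. f' (c *s h) = c * f' h"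
    using assms(1) unfolding entire_def by blast
  moreover obtain g' where "(g has_derivative g') (at z)" "\<And>c h. g' (c *s h) = c * g' h"
    using assms(2) unfolding entire_def by blast
  ultimately show "\<exists>h'. ((\<lambda>z. f z + g z) has_derivative h') (at z) \<and> (\<forall>c h. h' (c *s h) = c * h' h)"
    by (intro exI[of _ "\<lambda>h. f' h + g' h"]) (auto intro!: derivative_eq_intros simp: algebra_simps)
qed

lemma entire_mult:
  assumes "entire f" "entire (g :: complex^'n::finite \<Rightarrow> complex)"
  shows "entire (\<lambda>z. f z * g z)"
  unfolding entire_def
proof
  fix z
  obtain f' where "(f has_derivative f') (at z)" "\<And>c h. f' (c *s h) = c * f' h"
    using assms(1) unfolding entire_def by blast
  moreover obtain g' where "(g has_derivative g') (at z)" "\<And>c h. g' (c *s h) = c * g' h"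
    using assms(2) unfolding entire_def by blast
  ultimately show "\<exists>h'. ((\<lambda>z. f z * g z) has_derivative h') (at z) \<and> (\<forall>c h. h' (c *s h) = c * h' h)"
    by (intro exI[of _ "\<lambda>h. f z * g' h + f' h * g z"]) (auto intro!: derivative_eq_intros simp: algebra_simps)
qed

lemma entire_cmult: "entire f \<Longrightarrow> entire (\<lambda>z :: complex^'n::finite. c * f z)"
  by (rule entire_mult[OF entire_const])

lemma entire_diff:
  assumes "entire f" "entire (g :: complex^'n::finite \<Rightarrow> complex)"
  shows "entire (\<lambda>z. f z - g z)"
  using entire_add[OF assms(1) entire_cmult[OF assms(2), of "- 1"]] by simp

lemma entire_sum:
  assumes "\<And>i. i \<in> I \<Longrightarrow> entire (f i :: complex^'n::finite \<Rightarrow> complex)"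
  shows "entire (\<lambda>z. \<Sum>i\<in>I. f i z)"
  using assms by (induction I rule: infinite_finite_induct) (simp_all add: entire_const entire_add)

lemma entire_prod:
  assumes "\<And>i. i \<in> I \<Longrightarrow> entire (f i :: complex^'n::finite \<Rightarrow> complex)"
  shows "entire (\<lambda>z. \<Prod>i\<in>I. f i z)"
  using assms by (induction I rule: infinite_finite_induct) (simp_all add: entire_const entire_mult)

lemma entire_power: "entire f \<Longrightarrow> entire (\<lambda>z :: complex^'n::finite. f z ^ k)"
  by (induction k) (simp_all add: entire_const entire_mult)

lemma entire_compose_holomorphic:
  assumes "entire (f :: complex^'n::finite \<Rightarrow> complex)" "g holomorphic_on UNIV"
  shows "entire (\<lambda>z. g (f z))"
  unfolding entire_def
proof
  fix z
  obtain f' where f': "(f has_derivative f') (at z)" "\<And>c h. f' (c *s h) = c * f' h"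
    using assms(1) unfolding entire_def by blast
  have "(g has_field_derivative deriv g (f z)) (at (f z))"
    using assms(2) holomorphic_derivI by blast
  then have "(g has_derivative (*) (deriv g (f z))) (at (f z))" by (simp add: has_field_derivative_def)
  from has_derivative_compose[OF f'(1) this] f'(2)
  show "\<exists>h'. ((\<lambda>z. g (f z)) has_derivative h') (at z) \<and> (\<forall>c h. h' (c *s h) = c * h' h)"
    by (intro exI[of _ "\<lambda>h. deriv g (f z) * f' h"]) auto
qed

lemma entire_compose_affine:
  assumes "entire (f :: complex^'n::finite \<Rightarrow> complex)"
  shows "entire (\<lambda>z. f (a + c *s z))"
  unfolding entire_def
proof
  fix z
  obtain f' where f': "(f has_derivative f') (at (a + c *s z))" "\<And>c h. f' (c *s h) = c * f' h"
    using assms(1) unfolding entire_def by blast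
  have "bounded_linear (\<lambda>h :: complex^'n. c *s h)"
  proof (rule bounded_linear_intro[where K = "norm c"])
    show "c *s (x + y) = c *s x + c *s y" for x y :: "complex^'n" by (rule vector_add_ldistrib)
    show "c *s (r *\<^sub>R x) = r *\<^sub>R (c *s x)" for r and x :: "complex^'n" by (simp add: vec_eq_iff)
    show "norm (c *s x) \<le> norm x * norm c" for x :: "complex^'n" by (simp add: norm_vec_smult mult.commute)
  qed
  then have "((\<lambda>z. a + c *s z) has_derivative (\<lambda>h. c *s h)) (at z)"
    using bounded_linear_imp_has_derivative by (auto intro!: derivative_eq_intros)
  from has_derivative_compose[OF this f'(1)]
  show "\<exists>h'. ((\<lambda>z. f (a + c *s z)) has_derivative h') (at z) \<and> (\<forall>c h. h' (c *s h) = c * h' h)"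
    by (intro exI[of _ "\<lambda>h. f' (c *s h)"]) (auto simp: f'(2))
qed

definition dir_deriv :: "(complex^'n::finite \<Rightarrow> complex) \<Rightarrow> complex^'n \<Rightarrow> complex^'n \<Rightarrow> complex" where
  "dir_deriv f z v = deriv (\<lambda>\<zeta>. f (z + \<zeta> *s v)) 0"

lemma entire_has_dir_deriv:
  assumes "entire f"
  shows "(f has_derivative dir_deriv f z) (at z)" "dir_deriv f z (c *s h) = c * dir_deriv f z h"
    "((\<lambda>\<zeta>. f (z + \<zeta> *s v)) has_field_derivative dir_deriv f z v) (at 0)"
proof -
  obtain f' where f': "(f has_derivative f') (at z)" "\<And>c h. f' (c *s h) = c * f' h"
    "\<And>v. f' v = deriv (\<lambda>\<zeta>. f (z + \<zeta> *s v)) 0"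
    "\<And>v. ((\<lambda>\<zeta>. f (z + \<zeta> *s v)) has_field_derivative f' v) (at 0)"
    using entire_has_derivative_line[OF assms, of z] by blast
  then have "f' = dir_deriv f z" by (auto simp: dir_deriv_def)
  with f' show "(f has_derivative dir_deriv f z) (at z)" "dir_deriv f z (c *s h) = c * dir_deriv f z h"
    "((\<lambda>\<zeta>. f (z + \<zeta> *s v)) has_field_derivative dir_deriv f z v) (at 0)" by auto
qed

lemma norm_dir_deriv_le:
  assumes f: "entire f" and r: "0 < r" and C: "\<And>w. norm (w - z) \<le> r \<Longrightarrow> cmod (f w) \<le> C"
  shows "cmod (dir_deriv f z v) \<le> C / r * norm v"
proof (cases "v = 0")
  case True
  then show ?thesis by (simp add: dir_deriv_def)
next
  case False
  then have v: "norm v > 0" by simp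
  have "cmod ((deriv ^^ 1) (\<lambda>\<zeta>. f (z + \<zeta> *s v)) 0) \<le> fact 1 * C / (r / norm v) ^ 1"
  proof (rule Cauchy_inequality)
    show "(\<lambda>\<zeta>. f (z + \<zeta> *s v)) holomorphic_on ball 0 (r / norm v)" by (rule entire_line_holomorphic[OF f])
    show "continuous_on (cball 0 (r / norm v)) (\<lambda>\<zeta>. f (z + \<zeta> *s v))"
      by (intro holomorphic_on_imp_continuous_on entire_line_holomorphic[OF f])
    fix x assume "cmod (0 - x) = r / norm v"
    then have "norm ((z + x *s v) - z) \<le> r" using v by (simp add: norm_vec_smult)
    then show "cmod (f (z + x *s v)) \<le> C" by (rule C)
  qed (use r v in auto)
  then show ?thesis by (simp add: dir_deriv_def field_simps)
qed

lemma entire_lipschitz: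
  fixes f :: "complex^'n::finite \<Rightarrow> complex"
  assumes f: "entire f" and r: "0 < r" and C: "\<And>w. norm w \<le> R + r \<Longrightarrow> cmod (f w) \<le> C"
    and xy: "norm x \<le> R" "norm y \<le> R"
  shows "cmod (f x - f y) \<le> C / r * norm (x - y)"
proof (rule differentiable_bound[of "cball 0 R" f "dir_deriv f"])
  show "(f has_derivative dir_deriv f z) (at z within cball 0 R)" for z :: "complex^'n"
    using entire_has_dir_deriv(1)[OF f] has_derivative_at_withinI by blast
  fix z :: "complex^'n" assume z: "z \<in> cball 0 R"
  show "onorm (dir_deriv f z) \<le> C / r"
  proof (rule onorm_bound)
    have "norm (0 :: complex^'n) \<le> R + r" using norm_ge_zero[of x] xy(1) r unfolding norm_zero by linarith
    then have "0 \<le> C" using order_trans[OF norm_ge_zero C] by blast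
    then show "0 \<le> C / r" using r by simp
    fix v
    show "norm (dir_deriv f z v) \<le> C / r * norm v"
    proof (rule norm_dir_deriv_le[OF f r])
      fix w assume "norm (w - z) \<le> r"
      then have "norm w \<le> R + r" using z norm_triangle_sub[of w z] by simp
      then show "cmod (f w) \<le> C" by (rule C)
    qed
  qed
qed (use xy in auto)

lemma dir_deriv_diff:
  assumes "entire f" "entire g"
  shows "dir_deriv (\<lambda>z. f z - g z) z v = dir_deriv f z v - dir_deriv g z v"
  unfolding dir_deriv_def[of "\<lambda>z. f z - g z"]
  by (intro DERIV_imp_deriv DERIV_diff entire_has_dir_deriv(3) assms)

text \<open>Weierstrass' theorem: Cauchy's inequality on a ball enlarged by 1 makes the derivatives
  uniformly Cauchy, so limit and derivative may be interchanged.\<close>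

lemma entire_uniform_limit:
  fixes F :: "nat \<Rightarrow> complex^'n::finite \<Rightarrow> complex"
  assumes F: "\<And>n. entire (F n)" and ul: "\<And>R. uniform_limit (cball 0 R) F f sequentially"
  shows "entire f"
  unfolding entire_def
proof
  fix z0 :: "complex^'n"
  define R where "R = norm z0 + 1"
  have Cau: "\<exists>N. \<forall>m\<ge>N. \<forall>n\<ge>N. \<forall>z. norm z \<le> R \<longrightarrow> (\<forall>v. cmod (dir_deriv (F m) z v - dir_deriv (F n) z v) \<le> e * norm v)"
    if e: "e > 0" for e
  proof -
    have "e / 2 > 0" using e by simp
    from uniform_limitD[OF ul[of "R + 1"] this] obtain N where
      "\<forall>n\<ge>N. \<forall>x\<in>cball 0 (R + 1). dist (F n x) (f x) < e / 2"
      unfolding eventually_sequentially by blast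
    then have N: "\<And>n z. n \<ge> N \<Longrightarrow> norm z \<le> R + 1 \<Longrightarrow> dist (F n z) (f z) < e / 2" by simp
    have "cmod (dir_deriv (F m) z v - dir_deriv (F n) z v) \<le> e * norm v"
      if "m \<ge> N" "n \<ge> N" "norm z \<le> R" for m n z v
    proof -
      have "cmod (dir_deriv (\<lambda>z. F m z - F n z) z v) \<le> e / 1 * norm v"
      proof (rule norm_dir_deriv_le)
        show "entire (\<lambda>z. F m z - F n z)" by (intro entire_diff F)
        fix w assume "norm (w - z) \<le> 1"
        then have "norm w \<le> R + 1" using that(3) norm_triangle_sub[of w z] by linarith
        then show "cmod (F m w - F n w) \<le> e"
          using N[OF that(1), of w] N[OF that(2), of w] dist_triangle2[of "F m w" "F n w" "f w"]
          unfolding dist_norm[symmetric] by linarith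
      qed simp
      then show ?thesis unfolding dir_deriv_diff[OF F F] by simp
    qed
    then show ?thesis by blast
  qed
  define G where "G z v = lim (\<lambda>n. dir_deriv (F n) z v)" for z v
  have lim: "(\<lambda>n. dir_deriv (F n) z v) \<longlonglongrightarrow> G z v" if z: "norm z \<le> R" for z v
  proof -
    have "Cauchy (\<lambda>n. dir_deriv (F n) z v)"
    proof (rule metric_CauchyI)
      fix e :: real assume e: "e > 0"
      have "e / (norm v + 1) > 0" using e by (simp add: add_nonneg_pos)
      from Cau[OF this] obtain N where N: "\<And>m n. m \<ge> N \<Longrightarrow> n \<ge> N \<Longrightarrow>
          cmod (dir_deriv (F m) z v - dir_deriv (F n) z v) \<le> e / (norm v + 1) * norm v" using z by blast
      have p: "norm v + 1 > 0" by (simp add: add_nonneg_pos)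
      then have "e / (norm v + 1) * norm v < e" using e by (simp add: field_simps)
      then show "\<exists>N. \<forall>m\<ge>N. \<forall>n\<ge>N. dist (dir_deriv (F m) z v) (dir_deriv (F n) z v) < e"
        using N unfolding dist_norm by (meson le_less_trans)
    qed
    then show ?thesis unfolding G_def by (simp only: Cauchy_convergent convergent_LIMSEQ_iff[symmetric])
  qed
  have "\<exists>g. \<forall>x\<in>cball 0 R. (\<lambda>n. F n x) \<longlonglongrightarrow> g x \<and> (g has_derivative G x) (at x within cball 0 R)"
  proof (rule has_derivative_sequence)
    show "(F n has_derivative dir_deriv (F n) x) (at x within cball 0 R)" for n x
      using entire_has_dir_deriv(1)[OF F] has_derivative_at_withinI by blast
    show "\<forall>\<^sub>F n in sequentially. \<forall>x\<in>cball 0 R. \<forall>h. norm (dir_deriv (F n) x h - G x h) \<le> e * norm h"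
      if e: "e > 0" for e
    proof -
      obtain N where N: "\<And>m n z v. m \<ge> N \<Longrightarrow> n \<ge> N \<Longrightarrow> norm z \<le> R \<Longrightarrow>
          cmod (dir_deriv (F m) z v - dir_deriv (F n) z v) \<le> e * norm v" using Cau[OF e] by blast
      have "norm (dir_deriv (F n) x h - G x h) \<le> e * norm h" if "n \<ge> N" "x \<in> cball 0 R" for n x h
      proof (rule tendsto_le[OF _ tendsto_const])
        show "(\<lambda>m. norm (dir_deriv (F n) x h - dir_deriv (F m) x h)) \<longlonglongrightarrow> norm (dir_deriv (F n) x h - G x h)"
          using that by (intro tendsto_intros lim) simp
        show "\<forall>\<^sub>F m in sequentially. norm (dir_deriv (F n) x h - dir_deriv (F m) x h) \<le> e * norm h"
          unfolding eventually_sequentially using that by (intro exI[of _ N] allI impI N) auto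
      qed simp
      then show ?thesis unfolding eventually_sequentially by blast
    qed
    have "z0 \<in> cball 0 R" by (simp add: R_def)
    then show "z0 \<in> cball 0 R" "(\<lambda>n. F n z0) \<longlonglongrightarrow> f z0" using tendsto_uniform_limitI[OF ul[of R]] by auto
  qed simp
  then obtain g where g: "\<And>x. x \<in> cball 0 R \<Longrightarrow> (\<lambda>n. F n x) \<longlonglongrightarrow> g x"
    "\<And>x. x \<in> cball 0 R \<Longrightarrow> (g has_derivative G x) (at x within cball 0 R)" by blast
  have gf: "g x = f x" if "x \<in> cball 0 R" for x
    using g(1)[OF that] tendsto_uniform_limitI[OF ul[of R] that] LIMSEQ_unique by blast
  have z0: "z0 \<in> ball 0 R" by (simp add: R_def)
  have "(g has_derivative G z0) (at z0 within ball 0 R)"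
    using z0 by (intro has_derivative_subset[OF g(2) ball_subset_cball]) simp
  then have "(f has_derivative G z0) (at z0 within ball 0 R)"
    by (rule has_derivative_transform[OF z0, rotated]) (simp add: gf)
  then have "(f has_derivative G z0) (at z0)" unfolding at_within_open[OF z0 open_ball] .
  moreover have "G z0 (c *s h) = c * G z0 h" for c h
  proof -
    have n: "norm z0 \<le> R" by (simp add: R_def)
    have "(\<lambda>n. dir_deriv (F n) z0 (c *s h)) \<longlonglongrightarrow> c * G z0 h"
      unfolding entire_has_dir_deriv(2)[OF F] by (intro tendsto_intros lim n)
    then show ?thesis using lim[OF n] LIMSEQ_unique by blast
  qed
  ultimately show "\<exists>f'. (f has_derivative f') (at z0) \<and> (\<forall>c h. f' (c *s h) = c * f' h)" by blast
qed

section \<open>Partial derivatives and differential operators on entire functions\<close>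

definition cpd :: "'n::finite \<Rightarrow> (complex^'n \<Rightarrow> complex) \<Rightarrow> complex^'n \<Rightarrow> complex" where
  "cpd j f z = dir_deriv f z (axis j 1)"

lemma dir_deriv_eq_sum_cpd:
  fixes f :: "complex^'n::finite \<Rightarrow> complex"
  assumes f: "entire f"
  shows "dir_deriv f z v = (\<Sum>j\<in>UNIV. v $ j * cpd j f z)"
proof -
  have "dir_deriv f z v = dir_deriv f z (\<Sum>j\<in>UNIV. (v $ j) *s axis j 1)" by (simp add: basis_expansion)
  also have "\<dots> = (\<Sum>j\<in>UNIV. dir_deriv f z ((v $ j) *s axis j 1))"
    using has_derivative_linear[OF entire_has_dir_deriv(1)[OF f]] by (rule linear_sum)
  finally show ?thesis by (simp only: entire_has_dir_deriv(2)[OF f] cpd_def)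
qed

lemma norm_axis_one: "norm (axis j 1 :: complex^'n::finite) = 1"
proof -
  have "(norm ((axis j 1 :: complex^'n) $ i))\<^sup>2 = (if i = j then 1 else 0)" for i
    by (simp add: axis_def)
  then show ?thesis unfolding norm_vec_def L2_set_def by simp
qed

text \<open>The radius R + 2 has room for |s| \<le> 1 and for a unit circle around each such point;
  Cauchy's inequality for the second derivative on that circle contributes the factor 2!.\<close>

lemma entire_taylor_first_order:
  assumes f: "entire f" and C: "\<And>w. norm w \<le> R + 2 \<Longrightarrow> cmod (f w) \<le> C"
    and z: "norm z \<le> R" and v: "norm v = 1" and s: "cmod s \<le> 1"
  shows "cmod (f (z + s *s v) - f z - s * dir_deriv f z v) \<le> 2 * C * (cmod s)\<^sup>2"
proof -
  define g where "g \<zeta> = f (z + \<zeta> *s v)" for \<zeta>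
  have g: "g holomorphic_on A" for A unfolding g_def[abs_def] by (rule entire_line_holomorphic[OF f])
  have "cmod ((deriv ^^ 0) g s - (\<Sum>i\<le>1. (deriv ^^ i) g 0 * (s - 0) ^ i / fact i)) \<le> 2 * C * cmod (s - 0) ^ Suc 1 / fact 1"
  proof (rule complex_Taylor[of "cball 0 1"])
    show "((deriv ^^ i) g has_field_derivative (deriv ^^ Suc i) g x) (at x within cball 0 1)" for i x
      using holomorphic_derivI[OF holomorphic_higher_deriv[OF g open_UNIV] open_UNIV, of x i]
      by (simp add: has_field_derivative_at_within)
    show "cmod ((deriv ^^ Suc 1) g x) \<le> 2 * C" if x: "x \<in> cball 0 1" for x
    proof -
      have "cmod ((deriv ^^ Suc 1) g x) \<le> fact (Suc 1) * C / 1 ^ Suc 1"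
      proof (rule Cauchy_inequality[OF g])
        show "continuous_on (cball x 1) g" using g holomorphic_on_imp_continuous_on by blast
        fix y assume "cmod (x - y) = 1"
        then have "cmod y \<le> 2" using x norm_triangle_sub[of y x] by (simp add: norm_minus_commute)
        then have "norm (z + y *s v) \<le> R + 2"
          using z v norm_triangle_ineq[of z "y *s v"] by (simp add: norm_vec_smult)
        then show "cmod (g y) \<le> C" unfolding g_def by (rule C)
      qed simp
      then show ?thesis by simp
    qed
  qed (use s in auto)
  then show ?thesis by (simp add: g_def[abs_def] dir_deriv_def power2_eq_square algebra_simps)
qed

lemma entire_bounded_on_cball:
  fixes f :: "complex^'n::finite \<Rightarrow> complex"
  assumes "entire f"
  obtains C where "\<And>w. norm w \<le> R \<Longrightarrow> cmod (f w) \<le> C"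
proof -
  have "bounded (f ` cball 0 R)"
    by (intro compact_imp_bounded compact_continuous_image entire_continuous_on[OF assms] compact_cball)
  then obtain C where "\<forall>x \<in> f ` cball 0 R. cmod x \<le> C" using bounded_iff by blast
  then show thesis using that[of C] by auto
qed

lemma entire_shift:
  assumes "entire (f :: complex^'n::finite \<Rightarrow> complex)"
  shows "entire (\<lambda>z. f (z + a))"
proof -
  have "a + 1 *s z = z + a" for z :: "complex^'n" by (simp only: vector_smult_lid add.commute)
  with entire_compose_affine[OF assms, of a 1] show ?thesis by (simp only:)
qed

text \<open>By \<open>entire_taylor_first_order\<close> the difference quotients with step 1 / (n +
  1) converge uniformly on balls.\<close>

lemma entire_cpd:
  fixes f :: "complex^'n::finite \<Rightarrow> complex"
  assumes f: "entire f"
  shows "entire (cpd j f)"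
proof (rule entire_uniform_limit)
  let ?F = "\<lambda>n z. of_nat (Suc n) * (f (z + (1 / of_nat (Suc n)) *s axis j 1) - f z)"
  show "entire (?F n)" for n by (intro entire_cmult entire_diff entire_shift f)
  show "uniform_limit (cball 0 R) ?F (cpd j f) sequentially" for R
  proof (rule uniform_limitI)
    fix e :: real assume e: "e > 0"
    obtain C where C: "\<And>w. norm w \<le> R + 2 \<Longrightarrow> cmod (f w) \<le> C" using entire_bounded_on_cball[OF f] by blast
    have "(\<lambda>n. 2 * C / real (Suc n)) \<longlonglongrightarrow> 0" by real_asymp
    then have "\<forall>\<^sub>F n in sequentially. 2 * C / real (Suc n) < e" using e by (rule order_tendstoD)
    then show "\<forall>\<^sub>F n in sequentially. \<forall>x\<in>cball 0 R. dist (?F n x) (cpd j f x) < e"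
    proof eventually_elim
      case (elim n)
      show ?case
      proof
        fix x :: "complex^'n" assume x: "x \<in> cball 0 R"
        define s :: complex where "s = 1 / of_nat (Suc n)"
        have s: "cmod s = 1 / real (Suc n)" unfolding s_def norm_divide norm_of_nat by simp
        then have s1: "cmod s \<le> 1" by simp
        have ns: "of_nat (Suc n) * s = 1" unfolding s_def by (simp del: of_nat_Suc)
        have "cmod (f (x + s *s axis j 1) - f x - s * cpd j f x) \<le> 2 * C * (cmod s)\<^sup>2"
          unfolding cpd_def using x by (intro entire_taylor_first_order[OF f C _ norm_axis_one s1]) auto
        then have "real (Suc n) * cmod (f (x + s *s axis j 1) - f x - s * cpd j f x) \<le> real (Suc n) * (2 * C * (cmod s)\<^sup>2)"
          by (intro mult_left_mono) auto
        also have "\<dots> = 2 * C / real (Suc n)" unfolding s power2_eq_square by (simp del: of_nat_Suc)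
        finally have "cmod (of_nat (Suc n) * (f (x + s *s axis j 1) - f x - s * cpd j f x)) \<le> 2 * C / real (Suc n)"
          unfolding norm_mult norm_of_nat .
        moreover have "of_nat (Suc n) * (f (x + s *s axis j 1) - f x - s * cpd j f x) = ?F n x - cpd j f x"
          unfolding right_diff_distrib mult.assoc[symmetric] ns s_def by (simp del: of_nat_Suc)
        ultimately show "dist (?F n x) (cpd j f x) < e" using elim by (simp only: dist_norm)
      qed
    qed
  qed
qed

abbreviation cvec :: "real^'n::finite \<Rightarrow> complex^'n" where
  "cvec x \<equiv> (\<chi> j. complex_of_real (x $ j))"

lemma cvec_add: "cvec (x + y) = cvec x + cvec y"
  by (simp add: vec_eq_iff)

lemma cvec_scaleR: "cvec (t *\<^sub>R x) = of_real t *s cvec x"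
  by (simp add: vec_eq_iff)

lemma cvec_axis: "cvec (axis j 1) = axis j 1"
  by (simp add: vec_eq_iff axis_def)

lemma cvec_0: "cvec 0 = 0"
  by (simp add: vec_eq_iff)

lemma partial_deriv_restrict_real:
  assumes f: "entire f"
  shows "partial_deriv j (restrict_real f) = restrict_real (cpd j f)"
proof
  fix y
  have "((\<lambda>\<zeta>. f (cvec y + \<zeta> *s axis j 1)) has_field_derivative cpd j f (cvec y)) (at (of_real 0))"
    unfolding cpd_def using entire_has_dir_deriv(3)[OF f] by simp
  then have "((\<lambda>t. f (cvec y + of_real t *s axis j 1)) has_vector_derivative cpd j f (cvec y)) (at 0)"
    by (rule has_vector_derivative_real_field)
  then show "partial_deriv j (restrict_real f) y = restrict_real (cpd j f) y"
    unfolding partial_deriv_def restrict_real_def cvec_add cvec_scaleR cvec_axis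
    by (rule vector_derivative_at)
qed

text \<open>The coordinates are taken in the same order as in \<open>multi_deriv\<close>, so that
  both agree on restrictions without any commutation of derivatives.\<close>

definition cmd :: "nat^'n::{finite,linorder} \<Rightarrow> (complex^'n::{finite,linorder} \<Rightarrow> complex) \<Rightarrow>
    complex^'n::{finite,linorder} \<Rightarrow> complex" where
  "cmd \<alpha> f = foldr (\<lambda>j. cpd j ^^ (\<alpha> $ j)) (sorted_list_of_set UNIV) f"

lemma entire_cpd_funpow: "entire f \<Longrightarrow> entire ((cpd j ^^ k) f)"
  by (induction k) (simp_all add: entire_cpd)

lemma entire_foldr_cpd: "entire f \<Longrightarrow> entire (foldr (\<lambda>j. cpd j ^^ e j) js f)"
  by (induction js) (simp_all add: entire_cpd_funpow)

lemma entire_cmd: "entire f \<Longrightarrow> entire (cmd \<alpha> f)"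
  unfolding cmd_def by (rule entire_foldr_cpd)

lemma partial_deriv_funpow_restrict_real:
  "entire f \<Longrightarrow> (partial_deriv j ^^ k) (restrict_real f) = restrict_real ((cpd j ^^ k) f)"
  by (induction k) (simp_all add: partial_deriv_restrict_real entire_cpd_funpow)

lemma multi_deriv_restrict_real:
  assumes "entire f"
  shows "multi_deriv \<alpha> (restrict_real f) = restrict_real (cmd \<alpha> f)"
proof -
  have "foldr (\<lambda>j. partial_deriv j ^^ (\<alpha> $ j)) js (restrict_real f) =
      restrict_real (foldr (\<lambda>j. cpd j ^^ (\<alpha> $ j)) js f)" for js
    using assms
    by (induction js) (simp_all add: partial_deriv_funpow_restrict_real entire_foldr_cpd)
  then show ?thesis by (simp only: multi_deriv_def cmd_def)
qed

lemma diff_op_restrict_real: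
  assumes "entire f"
  shows "diff_op N b (restrict_real f) x = (\<Sum>\<alpha> | mi_size \<alpha> = N. b \<alpha> * cmd \<alpha> f (cvec x))"
  by (simp add: diff_op_def multi_deriv_restrict_real[OF assms] restrict_real_def)

lemma cpd_affine:
  assumes f: "entire f"
  shows "cpd j (\<lambda>z. k * f (a + c *s z)) = (\<lambda>z. k * c * cpd j f (a + c *s z))"
proof
  fix z
  have e: "entire (\<lambda>z. k * f (a + c *s z))" by (intro entire_cmult entire_compose_affine f)
  have "((\<lambda>\<zeta>. c * \<zeta>) has_field_derivative c) (at 0)" by (auto intro!: derivative_eq_intros)
  moreover have "((\<lambda>\<zeta>. f ((a + c *s z) + \<zeta> *s axis j 1)) has_field_derivative cpd j f (a + c *s z)) (at (c * 0))"
    unfolding cpd_def mult_zero_right by (rule entire_has_dir_deriv(3)[OF f])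
  ultimately have "((\<lambda>\<zeta>. f ((a + c *s z) + (c * \<zeta>) *s axis j 1)) has_field_derivative cpd j f (a + c *s z) * c) (at 0)"
    using DERIV_chain2 by fastforce
  then have "((\<lambda>\<zeta>. k * f ((a + c *s z) + (c * \<zeta>) *s axis j 1)) has_field_derivative k * (cpd j f (a + c *s z) * c)) (at 0)"
    by (rule DERIV_cmult)
  moreover have "(\<lambda>\<zeta>. k * f ((a + c *s z) + (c * \<zeta>) *s axis j 1)) = (\<lambda>\<zeta>. k * f (a + c *s (z + \<zeta> *s axis j 1)))"
    by (simp add: vector_add_ldistrib vector_smult_assoc add.assoc)
  ultimately have "((\<lambda>\<zeta>. k * f (a + c *s (z + \<zeta> *s axis j 1))) has_field_derivative k * (cpd j f (a + c *s z) * c)) (at 0)"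
    by simp
  moreover have "((\<lambda>\<zeta>. k * f (a + c *s (z + \<zeta> *s axis j 1))) has_field_derivative cpd j (\<lambda>z. k * f (a + c *s z)) z) (at 0)"
    unfolding cpd_def by (rule entire_has_dir_deriv(3)[OF e])
  ultimately show "cpd j (\<lambda>z. k * f (a + c *s z)) z = k * c * cpd j f (a + c *s z)"
    using DERIV_unique by fastforce
qed

lemma cpd_funpow_affine:
  assumes f: "entire f"
  shows "(cpd j ^^ n) (\<lambda>z. k * f (a + c *s z)) = (\<lambda>z. k * c ^ n * (cpd j ^^ n) f (a + c *s z))"
proof (induction n)
  case (Suc n)
  have "(cpd j ^^ Suc n) (\<lambda>z. k * f (a + c *s z)) = cpd j (\<lambda>z. k * c ^ n * (cpd j ^^ n) f (a + c *s z))"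
    using Suc by simp
  also have "\<dots> = (\<lambda>z. k * c ^ n * c * (cpd j ^^ Suc n) f (a + c *s z))"
    unfolding cpd_affine[OF entire_cpd_funpow[OF f]] by simp
  finally show ?case by (simp add: mult_ac)
qed simp

lemma cmd_affine:
  assumes f: "entire f"
  shows "cmd \<alpha> (\<lambda>z. k * f (a + c *s z)) = (\<lambda>z. k * c ^ mi_size \<alpha> * cmd \<alpha> f (a + c *s z))"
proof -
  have "foldr (\<lambda>j. cpd j ^^ (\<alpha> $ j)) js (\<lambda>z. k * f (a + c *s z)) =
    (\<lambda>z. k * c ^ (\<Sum>j\<leftarrow>js. \<alpha> $ j) * foldr (\<lambda>j. cpd j ^^ (\<alpha> $ j)) js f (a + c *s z))" for js
  proof (induction js)
    case (Cons j js)
    show ?case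
      unfolding foldr.simps o_def Cons.IH cpd_funpow_affine[OF entire_foldr_cpd[OF f]]
      by (simp add: power_add mult_ac)
  qed simp
  moreover have "(\<Sum>j\<leftarrow>sorted_list_of_set UNIV. \<alpha> $ j) = mi_size \<alpha>"
    unfolding mi_size_def by (subst sum_list_distinct_conv_sum_set) auto
  ultimately show ?thesis unfolding cmd_def by simp
qed

text \<open>Lets an estimate at 0 for a translated and dilated function be read as an estimate at an
  arbitrary point \<open>x0\<close>.\<close>

lemma diff_op_affine:
  assumes f: "entire f"
  shows "diff_op N b (restrict_real (\<lambda>z. k * f (cvec x0 + of_real t *s z))) x =
    k * of_real t ^ N * diff_op N b (restrict_real f) (x0 + t *\<^sub>R x)"
proof -
  have e: "entire (\<lambda>z. k * f (cvec x0 + of_real t *s z))" by (intro entire_cmult entire_compose_affine f)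
  show ?thesis
    unfolding diff_op_restrict_real[OF e] diff_op_restrict_real[OF f] cmd_affine[OF f] cvec_add cvec_scaleR sum_distrib_left
    by (rule sum.cong) auto
qed

text \<open>Cauchy's inequality with radius 1: each derivative costs one unit of radius and no
  constant.\<close>

lemma cpd_bound:
  fixes f :: "complex^'n::finite \<Rightarrow> complex"
  assumes "entire f" "\<And>w. norm w \<le> R + 1 \<Longrightarrow> cmod (f w) \<le> C" "norm z \<le> R"
  shows "cmod (cpd j f z) \<le> C"
proof -
  have "cmod (dir_deriv f z (axis j 1)) \<le> C / 1 * norm (axis j 1 :: complex^'n)"
  proof (rule norm_dir_deriv_le[OF assms(1)])
    fix w assume "norm (w - z) \<le> 1"
    then have "norm w \<le> R + 1" using assms(3) norm_triangle_sub[of w z] by linarith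
    then show "cmod (f w) \<le> C" by (rule assms(2))
  qed simp
  then show ?thesis by (simp add: cpd_def norm_axis_one)
qed

lemma cpd_funpow_bound:
  fixes f :: "complex^'n::finite \<Rightarrow> complex"
  assumes "entire f" "\<And>w. norm w \<le> R + real k \<Longrightarrow> cmod (f w) \<le> C" "norm z \<le> R"
  shows "cmod ((cpd j ^^ k) f z) \<le> C"
  using assms(2,3)
proof (induction k arbitrary: R z)
  case (Suc k)
  show ?case unfolding funpow.simps o_def
  proof (rule cpd_bound[OF entire_cpd_funpow[OF assms(1)] _ Suc.prems(2)])
    fix w :: "complex^'n" assume "norm w \<le> R + 1"
    then show "cmod ((cpd j ^^ k) f w) \<le> C" using Suc.prems(1) by (intro Suc.IH[of "R + 1"]) (auto simp: add_ac)
  qed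
qed simp

lemma cmd_bound:
  fixes f :: "complex^'n::{finite,linorder} \<Rightarrow> complex"
  assumes "entire f" "\<And>w. norm w \<le> R + real (mi_size \<alpha>) \<Longrightarrow> cmod (f w) \<le> C" "norm z \<le> R"
  shows "cmod (cmd \<alpha> f z) \<le> C"
proof -
  have main: "cmod (foldr (\<lambda>j. cpd j ^^ (\<alpha> $ j)) js f z) \<le> C"
    if "\<And>w. norm w \<le> R + real (\<Sum>j\<leftarrow>js. \<alpha> $ j) \<Longrightarrow> cmod (f w) \<le> C" "norm z \<le> R" for R z js
    using that
  proof (induction js arbitrary: R z)
    case (Cons j js)
    show ?case unfolding foldr.simps o_def
    proof (rule cpd_funpow_bound[OF entire_foldr_cpd[OF assms(1)] _ Cons.prems(2)])
      fix w :: "complex^'n::{finite,linorder}" assume "norm w \<le> R + real (\<alpha> $ j)"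
      then show "cmod (foldr (\<lambda>j. cpd j ^^ (\<alpha> $ j)) js f w) \<le> C"
        using Cons.prems(1) by (intro Cons.IH[of "R + real (\<alpha> $ j)"]) (auto simp: add_ac)
    qed
  qed simp
  moreover have "(\<Sum>j\<leftarrow>sorted_list_of_set UNIV. \<alpha> $ j) = mi_size \<alpha>"
    unfolding mi_size_def by (subst sum_list_distinct_conv_sum_set) auto
  ultimately show ?thesis unfolding cmd_def by (intro main[OF _ assms(3)] assms(2)) simp
qed

lemma diff_op_bound:
  fixes f :: "complex^'n::{finite,linorder} \<Rightarrow> complex"
  assumes f: "entire f" and C: "\<And>w. norm w \<le> real N \<Longrightarrow> cmod (f w) \<le> C"
  shows "cmod (diff_op N b (restrict_real f) 0) \<le> (\<Sum>\<alpha> | mi_size \<alpha> = N. cmod (b \<alpha>)) * C"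
  unfolding diff_op_restrict_real[OF f] sum_distrib_right
proof (rule sum_norm_le)
  fix \<alpha> :: "nat^'n::{finite,linorder}" assume "\<alpha> \<in> {\<alpha>. mi_size \<alpha> = N}"
  then have "cmod (cmd \<alpha> f 0) \<le> C" by (intro cmd_bound[OF f, of 0]) (auto simp: C)
  then show "cmod (b \<alpha> * cmd \<alpha> f (cvec 0)) \<le> cmod (b \<alpha>) * C"
    unfolding cvec_0 by (simp add: norm_mult mult_left_mono)
qed

text \<open>The mode of convergence that is stable under differentiation: pointwise on \<open>\<real>\<^sup>m\<close> and
  eventually locally bounded on \<open>\<complex>\<^sup>m\<close>.\<close>

definition real_conv :: "(nat \<Rightarrow> complex^'n::finite \<Rightarrow> complex) \<Rightarrow> (complex^'n \<Rightarrow> complex) \<Rightarrow> bool" where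
  "real_conv F f \<longleftrightarrow> (\<forall>n. entire (F n)) \<and> entire f \<and>
     (\<forall>R. \<exists>C. \<forall>\<^sub>F n in sequentially. \<forall>z. norm z \<le> R \<longrightarrow> cmod (F n z) \<le> C) \<and>
     (\<forall>x. (\<lambda>n. F n (cvec x)) \<longlonglongrightarrow> f (cvec x))"

text \<open>Difference quotients with a fixed real step converge because both nodes are real points;
  the local bounds make the Taylor error small uniformly in n.\<close>

lemma real_conv_cpd:
  fixes F :: "nat \<Rightarrow> complex^'n::finite \<Rightarrow> complex"
  assumes "real_conv F f"
  shows "real_conv (\<lambda>n. cpd j (F n)) (cpd j f)"
proof -
  have F: "\<And>n. entire (F n)" and f: "entire f"
    and bd: "\<And>R. \<exists>C. \<forall>\<^sub>F n in sequentially. \<forall>z. norm z \<le> R \<longrightarrow> cmod (F n z) \<le> C"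
    and lim: "\<And>x. (\<lambda>n. F n (cvec x)) \<longlonglongrightarrow> f (cvec x)"
    using assms unfolding real_conv_def by auto
  have "\<exists>C. \<forall>\<^sub>F n in sequentially. \<forall>z. norm z \<le> R \<longrightarrow> cmod (cpd j (F n) z) \<le> C" for R
  proof -
    obtain C where C: "\<forall>\<^sub>F n in sequentially. \<forall>z. norm z \<le> R + 1 \<longrightarrow> cmod (F n z) \<le> C"
      using bd by blast
    from C have "\<forall>\<^sub>F n in sequentially. \<forall>z. norm z \<le> R \<longrightarrow> cmod (cpd j (F n) z) \<le> C"
      by eventually_elim (blast intro: cpd_bound[OF F])
    then show ?thesis ..
  qed
  moreover have "(\<lambda>n. cpd j (F n) (cvec x)) \<longlonglongrightarrow> cpd j f (cvec x)" for x
  proof (rule tendstoI)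
    fix e :: real assume e: "e > 0"
    define z where "z = cvec x"
    obtain C1 where C1: "\<forall>\<^sub>F n in sequentially. \<forall>w. norm w \<le> norm z + 2 \<longrightarrow> cmod (F n w) \<le> C1"
      using bd by blast
    obtain C2 where C2: "\<And>w. norm w \<le> norm z + 2 \<Longrightarrow> cmod (f w) \<le> C2"
      using entire_bounded_on_cball[OF f] by blast
    \<comment> \<open>The 1 keeps C positive in the quotient defining \<open>s\<close>. With that
      \<open>s\<close> the two Taylor errors contribute at most s e / 2 and the convergence of the
      differences s e / 4.\<close>
    define C where "C = max 1 (max C1 C2)"
    define s where "s = min 1 (e / (8 * C))"
    have C0: "C > 0" by (simp add: C_def)
    have s: "0 < s" "s \<le> 1" "4 * C * s \<le> e / 2" using e C0 by (auto simp: s_def min_def field_simps)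
    have cs: "cmod (of_real s) \<le> 1" using s by simp
    have zs: "z + of_real s *s axis j 1 = cvec (x + s *\<^sub>R axis j 1)"
      by (simp only: cvec_add cvec_scaleR cvec_axis z_def)
    define q where "q g = g (z + of_real s *s axis j 1) - g z" for g :: "complex^'n \<Rightarrow> complex"
    have T: "cmod (q g - of_real s * cpd j g z) \<le> 2 * C * s\<^sup>2"
      if "entire g" "\<And>w. norm w \<le> norm z + 2 \<Longrightarrow> cmod (g w) \<le> C" for g
      using entire_taylor_first_order[OF that order_refl norm_axis_one[of j] cs] s
      by (simp add: q_def cpd_def)
    have "(\<lambda>n. q (F n)) \<longlonglongrightarrow> q f" unfolding q_def zs unfolding z_def by (intro tendsto_intros lim)
    moreover have "s * (e / 4) > 0" using s e by simp
    ultimately have "\<forall>\<^sub>F n in sequentially. dist (q (F n)) (q f) < s * (e / 4)" by (rule tendstoD)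
    with C1 show "\<forall>\<^sub>F n in sequentially. dist (cpd j (F n) (cvec x)) (cpd j f (cvec x)) < e"
    proof eventually_elim
      case (elim n)
      have "cmod (q (F n) - of_real s * cpd j (F n) z) \<le> 2 * C * s\<^sup>2"
        using elim(1) by (intro T F) (auto simp: C_def le_max_iff_disj)
      moreover have "cmod (q f - of_real s * cpd j f z) \<le> 2 * C * s\<^sup>2"
        using C2 by (intro T f) (auto simp: C_def le_max_iff_disj)
      moreover have "cmod (q (F n) - q f) < s * (e / 4)" using elim(2) by (simp only: dist_norm)
      moreover have "of_real s * (cpd j (F n) z - cpd j f z) =
          (q (F n) - q f) - (q (F n) - of_real s * cpd j (F n) z) + (q f - of_real s * cpd j f z)"
        by (simp add: algebra_simps)
      then have "cmod (of_real s * (cpd j (F n) z - cpd j f z)) \<le> cmod (q (F n) - q f) +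
          cmod (q (F n) - of_real s * cpd j (F n) z) + cmod (q f - of_real s * cpd j f z)"
        by (metis (no_types) norm_triangle_le norm_triangle_ineq4 add_right_mono)
      ultimately have "cmod (of_real s * (cpd j (F n) z - cpd j f z)) < s * (e / 4) + 4 * C * s\<^sup>2" by linarith
      also have "4 * C * s\<^sup>2 = s * (4 * C * s)" by (simp add: power2_eq_square)
      also have "s * (e / 4) + s * (4 * C * s) \<le> s * (e / 4) + s * (e / 2)" using s by (intro add_left_mono mult_left_mono) auto
      also have "\<dots> < s * e" using s e by (simp add: algebra_simps flip: distrib_left)
      finally have "s * cmod (cpd j (F n) z - cpd j f z) < s * e" using s by (simp add: norm_mult)
      then show ?case using s by (simp add: dist_norm z_def)
    qed
  qed
  ultimately show ?thesis unfolding real_conv_def by (intro conjI allI entire_cpd F f)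
qed

lemma real_conv_cmd:
  assumes "real_conv F f"
  shows "real_conv (\<lambda>n. cmd \<alpha> (F n)) (cmd \<alpha> f)"
proof -
  have 1: "real_conv (\<lambda>n. (cpd j ^^ k) (G n)) ((cpd j ^^ k) g)" if "real_conv G g" for G g j k
    using that by (induction k) (simp_all add: real_conv_cpd)
  have "real_conv (\<lambda>n. foldr (\<lambda>j. cpd j ^^ (\<alpha> $ j)) js (F n)) (foldr (\<lambda>j. cpd j ^^ (\<alpha> $ j)) js f)" for js
    using assms by (induction js) (simp_all add: 1)
  then show ?thesis unfolding cmd_def .
qed

lemma real_conv_diff_op:
  assumes "real_conv F f"
  shows "(\<lambda>n. diff_op N b (restrict_real (F n)) x) \<longlonglongrightarrow> diff_op N b (restrict_real f) x"
proof -
  have F: "entire (F n)" and f: "entire f" for n using assms unfolding real_conv_def by auto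
  have "(\<lambda>n. cmd \<alpha> (F n) (cvec x)) \<longlonglongrightarrow> cmd \<alpha> f (cvec x)" for \<alpha>
    using real_conv_cmd[OF assms, of \<alpha>] unfolding real_conv_def by blast
  then show ?thesis unfolding diff_op_restrict_real[OF F] diff_op_restrict_real[OF f]
    by (intro tendsto_sum tendsto_mult tendsto_const)
qed

section \<open>Normal families\<close>

text \<open>Local bounds give equicontinuity by \<open>entire_lipschitz\<close>; Arzela--Ascoli
  applies on each ball, and a diagonal sequence serves all balls.\<close>

lemma montel_entire:
  fixes F :: "nat \<Rightarrow> complex^'n::finite \<Rightarrow> complex"
  assumes F: "\<And>n. entire (F n)"
    and bd: "\<And>R. \<exists>C. \<forall>\<^sub>F n in sequentially. \<forall>z. norm z \<le> R \<longrightarrow> cmod (F n z) \<le> C"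
  obtains k f where "strict_mono k" "entire f" "\<And>z. (\<lambda>n. F (k n) z) \<longlonglongrightarrow> f z" "real_conv (\<lambda>n. F (k n)) f"
proof -
  have "\<forall>i :: nat. \<exists>C. \<forall>\<^sub>F n in sequentially. \<forall>z. norm z \<le> real i + 1 \<longrightarrow> cmod (F n z) \<le> C" using bd by blast
  from choice[OF this] obtain C where
    C: "\<And>i. \<forall>\<^sub>F n in sequentially. \<forall>z. norm z \<le> real i + 1 \<longrightarrow> cmod (F n z) \<le> C i" by blast
  \<comment> \<open>The bounds hold only eventually, from an index depending on the radius; on each
    ball the offending functions are replaced by 0, which does not change the limit.\<close>
  define G where "G i n = (if \<forall>z. norm z \<le> real i + 1 \<longrightarrow> cmod (F n z) \<le> C i then F n else (\<lambda>_. 0))" for i n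
  have Ge: "entire (G i n)" for i n by (simp add: G_def F entire_const)
  have Gb: "cmod (G i n z) \<le> max 0 (C i)" if "norm z \<le> real i + 1" for i n z
    using that by (auto simp: G_def le_max_iff_disj)
  have GF: "\<forall>\<^sub>F n in sequentially. G i n = F n" for i
    using C[of i] by eventually_elim (auto simp: G_def)
  define P where "P i s \<longleftrightarrow> (\<exists>g. uniform_limit (cball 0 (real i)) (\<lambda>n. G i (s n)) g sequentially)" for i and s :: "nat \<Rightarrow> nat"
  obtain k :: "nat \<Rightarrow> nat" where k: "strict_mono k" "\<And>i. P i (id \<circ> k)"
  proof (rule subsequence_diagonalization_lemma[of P id])
    fix i :: nat and r :: "nat \<Rightarrow> nat"
    obtain g and k :: "nat \<Rightarrow> nat" where "strict_mono k"
      "\<And>e. 0 < e \<Longrightarrow> \<exists>N. \<forall>n x. n \<ge> N \<and> x \<in> cball 0 (real i) \<longrightarrow> norm (G i (r (k n)) x - g x) < e"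
    proof (rule Arzela_Ascoli[of "cball 0 (real i)" "\<lambda>n. G i (r n)" "max 0 (C i)"])
      show "norm (G i (r n) x) \<le> max 0 (C i)" if "x \<in> cball 0 (real i)" for n x using that by (intro Gb) simp
      fix x :: "complex^'n" and e :: real assume x: "x \<in> cball 0 (real i)" and e: "0 < e"
      define d where "d = e / (max 0 (C i) + 1)"
      have M: "max 0 (C i) + 1 > 0" by simp
      have d: "d > 0" using e M by (simp add: d_def del: max_less_iff_conj)
      have "norm (G i (r n) x - G i (r n) y) < e" if "y \<in> cball 0 (real i)" "norm (x - y) < d" for n y
      proof -
        have "cmod (G i (r n) x - G i (r n) y) \<le> max 0 (C i) / 1 * norm (x - y)"
          using x that by (intro entire_lipschitz[OF Ge _ Gb]) auto
        also have "\<dots> \<le> (max 0 (C i) + 1) * norm (x - y)" by (intro mult_right_mono) auto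
        also have "\<dots> < (max 0 (C i) + 1) * d" using that(2) M by (rule mult_strict_left_mono)
        also have "\<dots> = e" using M by (simp add: d_def)
        finally show ?thesis .
      qed
      then show "\<exists>d>0. \<forall>n y. y \<in> cball 0 (real i) \<and> norm (x - y) < d \<longrightarrow> norm (G i (r n) x - G i (r n) y) < e"
        using d by blast
    qed auto
    then have "uniform_limit (cball 0 (real i)) (\<lambda>n. G i ((r \<circ> k) n)) g sequentially"
      unfolding uniform_limit_iff eventually_sequentially dist_norm o_def by blast
    then show "\<exists>k. strict_mono k \<and> P i (r \<circ> k)" using \<open>strict_mono k\<close> unfolding P_def by blast
  next
    fix i N :: nat and r k1 k2 :: "nat \<Rightarrow> nat"
    assume "P i (r \<circ> k1)" and sub: "\<And>j. N \<le> j \<Longrightarrow> \<exists>j'. j \<le> j' \<and> k2 j = k1 j'"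
    then obtain g where g: "uniform_limit (cball 0 (real i)) (\<lambda>n. G i ((r \<circ> k1) n)) g sequentially"
      unfolding P_def by blast
    have "uniform_limit (cball 0 (real i)) (\<lambda>n. G i ((r \<circ> k2) n)) g sequentially"
      unfolding uniform_limit_iff
    proof (intro allI impI)
      fix e :: real assume "0 < e"
      with g obtain N0 where N0: "\<And>n x. n \<ge> N0 \<Longrightarrow> x \<in> cball 0 (real i) \<Longrightarrow> dist (G i ((r \<circ> k1) n) x) (g x) < e"
        unfolding uniform_limit_iff eventually_sequentially by blast
      have "dist (G i ((r \<circ> k2) n) x) (g x) < e" if n: "n \<ge> max N N0" and x: "x \<in> cball 0 (real i)" for n x
      proof -
        obtain j' where "n \<le> j'" "k2 n = k1 j'" using sub[of n] n by auto
        then show ?thesis using N0[of j' x] n x by simp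
      qed
      then show "\<forall>\<^sub>F n in sequentially. \<forall>x\<in>cball 0 (real i). dist (G i ((r \<circ> k2) n) x) (g x) < e"
        unfolding eventually_sequentially by blast
    qed
    then show "P i (r \<circ> k2)" unfolding P_def by blast
  qed blast
  define f where "f z = lim (\<lambda>n. F (k n) z)" for z
  have ul: "uniform_limit (cball 0 (real i)) (\<lambda>n. F (k n)) f sequentially" for i
  proof -
    obtain g where G: "uniform_limit (cball 0 (real i)) (\<lambda>n. G i (k n)) g sequentially"
      using k(2)[of i] unfolding P_def by auto
    have "\<forall>\<^sub>F n in sequentially. G i (k n) = F (k n)"
      using GF[of i] filterlim_subseq[OF k(1)] unfolding filterlim_iff by blast
    then have ev: "\<forall>\<^sub>F n in sequentially. \<forall>x\<in>cball 0 (real i). G i (k n) x = F (k n) x"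
      by eventually_elim simp
    have g: "uniform_limit (cball 0 (real i)) (\<lambda>n. F (k n)) g sequentially"
      by (rule iffD1[OF uniform_limit_cong[OF ev refl] G])
    have gf: "g x = f x" if "x \<in> cball 0 (real i)" for x
      unfolding f_def using tendsto_uniform_limitI[OF g that] by (rule limI[symmetric])
    show ?thesis by (rule iffD1[OF uniform_limit_cong[OF _ gf] g]) simp
  qed
  have ulR: "uniform_limit (cball 0 R) (\<lambda>n. F (k n)) f sequentially" for R
  proof -
    obtain i :: nat where "R \<le> real i" using real_arch_simple by blast
    then show ?thesis by (intro uniform_limit_on_subset[OF ul[of i]] subset_cball)
  qed
  have f: "entire f" by (rule entire_uniform_limit[OF F ulR])
  have pw: "(\<lambda>n. F (k n) z) \<longlonglongrightarrow> f z" for z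
    by (rule tendsto_uniform_limitI[OF ulR[of "norm z"]]) simp
  have "\<exists>C. \<forall>\<^sub>F n in sequentially. \<forall>z. norm z \<le> R \<longrightarrow> cmod (F (k n) z) \<le> C" for R
    using bd[of R] filterlim_subseq[OF k(1)] unfolding filterlim_iff by blast
  then have "real_conv (\<lambda>n. F (k n)) f" unfolding real_conv_def using F f pw by blast
  then show thesis by (rule that[OF k(1) f pw])
qed

section \<open>Polynomials and homogeneous parts\<close>

definition mono_fun :: "nat^'n::finite \<Rightarrow> real^'n \<Rightarrow> complex" where
  "mono_fun \<alpha> x = (\<Prod>j\<in>UNIV. complex_of_real (x $ j) ^ (\<alpha> $ j))"

lemma polys_iff: "P \<in> polys n \<longleftrightarrow> (\<exists>c. P = (\<lambda>x. \<Sum>\<alpha> | mi_size \<alpha> \<le> n. c \<alpha> * mono_fun \<alpha> x))"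
  unfolding polys_def mono_fun_def by simp

lemma polys_zero: "(\<lambda>_. 0) \<in> polys n"
  unfolding polys_iff by (intro exI[of _ "\<lambda>_. 0"]) simp

lemma polys_add: "P \<in> polys n \<Longrightarrow> Q \<in> polys n \<Longrightarrow> (\<lambda>x. P x + Q x) \<in> polys n"
  unfolding polys_iff by (elim exE, rule_tac x = "\<lambda>\<alpha>. c \<alpha> + ca \<alpha>" in exI) (simp add: distrib_right sum.distrib)

lemma polys_cmult: "P \<in> polys n \<Longrightarrow> (\<lambda>x. k * P x) \<in> polys n"
  unfolding polys_iff by (elim exE, rule_tac x = "\<lambda>\<alpha>. k * c \<alpha>" in exI) (simp add: sum_distrib_left mult.assoc)

lemma polys_sum:
  assumes "\<And>i. i \<in> I \<Longrightarrow> P i \<in> polys n"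
  shows "(\<lambda>x. \<Sum>i\<in>I. P i x) \<in> polys n"
  using assms by (induction I rule: infinite_finite_induct) (simp_all add: polys_zero polys_add)

lemma polys_mono_fun:
  assumes "mi_size \<alpha> \<le> n"
  shows "mono_fun \<alpha> \<in> polys n"
proof -
  have "mono_fun \<alpha> = (\<lambda>x. \<Sum>\<beta> | mi_size \<beta> \<le> n. (if \<beta> = \<alpha> then 1 else 0) * mono_fun \<beta> x)"
  proof
    fix x
    have "(\<Sum>\<beta> | mi_size \<beta> \<le> n. (if \<beta> = \<alpha> then 1 else 0) * mono_fun \<beta> x) =
        (\<Sum>\<beta> | mi_size \<beta> \<le> n. if \<beta> = \<alpha> then mono_fun \<alpha> x else 0)"
      by (intro sum.cong) auto
    also have "\<dots> = mono_fun \<alpha> x" using assms by (simp add: sum.delta[OF finite_mi_size_le])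
    finally show "mono_fun \<alpha> x = (\<Sum>\<beta> | mi_size \<beta> \<le> n. (if \<beta> = \<alpha> then 1 else 0) * mono_fun \<beta> x)" ..
  qed
  then show ?thesis unfolding polys_iff by (rule exI[of _ "\<lambda>\<beta>. if \<beta> = \<alpha> then 1 else 0"])
qed

lemma polys_mono:
  assumes "n \<le> m" "P \<in> polys n"
  shows "P \<in> polys m"
proof -
  obtain c where c: "P = (\<lambda>x. \<Sum>\<alpha> | mi_size \<alpha> \<le> n. c \<alpha> * mono_fun \<alpha> x)"
    using assms(2) unfolding polys_iff by blast
  show ?thesis unfolding c
    using assms(1) by (intro polys_sum polys_cmult polys_mono_fun) auto
qed

lemma polys_mult_coord:
  fixes P :: "real^'n::finite \<Rightarrow> complex"
  assumes "P \<in> polys n"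
  shows "(\<lambda>x. complex_of_real (x $ j) * P x) \<in> polys (Suc n)"
proof -
  obtain c where c: "P = (\<lambda>x. \<Sum>\<alpha> | mi_size \<alpha> \<le> n. c \<alpha> * mono_fun \<alpha> x)"
    using assms unfolding polys_iff by blast
  define e :: "nat^'n" where "e = (\<chi> i. if i = j then 1 else 0)"
  have e: "mono_fun (\<alpha> + e) x = complex_of_real (x $ j) * mono_fun \<alpha> x" for \<alpha> x
  proof -
    have "mono_fun (\<alpha> + e) x = mono_fun \<alpha> x * (\<Prod>i\<in>UNIV. if i = j then complex_of_real (x $ i) else 1)"
      unfolding mono_fun_def prod.distrib[symmetric] by (intro prod.cong) (auto simp: e_def)
    then show ?thesis by (simp add: prod.delta mult.commute)
  qed
  have "mi_size (\<alpha> + e) = Suc (mi_size \<alpha>)" for \<alpha>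
    unfolding mi_size_def by (simp add: e_def sum.distrib sum.delta)
  then have "(\<lambda>x. \<Sum>\<alpha> | mi_size \<alpha> \<le> n. c \<alpha> * mono_fun (\<alpha> + e) x) \<in> polys (Suc n)"
    by (intro polys_sum polys_cmult polys_mono_fun) auto
  also have "(\<lambda>x. \<Sum>\<alpha> | mi_size \<alpha> \<le> n. c \<alpha> * mono_fun (\<alpha> + e) x) = (\<lambda>x. complex_of_real (x $ j) * P x)"
    unfolding c e sum_distrib_left by (simp add: mult_ac)
  finally show ?thesis .
qed

text \<open>A polynomial on \<complex>^m enters the estimates only through its restrictions to
  complex lines, where the one-variable Bernstein--Walsh inequality is applied; no coefficients are
  kept.\<close>

definition cpoly_fun :: "nat \<Rightarrow> (complex^'n::finite \<Rightarrow> complex) \<Rightarrow> bool" where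
  "cpoly_fun n f \<longleftrightarrow> entire f \<and> (\<forall>z v. \<exists>q :: complex poly. degree q \<le> n \<and> (\<forall>\<zeta>. f (z + \<zeta> *s v) = poly q \<zeta>))"

lemma polys_complexify:
  fixes P :: "real^'n::finite \<Rightarrow> complex"
  assumes "P \<in> polys n"
  obtains f where "cpoly_fun n f" "P = restrict_real f"
proof -
  obtain c where c: "P = (\<lambda>x. \<Sum>\<alpha> | mi_size \<alpha> \<le> n. c \<alpha> * mono_fun \<alpha> x)"
    using assms unfolding polys_iff by blast
  define f :: "complex^'n \<Rightarrow> complex" where
    "f z = (\<Sum>\<alpha> | mi_size \<alpha> \<le> n. c \<alpha> * (\<Prod>j\<in>UNIV. (z $ j) ^ (\<alpha> $ j)))" for z
  have "entire f" unfolding f_def[abs_def]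
    by (intro entire_sum entire_cmult entire_prod entire_power entire_nth)
  moreover have "\<exists>q :: complex poly. degree q \<le> n \<and> (\<forall>\<zeta>. f (z + \<zeta> *s v) = poly q \<zeta>)" for z v
  proof -
    define q where "q = (\<Sum>\<alpha> | mi_size \<alpha> \<le> n. smult (c \<alpha>) (\<Prod>j\<in>UNIV. [:z $ j, v $ j:] ^ (\<alpha> $ j)))"
    have "degree q \<le> n" unfolding q_def
    proof (intro degree_sum_le finite_mi_size_le order_trans[OF degree_smult_le])
      fix \<alpha> :: "nat^'n" assume a: "\<alpha> \<in> {\<alpha>. mi_size \<alpha> \<le> n}"
      have "degree (\<Prod>j\<in>UNIV. [:z $ j, v $ j:] ^ (\<alpha> $ j)) \<le> sum (degree \<circ> (\<lambda>j. [:z $ j, v $ j:] ^ (\<alpha> $ j))) UNIV"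
        by (rule degree_prod_sum_le) simp
      also have "\<dots> \<le> (\<Sum>j\<in>UNIV. \<alpha> $ j)"
      proof (rule sum_mono)
        fix j
        have "degree ([:z $ j, v $ j:] ^ (\<alpha> $ j)) \<le> degree [:z $ j, v $ j:] * \<alpha> $ j" by (rule degree_power_le)
        also have "\<dots> \<le> 1 * \<alpha> $ j" by (intro mult_right_mono) auto
        finally show "(degree \<circ> (\<lambda>j. [:z $ j, v $ j:] ^ (\<alpha> $ j))) j \<le> \<alpha> $ j" by simp
      qed
      finally show "degree (\<Prod>j\<in>UNIV. [:z $ j, v $ j:] ^ (\<alpha> $ j)) \<le> n" using a by (simp add: mi_size_def)
    qed
    moreover have "f (z + \<zeta> *s v) = poly q \<zeta>" for \<zeta>
      unfolding f_def q_def by (simp add: poly_sum poly_prod mult.commute)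
    ultimately show ?thesis by blast
  qed
  ultimately have "cpoly_fun n f" by (simp add: cpoly_fun_def)
  moreover have "P = restrict_real f"
    unfolding c restrict_real_def[abs_def] f_def mono_fun_def by simp
  ultimately show thesis by (rule that)
qed

lemma cpoly_fun_line_bound:
  assumes f: "cpoly_fun n f" and T: "0 < T"
    and M: "\<And>t. \<bar>t\<bar> \<le> T \<Longrightarrow> cmod (f (cvec (x + t *\<^sub>R v))) \<le> M"
  shows "cmod (f (cvec x + \<zeta> *s cvec v)) \<le> M * exp (real n * cmod \<zeta> / T)"
proof -
  obtain q :: "complex poly" where q: "degree q \<le> n" "\<And>\<zeta>. f (cvec x + \<zeta> *s cvec v) = poly q \<zeta>"
    using f unfolding cpoly_fun_def by blast
  show ?thesis unfolding q(2)
  proof (rule bernstein_walsh[OF q(1) T])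
    fix t :: real assume "\<bar>t\<bar> \<le> T"
    then show "cmod (poly q (of_real t)) \<le> M"
      unfolding q(2)[symmetric] cvec_scaleR[symmetric] cvec_add[symmetric] by (rule M)
  qed
qed

text \<open>This is k! times the homogeneous part of degree k of the Taylor series of
  \<open>f\<close> at 0, read off along the ray through \<open>x\<close>.\<close>

definition hom_part :: "(complex^'n::finite \<Rightarrow> complex) \<Rightarrow> nat \<Rightarrow> real^'n \<Rightarrow> complex" where
  "hom_part f k x = (deriv ^^ k) (\<lambda>\<zeta>. f (\<zeta> *s cvec x)) 0"

lemma higher_deriv_sum_at_0:
  fixes g :: "'i \<Rightarrow> complex \<Rightarrow> complex"
  assumes "\<And>i. i \<in> I \<Longrightarrow> g i holomorphic_on UNIV"
  shows "(deriv ^^ k) (\<lambda>\<zeta>. \<Sum>i\<in>I. g i \<zeta>) 0 = (\<Sum>i\<in>I. (deriv ^^ k) (g i) 0)"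
  using assms
proof (induction I rule: infinite_finite_induct)
  case (insert i I)
  have "(\<lambda>\<zeta>. \<Sum>i\<in>I. g i \<zeta>) holomorphic_on UNIV" using insert.prems by (intro holomorphic_on_sum) auto
  then have "(deriv ^^ k) (\<lambda>\<zeta>. g i \<zeta> + (\<Sum>i\<in>I. g i \<zeta>)) 0 = (deriv ^^ k) (g i) 0 + (deriv ^^ k) (\<lambda>\<zeta>. \<Sum>i\<in>I. g i \<zeta>) 0"
    using insert.prems by (intro higher_deriv_add[of _ UNIV]) auto
  with insert show ?case by simp
qed simp_all

lemma entire_ray_holomorphic:
  assumes "entire (f :: complex^'n::finite \<Rightarrow> complex)"
  shows "(\<lambda>\<zeta>. f (\<zeta> *s v)) holomorphic_on A"
  using entire_line_holomorphic[OF assms, of 0 v A] by simp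

text \<open>Induction on the degree: one derivative along the ray turns \<open>f\<close> into the
  sum of x_j times its partial derivatives.\<close>

lemma hom_part_polys:
  fixes f :: "complex^'n::finite \<Rightarrow> complex"
  assumes "entire f"
  shows "hom_part f k \<in> polys k"
  using assms
proof (induction k arbitrary: f)
  case 0
  have "hom_part f 0 = (\<lambda>x. f 0 * mono_fun 0 x)" by (rule ext) (simp add: hom_part_def mono_fun_def)
  then show ?case by (simp only:) (intro polys_cmult polys_mono_fun, simp add: mi_size_def)
next
  case (Suc k)
  have "hom_part f (Suc k) x = (\<Sum>j\<in>UNIV. complex_of_real (x $ j) * hom_part (cpd j f) k x)" for x
  proof -
    have "deriv (\<lambda>\<zeta>. f (\<zeta> *s cvec x)) \<zeta> = (\<Sum>j\<in>UNIV. complex_of_real (x $ j) * cpd j f (\<zeta> *s cvec x))" for \<zeta>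
    proof -
      have "((\<lambda>\<xi>. f (\<zeta> *s cvec x + \<xi> *s cvec x)) has_field_derivative dir_deriv f (\<zeta> *s cvec x) (cvec x)) (at 0)"
        by (rule entire_has_dir_deriv(3)[OF Suc.prems])
      then have "((\<lambda>\<xi>. f ((\<xi> + \<zeta>) *s cvec x)) has_field_derivative dir_deriv f (\<zeta> *s cvec x) (cvec x)) (at 0)"
        by (simp only: vector_sadd_rdistrib add.commute)
      then have "((\<lambda>\<xi>. f (\<xi> *s cvec x)) has_field_derivative dir_deriv f (\<zeta> *s cvec x) (cvec x)) (at \<zeta>)"
        using DERIV_shift[of "\<lambda>\<xi>. f (\<xi> *s cvec x)" _ 0 \<zeta>] by simp
      then show ?thesis by (simp add: DERIV_imp_deriv dir_deriv_eq_sum_cpd[OF Suc.prems])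
    qed
    then have "hom_part f (Suc k) x = (deriv ^^ k) (\<lambda>\<zeta>. \<Sum>j\<in>UNIV. complex_of_real (x $ j) * cpd j f (\<zeta> *s cvec x)) 0"
      unfolding hom_part_def funpow_Suc_right o_def by presburger
    also have "\<dots> = (\<Sum>j\<in>UNIV. (deriv ^^ k) (\<lambda>\<zeta>. complex_of_real (x $ j) * cpd j f (\<zeta> *s cvec x)) 0)"
      by (intro higher_deriv_sum_at_0 holomorphic_on_mult holomorphic_on_const entire_ray_holomorphic entire_cpd Suc.prems)
    also have "\<dots> = (\<Sum>j\<in>UNIV. complex_of_real (x $ j) * hom_part (cpd j f) k x)"
      unfolding hom_part_def
      by (intro sum.cong refl higher_deriv_cmult[of _ UNIV] entire_ray_holomorphic entire_cpd Suc.prems) auto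
    finally show ?thesis .
  qed
  then have "hom_part f (Suc k) = (\<lambda>x. \<Sum>j\<in>UNIV. complex_of_real (x $ j) * hom_part (cpd j f) k x)" by blast
  then show ?case by (simp only:) (intro polys_sum polys_mult_coord Suc.IH entire_cpd Suc.prems)
qed

section \<open>Polynomial approximation in the norm of the polar body\<close>

lemma norm_sum_mult_le:
  "cmod (\<Sum>j\<in>UNIV. complex_of_real (t $ j) * z $ j) \<le> norm t * norm (z :: complex^'n::finite)"
proof -
  have "cmod (\<Sum>j\<in>UNIV. complex_of_real (t $ j) * z $ j) \<le> (\<Sum>j\<in>UNIV. \<bar>t $ j\<bar> * \<bar>cmod (z $ j)\<bar>)"
    by (rule sum_norm_le) (simp add: norm_mult)
  also have "\<dots> \<le> L2_set (\<lambda>j. t $ j) UNIV * L2_set (\<lambda>j. cmod (z $ j)) UNIV" by (rule L2_set_mult_ineq)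
  also have "\<dots> = norm t * norm z" by (simp add: norm_vec_def L2_set_def)
  finally show ?thesis .
qed

locale symmetric_body =
  fixes V :: "(real^'m::{finite,linorder}) set"
  assumes compact_V: "compact V" and convex_V: "convex V" and interior_V: "interior V \<noteq> {}"
    and symmetric_V: "\<forall>x\<in>V. - x \<in> V"
begin

lemma V_nonempty: "V \<noteq> {}" using interior_V interior_subset by blast

lemma inner_radius: obtains r where "r > 0" "cball 0 r \<subseteq> V"
proof -
  obtain x where "x \<in> interior V" using interior_V by blast
  then obtain e where e: "e > 0" "ball x e \<subseteq> V" using mem_interior by blast
  \<comment> \<open>For such y the point x + 2 y lies in the ball around x, and y is the midpoint of
    x + 2 y and - x.\<close>
  have "cball 0 (e / 4) \<subseteq> V"
  proof
    fix y :: "real^'m::{finite,linorder}" assume "y \<in> cball 0 (e / 4)"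
    then have "x + 2 *\<^sub>R y \<in> V" using e by (intro subsetD[OF e(2)]) (simp add: dist_norm)
    moreover have "- x \<in> V" using e symmetric_V by (meson centre_in_ball subsetD)
    ultimately have "(1 / 2) *\<^sub>R (x + 2 *\<^sub>R y) + (1 / 2) *\<^sub>R (- x) \<in> V"
      using convex_V unfolding convex_def by force
    then show "y \<in> V" by (simp add: scaleR_add_right)
  qed
  then show thesis using that[of "e / 4"] e by auto
qed

lemma outer_radius: obtains r where "r > 0" "\<And>t. t \<in> V \<Longrightarrow> norm t \<le> r"
  using compact_imp_bounded[OF compact_V] bounded_pos by metis

lemma bdd_dual_norm: "bdd_above ((\<lambda>t. cmod (\<Sum>j\<in>UNIV. complex_of_real (t $ j) * z $ j)) ` V)"
proof -
  obtain r where r: "r > 0" "\<And>t. t \<in> V \<Longrightarrow> norm t \<le> r" using outer_radius by blast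
  show ?thesis
  proof (rule bdd_aboveI2)
    fix t assume "t \<in> V"
    then have "norm t * norm z \<le> r * norm z" by (intro mult_right_mono r) auto
    then show "cmod (\<Sum>j\<in>UNIV. complex_of_real (t $ j) * z $ j) \<le> r * norm z"
      using norm_sum_mult_le[of t z] by linarith
  qed
qed

lemma dual_norm_ge: "t \<in> V \<Longrightarrow> cmod (\<Sum>j\<in>UNIV. complex_of_real (t $ j) * z $ j) \<le> dual_norm V z"
  unfolding dual_norm_def by (rule cSUP_upper[OF _ bdd_dual_norm])

lemma dual_norm_leI:
  "(\<And>t. t \<in> V \<Longrightarrow> cmod (\<Sum>j\<in>UNIV. complex_of_real (t $ j) * z $ j) \<le> M) \<Longrightarrow> dual_norm V z \<le> M"
  unfolding dual_norm_def by (rule cSUP_least[OF V_nonempty])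

lemma dual_norm_nonneg: "0 \<le> dual_norm V z"
  using V_nonempty dual_norm_ge norm_ge_zero order_trans by (metis equals0I)

lemma dual_norm_smult: "dual_norm V (c *s z) = cmod c * dual_norm V z"
proof -
  have le: "dual_norm V (c *s z) \<le> cmod c * dual_norm V z" for c z
  proof (rule dual_norm_leI)
    fix t assume t: "t \<in> V"
    have "(\<Sum>j\<in>UNIV. complex_of_real (t $ j) * (c *s z) $ j) = c * (\<Sum>j\<in>UNIV. complex_of_real (t $ j) * z $ j)"
      unfolding sum_distrib_left by (intro sum.cong) auto
    then show "cmod (\<Sum>j\<in>UNIV. complex_of_real (t $ j) * (c *s z) $ j) \<le> cmod c * dual_norm V z"
      using dual_norm_ge[OF t, of z] by (simp add: norm_mult mult_left_mono)
  qed
  show ?thesis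
  proof (cases "c = 0")
    case True
    then show ?thesis using le[of 0 z] dual_norm_nonneg[of "c *s z"] by simp
  next
    case False
    have "dual_norm V ((1 / c) *s (c *s z)) \<le> cmod (1 / c) * dual_norm V (c *s z)" by (rule le)
    then have "cmod c * dual_norm V z \<le> dual_norm V (c *s z)"
      using False by (simp add: vector_smult_assoc norm_divide field_simps)
    with le[of c z] show ?thesis by simp
  qed
qed

lemma dual_norm_triangle: "dual_norm V (z + w) \<le> dual_norm V z + dual_norm V w"
proof (rule dual_norm_leI)
  fix t assume t: "t \<in> V"
  have "cmod (\<Sum>j\<in>UNIV. complex_of_real (t $ j) * (z + w) $ j) \<le>
      cmod (\<Sum>j\<in>UNIV. complex_of_real (t $ j) * z $ j) + cmod (\<Sum>j\<in>UNIV. complex_of_real (t $ j) * w $ j)"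
    by (simp add: distrib_left sum.distrib norm_triangle_ineq)
  then show "cmod (\<Sum>j\<in>UNIV. complex_of_real (t $ j) * (z + w) $ j) \<le> dual_norm V z + dual_norm V w"
    using dual_norm_ge[OF t, of z] dual_norm_ge[OF t, of w] by linarith
qed

text \<open>The support function of \<open>V\<close>, that is, the norm on \<real>^m whose closed
  unit ball is \<open>polar V\<close>.\<close>

definition body_norm :: "real^'m::{finite,linorder} \<Rightarrow> real" where "body_norm x = dual_norm V (cvec x)"

lemma cmod_sum_cvec: "cmod (\<Sum>j\<in>UNIV. complex_of_real (t $ j) * cvec x $ j) = \<bar>t \<bullet> x\<bar>"
proof -
  have "(\<Sum>j\<in>UNIV. complex_of_real (t $ j) * cvec x $ j) = complex_of_real (t \<bullet> x)"
    by (simp add: inner_vec_def)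
  then show ?thesis by (simp only: norm_of_real)
qed

lemma body_norm_ge: "t \<in> V \<Longrightarrow> \<bar>t \<bullet> x\<bar> \<le> body_norm x"
  unfolding body_norm_def using dual_norm_ge[of t "cvec x"] cmod_sum_cvec[of t x] by simp

lemma body_norm_leI: "(\<And>t. t \<in> V \<Longrightarrow> \<bar>t \<bullet> x\<bar> \<le> M) \<Longrightarrow> body_norm x \<le> M"
  unfolding body_norm_def using dual_norm_leI[of "cvec x" M] cmod_sum_cvec[of _ x] by simp

lemma body_norm_nonneg: "0 \<le> body_norm x" unfolding body_norm_def by (rule dual_norm_nonneg)

lemma body_norm_scaleR: "body_norm (c *\<^sub>R x) = \<bar>c\<bar> * body_norm x"
  unfolding body_norm_def cvec_scaleR dual_norm_smult by simp

lemma body_norm_triangle: "body_norm (x + y) \<le> body_norm x + body_norm y"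
  unfolding body_norm_def cvec_add by (rule dual_norm_triangle)

text \<open>For real t the product with x + i y has real part t . x and imaginary part t . y. The
  second bound lets growth in the imaginary part alone be read as exponential type
  \<open>V\<close>.\<close>

lemma body_norm_le_dual_norm:
  "body_norm x \<le> dual_norm V (cvec x + \<i> *s cvec y)" "body_norm y \<le> dual_norm V (cvec x + \<i> *s cvec y)"
proof -
  have *: "(\<Sum>j\<in>UNIV. complex_of_real (t $ j) * (cvec x + \<i> *s cvec y) $ j) = Complex (t \<bullet> x) (t \<bullet> y)" for t
    by (simp add: complex_eq_iff inner_vec_def Re_sum Im_sum)
  show "body_norm x \<le> dual_norm V (cvec x + \<i> *s cvec y)"
  proof (rule body_norm_leI)
    fix t assume "t \<in> V"
    from dual_norm_ge[OF this, of "cvec x + \<i> *s cvec y"]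
    show "\<bar>t \<bullet> x\<bar> \<le> dual_norm V (cvec x + \<i> *s cvec y)"
      unfolding * using abs_Re_le_cmod[of "Complex (t \<bullet> x) (t \<bullet> y)"] by simp
  qed
  show "body_norm y \<le> dual_norm V (cvec x + \<i> *s cvec y)"
  proof (rule body_norm_leI)
    fix t assume "t \<in> V"
    from dual_norm_ge[OF this, of "cvec x + \<i> *s cvec y"]
    show "\<bar>t \<bullet> y\<bar> \<le> dual_norm V (cvec x + \<i> *s cvec y)"
      unfolding * using abs_Im_le_cmod[of "Complex (t \<bullet> x) (t \<bullet> y)"] by simp
  qed
qed

lemma polar_eq: "polar V = {x. body_norm x \<le> 1}"
  unfolding polar_def using body_norm_ge body_norm_leI by (auto intro: order_trans)

lemma body_norm_equiv_norm:
  obtains r1 r2 where "r1 > 0" "r2 > 0" "\<And>x. r1 * norm x \<le> body_norm x" "\<And>x. body_norm x \<le> r2 * norm x"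
proof -
  obtain r where r: "r > 0" "cball 0 r \<subseteq> V" using inner_radius .
  obtain s where s: "s > 0" "\<And>t. t \<in> V \<Longrightarrow> norm t \<le> s" using outer_radius by blast
  have "r * norm x \<le> body_norm x" for x
  proof (cases "x = 0")
    case False
    have "(r / norm x) *\<^sub>R x \<in> V" using r False by (intro subsetD[OF r(2)]) simp
    from body_norm_ge[OF this, of x] show ?thesis
      using r False by (simp add: dot_square_norm power2_eq_square)
  qed (simp add: body_norm_nonneg)
  moreover have "body_norm x \<le> s * norm x" for x
  proof (rule body_norm_leI)
    fix t assume "t \<in> V"
    then have "norm t * norm x \<le> s * norm x" by (intro mult_right_mono s) auto
    then show "\<bar>t \<bullet> x\<bar> \<le> s * norm x" using Cauchy_Schwarz_ineq2[of t x] by linarith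
  qed
  ultimately show thesis using that r s by blast
qed

lemma body_norm_lipschitz: obtains r where "r > 0" "\<And>x y. \<bar>body_norm x - body_norm y\<bar> \<le> r * norm (x - y)"
proof -
  obtain r1 r2 where r: "r2 > 0" "\<And>x. body_norm x \<le> r2 * norm x" using body_norm_equiv_norm by metis
  have "body_norm x \<le> body_norm y + r2 * norm (x - y)" for x y
    using body_norm_triangle[of y "x - y"] r(2)[of "x - y"] by simp
  then have "\<bar>body_norm x - body_norm y\<bar> \<le> r2 * norm (x - y)" for x y
    by (smt (verit) norm_minus_commute)
  with r show thesis using that by blast
qed

lemma continuous_body_norm: "continuous_on A body_norm"
proof -
  obtain r where r: "r > 0" "\<And>x y. \<bar>body_norm x - body_norm y\<bar> \<le> r * norm (x - y)" using body_norm_lipschitz by blast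
  have "r-lipschitz_on A body_norm" using r by (intro lipschitz_onI) (auto simp: dist_norm)
  then show ?thesis by (rule lipschitz_on_continuous_on)
qed

lemma compact_body_norm_le: "compact {x. body_norm x \<le> L}"
proof -
  obtain r1 where r: "r1 > 0" "\<And>x. r1 * norm x \<le> body_norm x" using body_norm_equiv_norm by metis
  have "bounded {x. body_norm x \<le> L}"
    unfolding bounded_iff using r by (intro exI[of _ "L / r1"]) (auto simp: field_simps intro: order_trans)
  moreover have "closed {x. body_norm x \<le> L}"
    by (intro closed_Collect_le continuous_body_norm continuous_on_const)
  ultimately show ?thesis by (simp add: compact_eq_bounded_closed)
qed

lemma open_body_norm_less: "open {x. body_norm x < L}"
  by (intro open_Collect_less continuous_body_norm continuous_on_const)

text \<open>On every ray through the origin the entire function is of type less than one, so the truncated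
  Chebyshev pairing applies; it acts on the homogeneous parts by scalars and hence produces a
  polynomial of total degree at most \<open>n\<close>.\<close>

lemma polynomial_approximation:
  fixes F :: "complex^'m::{finite,linorder} \<Rightarrow> complex"
  assumes F: "entire F" and \<sigma>: "0 < \<sigma>" "\<sigma> < 1"
    and growth: "\<And>z. cmod (F z) \<le> C * exp (\<sigma> * dual_norm V z)"
    and M: "\<And>x. cmod (F (cvec x)) \<le> M"
  obtains A \<kappa> Q where "A > 0" "\<kappa> > 0" "\<And>n. n > 0 \<Longrightarrow> Q n \<in> polys n"
    "\<And>n x. n > 0 \<Longrightarrow> body_norm x \<le> real n \<Longrightarrow> cmod (F (cvec x) - Q n x) \<le> A * exp (- \<kappa> * real n)"
proof -
  \<comment> \<open>The gap between \<sigma> and 1 is shared: one factor \<open>\<theta>\<close> is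
    the type of the rescaled function on the ray, the other shortens the evaluation point to
    \<theta> n, as \<open>chebyshev_exp_approx\<close> requires.\<close>
  define \<theta> where "\<theta> = sqrt \<sigma>"
  have \<theta>: "0 < \<theta>" "\<theta> < 1" "\<theta> * \<theta> = \<sigma>" using \<sigma> by (auto simp: \<theta>_def)
  obtain R \<kappa> A1 where R: "R > 1" "\<kappa> > 0" "A1 > 0" and
    cheb: "\<And>n. \<exists>\<Lambda> :: complex poly. degree \<Lambda> \<le> n \<and> (\<forall>s. cmod s = R \<longrightarrow>
         cmod (exp (\<i> * of_real (\<theta> * n) * joukowski s) - poly \<Lambda> (joukowski s)) \<le> A1 * exp (- \<kappa> * n))"
    by (rule chebyshev_exp_approx[OF \<theta>(1,2)]) blast
  have "\<forall>n. \<exists>\<Lambda> :: complex poly. degree \<Lambda> \<le> n \<and> (\<forall>s. cmod s = R \<longrightarrow>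
         cmod (exp (\<i> * of_real (\<theta> * n) * joukowski s) - poly \<Lambda> (joukowski s)) \<le> A1 * exp (- \<kappa> * n))"
    using cheb by (rule allI)
  from choice[OF this] obtain \<Lambda> :: "nat \<Rightarrow> complex poly" where
    \<Lambda>: "\<And>n. degree (\<Lambda> n) \<le> n" "\<And>n s. cmod s = R \<Longrightarrow>
       cmod (exp (\<i> * of_real (\<theta> * n) * joukowski s) - poly (\<Lambda> n) (joukowski s)) \<le> A1 * exp (- \<kappa> * n)"
    by blast
  obtain A2 where A2: "A2 \<ge> 0"
    "\<And>h \<Lambda> n t \<epsilon>. \<lbrakk>h holomorphic_on UNIV; \<And>z. cmod (h z) \<le> C * exp (\<theta> * cmod z);
       \<And>y. cmod (h (\<i> * of_real y)) \<le> M; degree \<Lambda> \<le> n;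
       \<And>s. cmod s = R \<Longrightarrow> cmod (exp (\<i> * of_real t * joukowski s) - poly \<Lambda> (joukowski s)) \<le> \<epsilon>\<rbrakk> \<Longrightarrow>
      cmod (h (\<i> * of_real t) - (\<Sum>j\<le>n. coeff \<Lambda> j * (deriv ^^ j) h 0)) \<le> A2 * \<epsilon>"
    by (rule exp_type_polynomial_functional_bound[OF R(1) \<theta>(1,2), of C M]) blast
  \<comment> \<open>The rotation by - i carries the real ray, on which \<open>F\<close> is bounded,
    to the imaginary axis; the scale makes i \<theta> n correspond to the point \<open>x\<close>
    itself.\<close>
  define u where "u n = - \<i> / of_real (\<theta> * real n)" for n
  define Q where "Q n x = (\<Sum>j\<le>n. coeff (\<Lambda> n) j * u n ^ j * hom_part F j x)" for n x
  have C: "0 \<le> C" using growth[of 0] order_trans[OF norm_ge_zero, of "F 0"]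
    by (metis exp_gt_zero zero_le_mult_iff not_less)
  show thesis
  proof (rule that[of "A2 * A1 + 1" \<kappa> Q])
    show "A2 * A1 + 1 > 0" using A2(1) R(3) by (simp add: add_nonneg_pos)
    show "\<kappa> > 0" by (rule R(2))
    show "Q n \<in> polys n" if "n > 0" for n
      unfolding Q_def[abs_def] using polys_mono[OF _ hom_part_polys[OF F]]
      by (intro polys_sum polys_cmult) auto
    fix n :: nat and x assume n: "n > 0" and x: "body_norm x \<le> real n"
    define h where "h \<zeta> = F ((u n * \<zeta>) *s cvec x)" for \<zeta>
    have ray: "(\<lambda>\<zeta>. F (\<zeta> *s cvec x)) holomorphic_on UNIV" by (rule entire_ray_holomorphic[OF F])
    have hd: "(deriv ^^ j) h 0 = u n ^ j * hom_part F j x" for j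
      using higher_deriv_compose_linear[OF ray open_UNIV open_UNIV, of 0 "u n" j]
      by (simp add: h_def[abs_def] hom_part_def)
    have tn: "\<theta> * real n > 0" using \<theta> n by simp
    have cu: "cmod (u n) = 1 / (\<theta> * real n)"
      using tn unfolding u_def norm_divide norm_of_real norm_minus_cancel norm_ii by simp
    have "cmod (h (\<i> * of_real (\<theta> * real n)) - (\<Sum>j\<le>n. coeff (\<Lambda> n) j * (deriv ^^ j) h 0)) \<le> A2 * (A1 * exp (- \<kappa> * n))"
    proof (rule A2(2)[OF _ _ _ \<Lambda>])
      have "((\<lambda>\<zeta>. F (\<zeta> *s cvec x)) \<circ> (\<lambda>\<zeta>. u n * \<zeta>)) holomorphic_on UNIV"
        by (intro holomorphic_on_compose_gen[OF _ ray] holomorphic_intros) auto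
      then show "h holomorphic_on UNIV" by (simp add: h_def[abs_def] o_def)
      show "cmod (h z) \<le> C * exp (\<theta> * cmod z)" for z
      proof -
        have "\<sigma> * dual_norm V ((u n * z) *s cvec x) = \<theta> * cmod z * (body_norm x / real n)"
          using tn n \<theta> unfolding dual_norm_smult body_norm_def norm_mult cu by (simp add: \<theta>(3)[symmetric])
        also have "\<dots> \<le> \<theta> * cmod z * 1" using x n \<theta> by (intro mult_left_mono) auto
        finally have "exp (\<sigma> * dual_norm V ((u n * z) *s cvec x)) \<le> exp (\<theta> * cmod z)" by simp
        then have "C * exp (\<sigma> * dual_norm V ((u n * z) *s cvec x)) \<le> C * exp (\<theta> * cmod z)"
          using C by (rule mult_left_mono)
        then show ?thesis unfolding h_def using growth[of "(u n * z) *s cvec x"] by linarith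
      qed
      show "cmod (h (\<i> * of_real y)) \<le> M" for y
      proof -
        have "u n * (\<i> * of_real y) = of_real (y / (\<theta> * real n))" by (simp add: u_def)
        then have "h (\<i> * of_real y) = F (cvec ((y / (\<theta> * real n)) *\<^sub>R x))"
          unfolding h_def cvec_scaleR by (simp only:)
        then show ?thesis by (simp only: M)
      qed
    qed
    moreover have "h (\<i> * of_real (\<theta> * real n)) = F (cvec x)"
    proof -
      have "complex_of_real (\<theta> * real n) \<noteq> 0" unfolding of_real_eq_0_iff using tn by linarith
      then have "u n * (\<i> * of_real (\<theta> * real n)) = 1" by (simp add: u_def del: of_real_mult)
      then show ?thesis unfolding h_def by (simp only: vector_smult_lid)
    qed
    moreover have "(\<Sum>j\<le>n. coeff (\<Lambda> n) j * (deriv ^^ j) h 0) = Q n x"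
      unfolding Q_def hd by (simp add: mult.assoc)
    ultimately have "cmod (F (cvec x) - Q n x) \<le> A2 * (A1 * exp (- \<kappa> * n))" by (simp only:)
    also have "\<dots> \<le> (A2 * A1 + 1) * exp (- \<kappa> * n)" by (simp add: distrib_right)
    finally show "cmod (F (cvec x) - Q n x) \<le> (A2 * A1 + 1) * exp (- \<kappa> * real n)" .
  qed
qed

text \<open>On the circle of radius 4 type 2 gives the bound C exp (8 L), so the j-th Taylor term is
  at most C exp (8 L) / 4^j. At degree 8 L this is C (e / 4)^(8 L), and (e / 4)^8 < 1 / e.\<close>

lemma taylor_approximation:
  fixes F :: "complex^'m::{finite,linorder} \<Rightarrow> complex"
  assumes F: "entire F" and growth: "\<And>z. cmod (F z) \<le> C * exp (2 * dual_norm V z)"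
    and x: "body_norm x \<le> real L"
  shows "cmod (F (cvec x) - (\<Sum>j\<le>8 * L. hom_part F j x / fact j)) \<le> C * exp (- real L)"
proof -
  have C: "0 \<le> C" using growth[of 0] order_trans[OF norm_ge_zero, of "F 0"]
    by (metis exp_gt_zero zero_le_mult_iff not_less)
  define g where "g \<zeta> = F (\<zeta> *s cvec x)" for \<zeta>
  have g: "g holomorphic_on A" for A unfolding g_def[abs_def] by (rule entire_ray_holomorphic[OF F])
  define c where "c j = hom_part F j x / fact j" for j
  have "(\<lambda>j. (deriv ^^ j) g 0 / fact j * (1 - 0) ^ j) sums g 1"
    by (rule holomorphic_power_series[where r = 2, OF g]) simp
  then have "c sums F (cvec x)" unfolding c_def[abs_def] hom_part_def g_def[abs_def] by simp
  from sums_split_initial_segment[OF this, of "Suc (8 * L)"]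
  have s: "(\<lambda>j. c (j + Suc (8 * L))) sums (F (cvec x) - (\<Sum>j\<le>8 * L. c j))" by (simp add: lessThan_Suc_atMost)
  define E where "E = C * exp (8 * real L)"
  have cb: "cmod (c j) \<le> E * (1 / 4) ^ j" for j
  proof -
    have "cmod ((deriv ^^ j) g 0) \<le> fact j * E / 4 ^ j"
    proof (rule Cauchy_inequality[OF g])
      show "continuous_on (cball 0 4) g" by (rule holomorphic_on_imp_continuous_on[OF g])
      fix \<zeta> :: complex assume "cmod (0 - \<zeta>) = 4"
      then have "2 * dual_norm V (\<zeta> *s cvec x) \<le> 8 * real L"
        using x unfolding dual_norm_smult body_norm_def by simp
      then have "C * exp (2 * dual_norm V (\<zeta> *s cvec x)) \<le> E" unfolding E_def using C by (intro mult_left_mono) simp_all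
      then show "cmod (g \<zeta>) \<le> E" unfolding g_def using growth[of "\<zeta> *s cvec x"] by linarith
    qed simp
    then show ?thesis unfolding c_def hom_part_def g_def by (simp add: norm_divide power_divide field_simps)
  qed
  have "(\<lambda>j. (1 / 4 :: real) ^ j) sums (1 / (1 - 1 / 4))" by (rule geometric_sums) simp
  from sums_mult[OF this, of "E * (1 / 4) ^ Suc (8 * L)"]
  have t: "(\<lambda>j. E * (1 / 4) ^ (j + Suc (8 * L))) sums (E * (1 / 4) ^ Suc (8 * L) * (1 / (1 - 1 / 4)))"
    by (simp add: power_add mult_ac)
  have "cmod (F (cvec x) - (\<Sum>j\<le>8 * L. c j)) = cmod (\<Sum>j. c (j + Suc (8 * L)))" by (simp only: sums_unique[OF s])
  also have "\<dots> \<le> (\<Sum>j. E * (1 / 4) ^ (j + Suc (8 * L)))" by (intro norm_suminf_le cb sums_summable[OF t])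
  also have "\<dots> = E * (1 / 4) ^ (8 * L) * (1 / 3)" unfolding sums_unique[OF t, symmetric] by simp
  also have "\<dots> \<le> E * (1 / 4) ^ (8 * L) * 1" using C unfolding E_def by (intro mult_left_mono) auto
  also have "\<dots> = C * (exp 1 / 4) ^ (8 * L)"
    unfolding E_def power_divide exp_of_nat_mult[symmetric] by simp
  also have "\<dots> \<le> C * exp (- real L)"
  proof (rule mult_left_mono[OF _ C])
    have "(exp 1 / 4 :: real) ^ 8 \<le> (3 / 4) ^ 8" using exp_le by (intro power_mono) auto
    also have "\<dots> \<le> 1 / 3" by (simp add: power_divide)
    also have "\<dots> \<le> exp (- 1)" using exp_le by (simp add: exp_minus divide_simps)
    finally have "((exp 1 / 4) ^ 8) ^ L \<le> exp (- 1 :: real) ^ L" by (intro power_mono) auto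
    then show "(exp 1 / 4 :: real) ^ (8 * L) \<le> exp (- real L)"
      unfolding power_mult exp_of_nat_mult[symmetric] by simp
  qed
  finally show ?thesis unfolding c_def .
qed

end

section \<open>Quasinorms and the Nikolskii inequality\<close>

lemma ennreal_powr_ennreal: "0 \<le> c \<Longrightarrow> ennreal_powr (ennreal c) a = ennreal (c powr a)"
  by (simp add: ennreal_powr_def)

lemma ennreal_powr_mono:
  assumes "x \<le> y" "0 \<le> a"
  shows "ennreal_powr x a \<le> ennreal_powr y a"
proof (cases "y = \<infinity>")
  case False
  then have "y < top" by (simp add: less_top)
  moreover have "x \<noteq> \<infinity>" using False assms(1) by (auto simp: top_unique)
  ultimately show ?thesis using assms False
    by (auto simp: ennreal_powr_def intro!: ennreal_leI powr_mono2 enn2real_mono)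
qed (simp add: ennreal_powr_def)

lemma continuous_ennreal_cmod:
  assumes "continuous_on A F"
  shows "continuous_on A (\<lambda>x. ennreal (cmod (F x)))"
  by (intro continuous_on_ennreal continuous_on_norm assms)

lemma continuous_Lp_measurable:
  fixes F :: "real^'m::finite \<Rightarrow> complex"
  assumes F: "continuous_on UNIV F" and E: "E \<in> sets borel"
  shows "F \<in> borel_measurable (lebesgue_on E)"
proof -
  have "F \<in> borel_measurable borel" using F by (rule borel_measurable_continuous_onI)
  then have "F \<in> borel_measurable lborel" by simp
  then have "F \<in> borel_measurable lebesgue" by (rule measurable_completion)
  then show ?thesis by (rule measurable_restrict_space1)
qed

text \<open>\<open>U - C\<close> is open and contained in a null set, hence empty.\<close>

lemma AE_lebesgue_on_open_closed:
  fixes C :: "(real^'m::finite) set"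
  assumes "AE x in lebesgue_on E. x \<in> C" "open U" "U \<subseteq> E" "closed C" "E \<in> sets borel"
  shows "U \<subseteq> C"
proof -
  have "AE x in lebesgue. x \<in> E \<longrightarrow> x \<in> C"
    using assms(1,5) by (subst (asm) AE_restrict_space_iff) auto
  then obtain N where N: "{x. \<not> (x \<in> E \<longrightarrow> x \<in> C)} \<subseteq> N" "N \<in> null_sets lebesgue"
    by (auto elim!: AE_E simp: null_sets_def)
  then have "negligible N" by (simp add: negligible_iff_null_sets)
  moreover have "U - C \<subseteq> N" using N(1) assms(3) by auto
  ultimately have "negligible (U - C)" by (rule negligible_subset)
  moreover have "open (U - C)" using assms by (intro open_Diff)
  ultimately show ?thesis using open_not_negligible by blast
qed

text \<open>For a continuous function an almost everywhere bound holds on the interior and therefore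
  on its closure, so the essential supremum may be treated as a supremum.\<close>

lemma Lp_norm_infinity_le_iff:
  fixes F :: "real^'m::finite \<Rightarrow> complex"
  assumes F: "continuous_on UNIV F" and E: "E \<in> sets borel" "E \<subseteq> closure (interior E)"
  shows "Lp_norm \<infinity> E F \<le> u \<longleftrightarrow> (\<forall>x\<in>E. ennreal (cmod (F x)) \<le> u)"
proof
  assume le: "Lp_norm \<infinity> E F \<le> u"
  have cl: "closed {x. ennreal (cmod (F x)) \<le> u}"
    by (intro closed_Collect_le continuous_ennreal_cmod[OF F] continuous_on_const)
  have "AE x in lebesgue_on E. ennreal (cmod (F x)) \<le> esssup (lebesgue_on E) (\<lambda>x. ennreal (cmod (F x)))"
    by (rule esssup_AE)
  then have "AE x in lebesgue_on E. x \<in> {x. ennreal (cmod (F x)) \<le> u}"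
  proof (rule eventually_mono)
    fix x assume "ennreal (cmod (F x)) \<le> esssup (lebesgue_on E) (\<lambda>x. ennreal (cmod (F x)))"
    also have "\<dots> \<le> u" using le by (simp add: Lp_norm_def)
    finally show "x \<in> {x. ennreal (cmod (F x)) \<le> u}" by simp
  qed
  then have "interior E \<subseteq> {x. ennreal (cmod (F x)) \<le> u}"
    using AE_lebesgue_on_open_closed[OF _ open_interior interior_subset cl E(1)] by blast
  then have "closure (interior E) \<subseteq> {x. ennreal (cmod (F x)) \<le> u}" using cl by (rule closure_minimal)
  then show "\<forall>x\<in>E. ennreal (cmod (F x)) \<le> u" using E by blast
next
  assume le: "\<forall>x\<in>E. ennreal (cmod (F x)) \<le> u"
  have "(\<lambda>x. ennreal (cmod (F x))) \<in> borel_measurable (lebesgue_on E)"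
    using continuous_Lp_measurable[OF F E(1)] by measurable
  then have "esssup (lebesgue_on E) (\<lambda>x. ennreal (cmod (F x))) \<le> u"
    by (rule esssup_I) (use le in \<open>auto intro!: AE_I2 simp: space_restrict_space\<close>)
  then show "Lp_norm \<infinity> E F \<le> u" by (simp add: Lp_norm_def)
qed

text \<open>Without the root and over the Borel measure instead of its completion, the substitution
  rule and Fatou's lemma apply directly.\<close>

definition Lp_integral :: "real \<Rightarrow> (real^'m::finite) set \<Rightarrow> (real^'m \<Rightarrow> complex) \<Rightarrow> ennreal" where
  "Lp_integral q E F = (\<integral>\<^sup>+x. ennreal (cmod (F x) powr q) * indicator E x \<partial>lborel)"

lemma Lp_norm_finite:
  assumes "p \<noteq> \<infinity>" "E \<in> sets borel"
  shows "Lp_norm p E F = ennreal_powr (Lp_integral (enn2real p) E F) (1 / enn2real p)"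
proof -
  have "E \<inter> space lebesgue \<in> sets lebesgue" using assms(2) by simp
  then show ?thesis using assms(1)
    by (simp add: Lp_norm_def Lp_integral_def nn_integral_restrict_space nn_integral_completion)
qed

lemma enn2real_pos: "0 < p \<Longrightarrow> p \<noteq> \<infinity> \<Longrightarrow> 0 < enn2real p"
  by (simp add: enn2real_positive_iff less_top)

lemma Lp_norm_finite_leI:
  assumes "0 < p" "p \<noteq> \<infinity>" "E \<in> sets borel" "0 \<le> u"
    and "Lp_integral (enn2real p) E F \<le> ennreal (u powr enn2real p)"
  shows "Lp_norm p E F \<le> ennreal u"
proof -
  have q: "0 < enn2real p" by (rule enn2real_pos[OF assms(1,2)])
  have "Lp_norm p E F \<le> ennreal_powr (ennreal (u powr enn2real p)) (1 / enn2real p)"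
    unfolding Lp_norm_finite[OF assms(2,3)] using q by (intro ennreal_powr_mono assms(5)) simp
  also have "\<dots> = ennreal u" using q assms(4) by (simp add: ennreal_powr_ennreal powr_powr)
  finally show ?thesis .
qed

lemma Lp_norm_finite_geI:
  assumes "0 < p" "p \<noteq> \<infinity>" "E \<in> sets borel" "0 \<le> u"
    and "ennreal (u powr enn2real p) \<le> Lp_integral (enn2real p) E F"
  shows "ennreal u \<le> Lp_norm p E F"
proof -
  have q: "0 < enn2real p" by (rule enn2real_pos[OF assms(1,2)])
  have "ennreal u = ennreal_powr (ennreal (u powr enn2real p)) (1 / enn2real p)"
    using q assms(4) by (simp add: ennreal_powr_ennreal powr_powr)
  also have "\<dots> \<le> Lp_norm p E F"
    unfolding Lp_norm_finite[OF assms(2,3)] using q by (intro ennreal_powr_mono assms(5)) simp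
  finally show ?thesis .
qed

lemma Lp_norm_less_top_iff:
  assumes "p \<noteq> \<infinity>" "E \<in> sets borel"
  shows "Lp_norm p E F < \<infinity> \<longleftrightarrow> Lp_integral (enn2real p) E F < \<infinity>"
  unfolding Lp_norm_finite[OF assms] by (auto simp: ennreal_powr_def less_top)

lemma Lp_integral_affine:
  fixes F :: "real^'m::finite \<Rightarrow> complex"
  assumes F: "F \<in> borel_measurable borel" and E: "E \<in> sets borel" and c: "0 < c"
  shows "Lp_integral q E F = ennreal (c ^ CARD('m)) * Lp_integral q {x. a + c *\<^sub>R x \<in> E} (\<lambda>x. F (a + c *\<^sub>R x))"
proof -
  let ?g = "\<lambda>x. ennreal (cmod (F x) powr q) * indicator E x"
  have g: "?g \<in> borel_measurable borel" using F E by measurable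
  have T: "(\<lambda>x :: real^'m. a + c *\<^sub>R x) \<in> borel_measurable borel" by measurable
  have "Lp_integral q E F = (\<integral>\<^sup>+x. ?g x \<partial>density (distr lborel borel (\<lambda>x. a + c *\<^sub>R x)) (\<lambda>_. \<bar>c\<bar>^DIM(real^'m)))"
    unfolding Lp_integral_def using lborel_affine[of c a] c by simp
  also have "\<dots> = (\<integral>\<^sup>+x. ennreal (\<bar>c\<bar>^DIM(real^'m)) * ?g x \<partial>distr lborel borel (\<lambda>x. a + c *\<^sub>R x))"
    using g by (intro nn_integral_density) auto
  also have "\<dots> = (\<integral>\<^sup>+x. ennreal (\<bar>c\<bar>^DIM(real^'m)) * ?g (a + c *\<^sub>R x) \<partial>lborel)"
    using g by (intro nn_integral_distr) auto
  also have "\<dots> = ennreal (\<bar>c\<bar>^DIM(real^'m)) * (\<integral>\<^sup>+x. ?g (a + c *\<^sub>R x) \<partial>lborel)"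
    using measurable_compose[OF T g] by (intro nn_integral_cmult) (auto simp: measurable_lborel1)
  also have "(\<integral>\<^sup>+x. ?g (a + c *\<^sub>R x) \<partial>lborel) = Lp_integral q {x. a + c *\<^sub>R x \<in> E} (\<lambda>x. F (a + c *\<^sub>R x))"
    unfolding Lp_integral_def by (intro nn_integral_cong) (auto simp: indicator_def)
  finally show ?thesis using c by simp
qed

lemma affine_preimage_borel:
  fixes E :: "(real^'m::finite) set"
  assumes "E \<in> sets borel"
  shows "{x. a + c *\<^sub>R x \<in> E} \<in> sets borel"
proof -
  have "(\<lambda>x :: real^'m. a + c *\<^sub>R x) \<in> borel_measurable borel" by measurable
  from measurable_sets[OF this assms] show ?thesis by (simp add: vimage_def)
qed

text \<open>The quasinorm may be infinite, hence the two sides are compared in \<^typ>\<open>ennreal\<close>.\<close>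

lemma Lp_norm_affine:
  fixes F :: "real^'m::finite \<Rightarrow> complex"
  assumes p: "0 < p" and F: "continuous_on UNIV F" and c: "0 < c"
    and E: "E \<in> sets borel" "E \<subseteq> closure (interior E)"
    and E': "E' = {x. a + c *\<^sub>R x \<in> E}" "E' \<subseteq> closure (interior E')"
  shows "Lp_norm p E F = ennreal (c powr (if p = \<infinity> then 0 else real CARD('m) / enn2real p)) * Lp_norm p E' (\<lambda>x. F (a + c *\<^sub>R x))"
proof (cases "p = \<infinity>")
  case True
  have F': "continuous_on UNIV (\<lambda>x. F (a + c *\<^sub>R x))"
    by (intro continuous_on_compose2[OF F] continuous_intros) auto
  have B': "E' \<in> sets borel" unfolding E' by (rule affine_preimage_borel[OF E(1)])
  have "(\<forall>x\<in>E. ennreal (cmod (F x)) \<le> u) \<longleftrightarrow> (\<forall>x\<in>E'. ennreal (cmod (F (a + c *\<^sub>R x))) \<le> u)" for u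
  proof safe
    fix x assume all: "\<forall>x\<in>E'. ennreal (cmod (F (a + c *\<^sub>R x))) \<le> u" and x: "x \<in> E"
    have "a + c *\<^sub>R ((1 / c) *\<^sub>R (x - a)) = x" using c by simp
    moreover from this have "(1 / c) *\<^sub>R (x - a) \<in> E'" using x unfolding E' by simp
    ultimately show "ennreal (cmod (F x)) \<le> u" using all by metis
  qed (auto simp: E')
  then have "Lp_norm p E F \<le> u \<longleftrightarrow> Lp_norm p E' (\<lambda>x. F (a + c *\<^sub>R x)) \<le> u" for u
    unfolding True Lp_norm_infinity_le_iff[OF F E] Lp_norm_infinity_le_iff[OF F' B' E'(2)] .
  then have "Lp_norm p E F = Lp_norm p E' (\<lambda>x. F (a + c *\<^sub>R x))" by (metis order_antisym order_refl)
  then show ?thesis using True c by simp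
next
  case False
  define q where "q = enn2real p"
  have q: "0 < q" unfolding q_def by (rule enn2real_pos[OF p False])
  have B': "E' \<in> sets borel" unfolding E' by (rule affine_preimage_borel[OF E(1)])
  define I where "I = Lp_integral q E' (\<lambda>x. F (a + c *\<^sub>R x))"
  have I: "Lp_integral q E F = ennreal (c ^ CARD('m)) * I"
    unfolding I_def E'(1) by (rule Lp_integral_affine[OF borel_measurable_continuous_onI[OF F] E(1) c])
  have cp: "0 < c ^ CARD('m)" using c by simp
  have "ennreal_powr (ennreal (c ^ CARD('m)) * I) (1 / q) = ennreal (c powr (real CARD('m) / q)) * ennreal_powr I (1 / q)"
  proof (cases I)
    case (real r)
    have "ennreal (c ^ CARD('m)) * I = ennreal (c ^ CARD('m) * r)" using real cp by (simp add: ennreal_mult)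
    moreover have "(c ^ CARD('m) * r) powr (1 / q) = c powr (real CARD('m) / q) * r powr (1 / q)"
      using real c by (simp add: powr_mult powr_realpow[symmetric] powr_powr)
    moreover have "ennreal_powr (ennreal (c ^ CARD('m) * r)) (1 / q) = ennreal ((c ^ CARD('m) * r) powr (1 / q))"
      using real cp by (intro ennreal_powr_ennreal) simp
    ultimately show ?thesis using real c by (simp only: ennreal_powr_ennreal) (simp add: ennreal_mult)
  next
    case top
    then show ?thesis using cp c by (simp add: ennreal_powr_def ennreal_mult_eq_top_iff)
  qed
  then show ?thesis
    unfolding Lp_norm_finite[OF False E(1)] Lp_norm_finite[OF False B'] q_def[symmetric] I I_def[symmetric]
    using False by simp
qed

section \<open>The Nikolskii inequality for polynomials\<close>

lemma holomorphic_lipschitz_at_unit: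
  assumes g: "g holomorphic_on UNIV" and Y: "Y > 1" and B: "\<And>\<zeta>. cmod \<zeta> \<le> Y \<Longrightarrow> cmod (g \<zeta>) \<le> B"
  shows "cmod (g 1 - g 0) \<le> B / (Y - 1)"
proof -
  have "cmod (g 1 - g 0) \<le> B / (Y - 1) * cmod (1 - 0)"
  proof (rule field_differentiable_bound[of "cball 0 1" g "deriv g"])
    show "(g has_field_derivative deriv g z) (at z within cball 0 1)" for z
      using holomorphic_derivI[OF g open_UNIV] has_field_derivative_at_within by blast
    show "cmod (deriv g z) \<le> B / (Y - 1)" if z: "z \<in> cball 0 1" for z
    proof -
      have "cmod ((deriv ^^ 1) g z) \<le> fact 1 * B / (Y - 1) ^ 1"
      proof (rule Cauchy_inequality)
        show "g holomorphic_on ball z (Y - 1)" "continuous_on (cball z (Y - 1)) g"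
          using g holomorphic_on_subset holomorphic_on_imp_continuous_on by blast+
        fix x assume "cmod (z - x) = Y - 1"
        then have "cmod x \<le> Y" using z norm_triangle_sub[of x z] by (simp add: norm_minus_commute)
        then show "cmod (g x) \<le> B" by (rule B)
      qed (use Y in simp)
      then show ?thesis by simp
    qed
  qed auto
  then show ?thesis by simp
qed

context symmetric_body
begin

lemma sets_body [measurable]: "{x. body_norm x \<le> L} \<in> sets borel"
  using compact_body_norm_le by (simp add: borel_compact)

text \<open>Contracting a point of the body towards 0 puts it into the open body. This is the
  regularity required by \<open>Lp_norm_infinity_le_iff\<close>.\<close>

lemma body_regular:
  assumes L: "0 < L"
  shows "{x. body_norm x \<le> L} \<subseteq> closure (interior {x. body_norm x \<le> L})"
proof -
  have "{x. body_norm x < L} \<subseteq> interior {x. body_norm x \<le> L}"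
    by (rule interior_maximal[OF _ open_body_norm_less]) auto
  then have "closure {x. body_norm x < L} \<subseteq> closure (interior {x. body_norm x \<le> L})" by (rule closure_mono)
  moreover have "x \<in> closure {x. body_norm x < L}" if x: "body_norm x \<le> L" for x
    unfolding closure_sequential
  proof (intro exI[of _ "\<lambda>n. (1 - 1 / real (n + 2)) *\<^sub>R x"] conjI allI)
    show "(1 - 1 / real (n + 2)) *\<^sub>R x \<in> {x. body_norm x < L}" for n
    proof -
      have "(1 - 1 / real (n + 2)) * body_norm x \<le> (1 - 1 / real (n + 2)) * L" using x by (intro mult_left_mono) auto
      also have "\<dots> < L" using L by (simp add: algebra_simps)
      finally show ?thesis by (simp add: body_norm_scaleR)
    qed
    have "(\<lambda>n. 1 - 1 / real (n + 2)) \<longlonglongrightarrow> 1" by real_asymp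
    from tendsto_scaleR[OF this tendsto_const, of x]
    show "(\<lambda>n. (1 - 1 / real (n + 2)) *\<^sub>R x) \<longlonglongrightarrow> x" by simp
  qed
  ultimately show ?thesis by blast
qed

lemma polys_continuous:
  assumes "P \<in> polys n"
  shows "continuous_on A P"
proof -
  obtain c where "P = (\<lambda>x. \<Sum>\<alpha> | mi_size \<alpha> \<le> n. c \<alpha> * mono_fun \<alpha> x)" using assms unfolding polys_iff by blast
  then show ?thesis unfolding mono_fun_def by (auto intro!: continuous_intros)
qed

text \<open>Maximise \<open>|Q| (1 - \<parallel>x\<parallel> / L)\<^sup>a\<close> with \<open>a = m / q\<close>. By the Bernstein--Walsh inequality the polynomial stays
  large in a ball around the maximiser whose radius is proportional to the distance to the
  boundary, and the weight is chosen to compensate the volume of this ball.\<close>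

lemma polynomial_nikolskii_finite:
  assumes q: "0 < (q :: real)" and A: "0 < A" and lam: "0 < lam" "lam < 1"
  obtains c where "c > 0"
    "\<And>L d Q x. \<lbrakk>1 \<le> L; real d \<le> A * L; Q \<in> polys d; body_norm x \<le> lam * L\<rbrakk> \<Longrightarrow>
      ennreal ((c * cmod (Q x)) powr q) \<le> Lp_integral q {x. body_norm x \<le> L} Q"
proof -
  obtain r1 r2 where r: "r1 > 0" "r2 > 0" "\<And>x. r1 * norm x \<le> body_norm x" "\<And>x. body_norm x \<le> r2 * norm x"
    using body_norm_equiv_norm by blast
  define m where "m = CARD('m)"
  define a where "a = real m / q"
  have a: "0 < a" using q by (simp add: a_def m_def)
  \<comment> \<open>The Lipschitz bound 3 * 2^a q0 / (Y - 1) is then q0 / 2.\<close>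
  define Y where "Y = 1 + 6 * 2 powr a"
  have Y: "Y > 1" by (simp add: Y_def)
  \<comment> \<open>The first bound keeps the ball around the maximiser inside the body, the second
    makes the Bernstein--Walsh exponent at most 1 on the disc of radius \<open>Y\<close>.\<close>
  define \<kappa> where "\<kappa> = min (1 / 2) (1 / (2 * A * Y))"
  have \<kappa>: "0 < \<kappa>" "\<kappa> \<le> 1 / 2" "2 * A * \<kappa> * Y \<le> 1" using A Y by (auto simp: \<kappa>_def min_def field_simps)
  define ub where "ub = unit_ball_vol (real m) * (\<kappa> / r2) ^ m"
  have ub: "0 < ub" using \<kappa> r by (simp add: ub_def unit_ball_vol_pos)
  define k where "k = (ub powr (1 / q)) / 2 * (1 - lam) powr a"
  have k: "0 < k" using ub lam by (simp add: k_def)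
  have "ennreal ((k * cmod (Q x)) powr q) \<le> Lp_integral q {x. body_norm x \<le> L} Q"
    if L: "1 \<le> L" and d: "real d \<le> A * L" and Q: "Q \<in> polys d" and x: "body_norm x \<le> lam * L" for L d Q x
  proof -
    define K where "K = {x. body_norm x \<le> L}"
    define W where "W y = cmod (Q y) * (1 - body_norm y / L) powr a" for y
    have "continuous_on K (\<lambda>y. (1 - body_norm y / L) powr a)"
      using L a by (intro continuous_on_powr' continuous_intros continuous_body_norm) (auto simp: K_def)
    then have cW: "continuous_on K W"
      unfolding W_def by (rule continuous_on_mult[OF continuous_on_norm[OF polys_continuous[OF Q]]])
    have "0 \<in> K" using L body_norm_scaleR[of 0 0] by (simp add: K_def)
    then obtain z where z: "z \<in> K" "\<And>y. y \<in> K \<Longrightarrow> W y \<le> W z"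
      using continuous_attains_sup[OF _ _ cW] compact_body_norm_le[of L] unfolding K_def by blast
    have "lam * L \<le> 1 * L" using L lam by (intro mult_right_mono) auto
    then have xL: "body_norm x \<le> L" using x by linarith
    have Wx: "cmod (Q x) * (1 - lam) powr a \<le> W z"
    proof -
      have "1 - lam \<le> 1 - body_norm x / L" using x L by (simp add: field_simps)
      then have "(1 - lam) powr a \<le> (1 - body_norm x / L) powr a" using lam a by (intro powr_mono2) auto
      then have "cmod (Q x) * (1 - lam) powr a \<le> W x" unfolding W_def by (intro mult_left_mono) auto
      also have "\<dots> \<le> W z" using xL by (intro z(2)) (simp add: K_def)
      finally show ?thesis .
    qed
    show ?thesis
    proof (cases "Q x = 0")
      case True
      then show ?thesis using q by simp
    next
      case False
      then have "0 < cmod (Q x) * (1 - lam) powr a" using lam by simp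
      then have Wz: "0 < W z" using Wx by linarith
      define D where "D = 1 - body_norm z / L"
      have zL: "body_norm z \<le> L" using z(1) by (simp add: K_def)
      have "D \<ge> 0" using zL L by (simp add: D_def)
      moreover have "D \<noteq> 0" using Wz a by (auto simp: W_def D_def)
      ultimately have D: "0 < D" by simp
      have D1: "D \<le> 1" using body_norm_nonneg[of z] L by (simp add: D_def)
      have zD: "body_norm z = L * (1 - D)" using L by (simp add: D_def)
      define q0 where "q0 = cmod (Q z)"
      have WzD: "W z = q0 * D powr a" by (simp add: W_def D_def q0_def)
      have q0: "0 < q0" using Wz D unfolding WzD by (simp add: zero_less_mult_iff)
      obtain f where f: "cpoly_fun d f" "Q = restrict_real f" using polys_complexify[OF Q] .
      have Qf: "Q y = f (cvec y)" for y unfolding f(2) restrict_real_def ..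
      have big: "q0 / 2 \<le> cmod (Q (z + v))" if v: "body_norm v \<le> \<kappa> * D" for v
      proof -
        \<comment> \<open>For |t| \<le> T the point moves by at most L D / 2, half of its distance
          to the boundary; the weight drops by at most 2^a, and maximality of \<open>z\<close> gives
          |Q| \<le> 2^a q0 on the whole segment.\<close>
        define T where "T = L / (2 * \<kappa>)"
        have T: "0 < T" using L \<kappa> by (simp add: T_def)
        have seg: "cmod (f (cvec (z + t *\<^sub>R v))) \<le> 2 powr a * q0" if t: "\<bar>t\<bar> \<le> T" for t
        proof -
          have "body_norm (z + t *\<^sub>R v) \<le> body_norm z + \<bar>t\<bar> * body_norm v"
            using body_norm_triangle[of z "t *\<^sub>R v"] by (simp add: body_norm_scaleR)
          also have "\<bar>t\<bar> * body_norm v \<le> T * (\<kappa> * D)" using t v T by (intro mult_mono) (auto simp: body_norm_nonneg)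
          also have "T * (\<kappa> * D) = L * D / 2" using \<kappa> by (simp add: T_def)
          finally have b: "body_norm (z + t *\<^sub>R v) \<le> L * (1 - D / 2)" by (simp add: zD algebra_simps)
          also have "\<dots> \<le> L" using L D by simp
          finally have yK: "z + t *\<^sub>R v \<in> K" by (simp add: K_def)
          have "D / 2 \<le> 1 - body_norm (z + t *\<^sub>R v) / L" using b L by (simp add: field_simps)
          then have "(D / 2) powr a \<le> (1 - body_norm (z + t *\<^sub>R v) / L) powr a" using D a by (intro powr_mono2) auto
          then have "cmod (Q (z + t *\<^sub>R v)) * (D / 2) powr a \<le> W (z + t *\<^sub>R v)" unfolding W_def by (intro mult_left_mono) auto
          also have "\<dots> \<le> q0 * D powr a" unfolding WzD[symmetric] by (rule z(2)[OF yK])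
          finally have "cmod (Q (z + t *\<^sub>R v)) * (D powr a / 2 powr a) \<le> q0 * D powr a" using D by (simp add: powr_divide)
          then show ?thesis using D unfolding Qf[symmetric] by (simp add: field_simps)
        qed
        define g where "g \<zeta> = f (cvec z + \<zeta> *s cvec v)" for \<zeta>
        have g: "g holomorphic_on UNIV"
          unfolding g_def[abs_def] using f(1) by (intro entire_line_holomorphic) (simp add: cpoly_fun_def)
        have gB: "cmod (g \<zeta>) \<le> 3 * (2 powr a * q0)" if \<zeta>: "cmod \<zeta> \<le> Y" for \<zeta>
        proof -
          have "real d * cmod \<zeta> / T \<le> (A * L) * Y / T"
            using d \<zeta> T A L Y by (intro divide_right_mono mult_mono) auto
          also have "\<dots> = 2 * A * \<kappa> * Y" using L \<kappa> by (simp add: T_def)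
          also have "\<dots> \<le> 1" by (rule \<kappa>(3))
          finally have "exp (real d * cmod \<zeta> / T) \<le> exp 1" by simp
          also have "\<dots> \<le> 3" by (rule exp_le)
          finally have e3: "exp (real d * cmod \<zeta> / T) \<le> 3" .
          have "cmod (g \<zeta>) \<le> (2 powr a * q0) * exp (real d * cmod \<zeta> / T)"
            unfolding g_def by (rule cpoly_fun_line_bound[OF f(1) T seg])
          also have "\<dots> \<le> (2 powr a * q0) * 3" using e3 q0 by (intro mult_left_mono) auto
          finally show ?thesis by simp
        qed
        have "cmod (g 1 - g 0) \<le> 3 * (2 powr a * q0) / (Y - 1)" by (rule holomorphic_lipschitz_at_unit[OF g Y gB])
        also have "\<dots> = q0 / 2" by (simp add: Y_def)
        finally have "cmod (g 1 - g 0) \<le> q0 / 2" .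
        moreover have "g 0 = Q z" "g 1 = Q (z + v)" unfolding g_def Qf cvec_add by simp_all
        ultimately show ?thesis using norm_triangle_ineq2[of "g 0" "g 1"] by (simp add: q0_def norm_minus_commute)
      qed
      define \<rho> where "\<rho> = \<kappa> * D / r2"
      have \<rho>: "0 < \<rho>" using \<kappa> D r by (simp add: \<rho>_def)
      have near: "q0 / 2 \<le> cmod (Q y)" "y \<in> K" if "y \<in> ball z \<rho>" for y
      proof -
        have "norm (y - z) \<le> \<rho>" using that by (simp add: dist_norm norm_minus_commute)
        then have "r2 * norm (y - z) \<le> \<kappa> * D" using r by (simp add: \<rho>_def field_simps)
        then have v: "body_norm (y - z) \<le> \<kappa> * D" using r(4)[of "y - z"] by linarith
        from big[OF this] show "q0 / 2 \<le> cmod (Q y)" by simp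
        have "body_norm y \<le> body_norm z + body_norm (y - z)" using body_norm_triangle[of z "y - z"] by simp
        also have "\<dots> \<le> L * (1 - D) + \<kappa> * D" using v zD by simp
        also have "\<dots> \<le> L * (1 - D) + L * D" using \<kappa> L D by (intro add_left_mono mult_right_mono) auto
        also have "\<dots> = L" by (simp add: algebra_simps)
        finally show "y \<in> K" by (simp add: K_def)
      qed
      have "ennreal ((q0 / 2) powr q) * emeasure lborel (ball z \<rho>) =
          (\<integral>\<^sup>+y. ennreal ((q0 / 2) powr q) * indicator (ball z \<rho>) y \<partial>lborel)"
        by (subst nn_integral_cmult_indicator) auto
      also have "\<dots> \<le> Lp_integral q K Q"
        unfolding Lp_integral_def
      proof (rule nn_integral_mono)
        fix y
        show "ennreal ((q0 / 2) powr q) * indicator (ball z \<rho>) y \<le> ennreal (cmod (Q y) powr q) * indicator K y"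
        proof (cases "y \<in> ball z \<rho>")
          case True
          then show ?thesis using near[OF True] q0 q by (simp add: ennreal_leI powr_mono2)
        qed simp
      qed
      finally have low: "ennreal ((q0 / 2) powr q) * emeasure lborel (ball z \<rho>) \<le> Lp_integral q K Q" .
      have vol: "emeasure lborel (ball z \<rho>) = ennreal (ub * D powr real m)"
      proof -
        have "emeasure lborel (ball z \<rho>) = ennreal (unit_ball_vol (real m) * \<rho> ^ m)"
          using \<rho> by (simp add: emeasure_ball m_def)
        also have "\<rho> ^ m = (\<kappa> / r2) ^ m * D powr real m"
          using D by (simp add: \<rho>_def powr_realpow power_mult_distrib power_divide)
        finally show ?thesis by (simp add: ub_def mult.assoc)
      qed
      have "k * cmod (Q x) \<le> (ub powr (1 / q)) / 2 * W z"
        using Wx ub unfolding k_def by (simp add: mult.assoc mult_left_mono mult.commute)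
      then have "(k * cmod (Q x)) powr q \<le> ((ub powr (1 / q)) / 2 * W z) powr q"
        using k q by (intro powr_mono2) auto
      also have "\<dots> = (ub powr (1 / q) * (q0 / 2) * D powr a) powr q" unfolding WzD by (simp add: mult_ac)
      also have "\<dots> = (ub powr (1 / q)) powr q * (q0 / 2) powr q * (D powr a) powr q"
        by (simp only: powr_mult)
      also have "(ub powr (1 / q)) powr q = ub" using q ub by (simp add: powr_powr)
      also have "(D powr a) powr q = D powr real m" using q by (simp add: powr_powr a_def)
      finally have "(k * cmod (Q x)) powr q \<le> (q0 / 2) powr q * (ub * D powr real m)" by (simp add: mult_ac)
      then have "ennreal ((k * cmod (Q x)) powr q) \<le> ennreal ((q0 / 2) powr q) * ennreal (ub * D powr real m)"
        using ub by (subst ennreal_mult[symmetric]) (auto intro!: ennreal_leI)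
      also have "\<dots> \<le> Lp_integral q K Q" using low unfolding vol .
      finally show ?thesis unfolding K_def .
    qed
  qed
  with k show thesis using that by blast
qed

lemma polynomial_nikolskii:
  assumes p: "0 < (p :: ennreal)" and A: "0 < A" and lam: "0 < lam" "lam < 1"
  obtains C where "C > 0"
    "\<And>L d Q x. \<lbrakk>1 \<le> L; real d \<le> A * L; Q \<in> polys d; body_norm x \<le> lam * L\<rbrakk> \<Longrightarrow>
      ennreal (cmod (Q x)) \<le> ennreal C * Lp_norm p {x. body_norm x \<le> L} Q"
proof (cases "p = \<infinity>")
  case True
  have "ennreal (cmod (Q x)) \<le> ennreal 1 * Lp_norm p {x. body_norm x \<le> L} Q"
    if "1 \<le> L" "real d \<le> A * L" "Q \<in> polys d" "body_norm x \<le> lam * L" for L d Q x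
  proof -
    have "lam * L \<le> 1 * L" using that(1) lam by (intro mult_right_mono) auto
    then have "body_norm x \<le> L" using that(4) by linarith
    moreover have "0 < L" using that(1) by simp
    then have "\<forall>x\<in>{x. body_norm x \<le> L}. ennreal (cmod (Q x)) \<le> Lp_norm \<infinity> {x. body_norm x \<le> L} Q"
      by (rule iffD1[OF Lp_norm_infinity_le_iff[OF polys_continuous[OF that(3)] sets_body body_regular] order_refl])
    ultimately show ?thesis using True by simp
  qed
  then show thesis using that[of 1] by simp
next
  case False
  define q where "q = enn2real p"
  have q: "0 < q" unfolding q_def by (rule enn2real_pos[OF p False])
  obtain c where c: "c > 0" "\<And>L d Q x. \<lbrakk>1 \<le> L; real d \<le> A * L; Q \<in> polys d; body_norm x \<le> lam * L\<rbrakk> \<Longrightarrow>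
      ennreal ((c * cmod (Q x)) powr q) \<le> Lp_integral q {x. body_norm x \<le> L} Q"
    using polynomial_nikolskii_finite[OF q A lam] by blast
  have "ennreal (cmod (Q x)) \<le> ennreal (1 / c) * Lp_norm p {x. body_norm x \<le> L} Q"
    if "1 \<le> L" "real d \<le> A * L" "Q \<in> polys d" "body_norm x \<le> lam * L" for L d Q x
  proof -
    have "ennreal (c * cmod (Q x)) \<le> Lp_norm p {x. body_norm x \<le> L} Q"
      using c(2)[OF that] c(1) unfolding q_def by (intro Lp_norm_finite_geI[OF p False sets_body]) auto
    then have "ennreal (1 / c) * ennreal (c * cmod (Q x)) \<le> ennreal (1 / c) * Lp_norm p {x. body_norm x \<le> L} Q"
      by (rule mult_left_mono) simp
    moreover have "ennreal (1 / c) * ennreal (c * cmod (Q x)) = ennreal (cmod (Q x))"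
      using c(1) by (simp flip: ennreal_mult)
    ultimately show ?thesis by simp
  qed
  then show thesis using that[of "1 / c"] c(1) by simp
qed

end

section \<open>Norms of approximating polynomials and boundedness\<close>

text \<open>A substitute for the triangle inequality that is valid for all positive q: the main term
  keeps a factor close to 1 and the loss falls on the error term. The cases are e \<le> \<delta> a
  and its negation.\<close>

lemma powr_add_le:
  assumes "0 < q" "0 < \<delta>" "0 \<le> a" "0 \<le> (e :: real)"
  shows "(a + e) powr q \<le> (1 + \<delta>) powr q * a powr q + (1 + 1 / \<delta>) powr q * e powr q"
proof (cases "e \<le> \<delta> * a")
  case True
  then have "(a + e) powr q \<le> ((1 + \<delta>) * a) powr q" using assms by (intro powr_mono2) (auto simp: algebra_simps)
  also have "\<dots> = (1 + \<delta>) powr q * a powr q" by (rule powr_mult)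
  finally show ?thesis by (simp add: add_increasing2)
next
  case False
  then have "a + e \<le> (1 + 1 / \<delta>) * e" using assms by (simp add: field_simps)
  then have "(a + e) powr q \<le> ((1 + 1 / \<delta>) * e) powr q" using assms by (intro powr_mono2) auto
  also have "\<dots> = (1 + 1 / \<delta>) powr q * e powr q" by (rule powr_mult)
  finally show ?thesis by (simp add: add_increasing)
qed

lemma Lp_integral_cmult:
  fixes F :: "real^'m::finite \<Rightarrow> complex"
  assumes F: "F \<in> borel_measurable borel" and E: "E \<in> sets borel"
  shows "Lp_integral q E (\<lambda>x. c * F x) = ennreal (cmod c powr q) * Lp_integral q E F"
proof -
  note [measurable] = F E
  have "Lp_integral q E (\<lambda>x. c * F x) =
      (\<integral>\<^sup>+x. ennreal (cmod c powr q) * (ennreal (cmod (F x) powr q) * indicator E x) \<partial>lborel)"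
    unfolding Lp_integral_def by (intro nn_integral_cong) (simp add: norm_mult powr_mult ennreal_mult mult.assoc)
  also have "\<dots> = ennreal (cmod c powr q) * Lp_integral q E F"
    unfolding Lp_integral_def by (rule nn_integral_cmult) measurable
  finally show ?thesis .
qed

lemma Lp_norm_cmult_le:
  fixes F :: "real^'m::finite \<Rightarrow> complex"
  assumes p: "0 < p" and F: "continuous_on UNIV F" and E: "E \<in> sets borel" "E \<subseteq> closure (interior E)"
    and M: "Lp_norm p E F \<le> ennreal M" "0 \<le> M"
  shows "Lp_norm p E (\<lambda>x. c * F x) \<le> ennreal (cmod c * M)"
proof (cases "p = \<infinity>")
  case True
  have F': "continuous_on UNIV (\<lambda>x. c * F x)" by (intro continuous_intros F)
  have *: "\<forall>x\<in>E. ennreal (cmod (F x)) \<le> ennreal M" using M(1) unfolding True Lp_norm_infinity_le_iff[OF F E] .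
  have "cmod (c * F x) \<le> cmod c * M" if "x \<in> E" for x
    using bspec[OF * that] M(2) by (simp add: norm_mult mult_left_mono)
  then show ?thesis unfolding True Lp_norm_infinity_le_iff[OF F' E] using ennreal_leI by blast
next
  case False
  define q where "q = enn2real p"
  have q: "0 < q" unfolding q_def by (rule enn2real_pos[OF p False])
  have "Lp_integral q E F \<le> ennreal (M powr q)"
  proof -
    have le: "ennreal_powr (Lp_integral q E F) (1 / q) \<le> ennreal M" using M(1) unfolding Lp_norm_finite[OF False E(1)] q_def .
    then have "Lp_integral q E F \<noteq> \<infinity>" by (auto simp: ennreal_powr_def top_unique)
    then obtain i where i: "Lp_integral q E F = ennreal i" "0 \<le> i" by (cases "Lp_integral q E F") auto
    then have "i powr (1 / q) \<le> M" using le M(2) by (simp add: ennreal_powr_ennreal)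
    then have "(i powr (1 / q)) powr q \<le> M powr q" using q by (intro powr_mono2) auto
    then show ?thesis using i q by (simp add: powr_powr ennreal_leI)
  qed
  then have "ennreal (cmod c powr q) * Lp_integral q E F \<le> ennreal (cmod c powr q) * ennreal (M powr q)"
    by (rule mult_left_mono) simp
  also have "\<dots> = ennreal ((cmod c * M) powr q)" by (simp add: powr_mult ennreal_mult)
  finally show ?thesis
    using M(2) Lp_integral_cmult[OF borel_measurable_continuous_onI[OF F] E(1)] unfolding q_def
    by (intro Lp_norm_finite_leI[OF p False E(1)]) auto
qed

lemma entire_restrict_continuous:
  assumes "entire f"
  shows "continuous_on A (restrict_real f)"
proof -
  have "continuous_on A cvec" by (intro continuous_on_vec_lambda continuous_intros)
  then show ?thesis unfolding restrict_real_def[abs_def]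
    by (rule continuous_on_compose2[OF entire_continuous_on[OF assms, of UNIV]]) simp
qed

lemma entire_borel_measurable: "entire f \<Longrightarrow> restrict_real f \<in> borel_measurable borel"
  by (intro borel_measurable_continuous_onI entire_restrict_continuous)

lemma cvec_Re_Im: "z = cvec (\<chi> j. Re (z $ j)) + \<i> *s cvec (\<chi> j. Im (z $ j))"
  by (simp add: vec_eq_iff complex_eq_iff)

lemma norm_Re_Im_vec_le: "norm (\<chi> j. Re (z $ j)) \<le> norm z" "norm (\<chi> j. Im (z $ j)) \<le> norm (z :: complex^'n::finite)"
  unfolding norm_vec_def by (intro L2_set_mono; simp add: abs_Re_le_cmod abs_Im_le_cmod)+

context symmetric_body
begin

text \<open>The error is uniformly exponentially small on a body of volume of order n^m, so its
  share of the integral tends to 0 and the norms fall below any bound exceeding that of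
  \<open>F\<close>.\<close>

lemma Lp_norm_limsup:
  fixes Q :: "nat \<Rightarrow> real^'m::{finite,linorder} \<Rightarrow> complex"
  assumes p: "0 < p" and F: "continuous_on UNIV F" and Q: "\<And>n. n > 0 \<Longrightarrow> continuous_on UNIV (Q n)"
    and \<kappa>: "0 < \<kappa>" and A: "0 \<le> A"
    and approx: "\<And>n x. n > 0 \<Longrightarrow> body_norm x \<le> real n \<Longrightarrow> cmod (F x - Q n x) \<le> A * exp (- \<kappa> * real n)"
    and u: "Lp_norm p UNIV F < ennreal u" "0 \<le> u"
  shows "\<forall>\<^sub>F n in sequentially. Lp_norm p {x. body_norm x \<le> real n} (Q n) \<le> ennreal u"
proof -
  have Qle: "cmod (Q n x) \<le> cmod (F x) + A * exp (- \<kappa> * real n)" if "n > 0" "body_norm x \<le> real n" for n x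
    using approx[OF that] norm_triangle_sub[of "Q n x" "F x"] by (simp add: norm_minus_commute)
  show ?thesis
  proof (cases "p = \<infinity>")
    case True
    obtain s where s: "Lp_norm \<infinity> UNIV F = ennreal s" "0 \<le> s"
      using u True by (cases "Lp_norm \<infinity> UNIV F") (auto simp: top_unique)
    have su: "s < u" using u s True by (simp add: ennreal_less_iff)
    have "\<forall>x\<in>UNIV. ennreal (cmod (F x)) \<le> ennreal s"
      using s(1) by (intro iffD1[OF Lp_norm_infinity_le_iff[OF F]]) auto
    then have Fs: "cmod (F x) \<le> s" for x using s(2) by simp
    have "(\<lambda>n. A * exp (- \<kappa> * real n)) \<longlonglongrightarrow> A * 0" using \<kappa> by (intro tendsto_mult tendsto_const) real_asymp
    then have "(\<lambda>n. A * exp (- \<kappa> * real n)) \<longlonglongrightarrow> 0" by simp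
    then have "\<forall>\<^sub>F n in sequentially. A * exp (- \<kappa> * real n) < u - s" by (rule order_tendstoD) (use su in simp)
    with eventually_gt_at_top[of 0] show ?thesis
    proof eventually_elim
      case (elim n)
      have "\<forall>x\<in>{x. body_norm x \<le> real n}. ennreal (cmod (Q n x)) \<le> ennreal u"
      proof
        fix x assume "x \<in> {x. body_norm x \<le> real n}"
        then have "cmod (Q n x) \<le> u" using Qle[OF elim(1), of x] Fs[of x] elim(2) by simp
        then show "ennreal (cmod (Q n x)) \<le> ennreal u" by (rule ennreal_leI)
      qed
      then show ?case unfolding True using elim(1)
        by (intro iffD2[OF Lp_norm_infinity_le_iff[OF Q[OF elim(1)] sets_body body_regular]]) auto
    qed
  next
    case False
    define q where "q = enn2real p"
    have q: "0 < q" unfolding q_def by (rule enn2real_pos[OF p False])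
    have less: "ennreal_powr (Lp_integral q UNIV F) (1 / q) < ennreal u"
      using u(1) unfolding q_def by (subst (asm) Lp_norm_finite[OF False]) auto
    then have "Lp_integral q UNIV F \<noteq> \<infinity>" by (auto simp: ennreal_powr_def)
    then obtain i where i: "Lp_integral q UNIV F = ennreal i" "0 \<le> i" by (cases "Lp_integral q UNIV F") auto
    then have "i powr (1 / q) < u" using less by (simp add: ennreal_powr_ennreal ennreal_less_iff)
    then have "(i powr (1 / q)) powr q < u powr q" using q by (intro powr_less_mono2) auto
    then have iu: "i < u powr q" using i q by (simp add: powr_powr)
    \<comment> \<open>The strict inequality between the norm of \<open>F\<close> and
      \<open>u\<close> pays for the factor (1 + \<delta>)^q of \<open>powr_add_le\<close>.\<close>
    obtain \<delta> where \<delta>: "\<delta> > 0" "(1 + \<delta>) powr q * i < u powr q"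
    proof -
      have "(\<lambda>k. (1 + 1 / real (Suc k)) powr q * i) \<longlonglongrightarrow> (1 + 0) powr q * i"
        by (intro tendsto_mult tendsto_const tendsto_powr tendsto_add) (real_asymp, simp)
      then have "\<forall>\<^sub>F k in sequentially. (1 + 1 / real (Suc k)) powr q * i < u powr q"
        by (rule order_tendstoD) (use iu in simp)
      then obtain k where "(1 + 1 / real (Suc k)) powr q * i < u powr q" using eventually_happens by force
      then show thesis using that[of "1 / real (Suc k)"] by simp
    qed
    obtain r1 where r1: "r1 > 0" "\<And>x. r1 * norm x \<le> body_norm x" using body_norm_equiv_norm by metis
    define m where "m = CARD('m)"
    \<comment> \<open>Chosen so that the error term equals B t^m / exp t with t = \<kappa> q
      n.\<close>
    define B where "B = (1 + 1 / \<delta>) powr q * A powr q * unit_ball_vol (real m) / (r1 * \<kappa> * q) ^ m"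
    define E where "E n = (1 + 1 / \<delta>) powr q * (A * exp (- \<kappa> * real n)) powr q" for n
    have bound: "Lp_integral q {x. body_norm x \<le> real n} (Q n) \<le>
        ennreal ((1 + \<delta>) powr q * i + E n * (unit_ball_vol (real m) * (real n / r1) ^ m))" if n: "n > 0" for n
    proof -
      have "{x. body_norm x \<le> real n} \<subseteq> cball 0 (real n / r1)"
      proof
        fix x assume "x \<in> {x. body_norm x \<le> real n}"
        then have "r1 * norm x \<le> real n" using r1(2)[of x] by simp
        then show "x \<in> cball 0 (real n / r1)" using r1(1) by (simp add: field_simps)
      qed
      then have "emeasure lborel {x. body_norm x \<le> real n} \<le> emeasure lborel (cball 0 (real n / r1) :: (real^'m::{finite,linorder}) set)"
        by (rule emeasure_mono) simp
      also have "\<dots> = ennreal (unit_ball_vol (real m) * (real n / r1) ^ m)"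
        using r1(1) by (subst emeasure_cball) (auto simp: m_def)
      finally have vol: "emeasure lborel {x. body_norm x \<le> real n} \<le> ennreal (unit_ball_vol (real m) * (real n / r1) ^ m)" .
      have Fm: "F \<in> borel_measurable borel" by (rule borel_measurable_continuous_onI[OF F])
      have "Lp_integral q {x. body_norm x \<le> real n} (Q n) \<le>
          (\<integral>\<^sup>+x. ennreal ((1 + \<delta>) powr q) * (ennreal (cmod (F x) powr q) * indicator UNIV x) +
             ennreal (E n) * indicator {x. body_norm x \<le> real n} x \<partial>lborel)"
        unfolding Lp_integral_def
      proof (rule nn_integral_mono)
        fix x
        show "ennreal (cmod (Q n x) powr q) * indicator {x. body_norm x \<le> real n} x \<le>
            ennreal ((1 + \<delta>) powr q) * (ennreal (cmod (F x) powr q) * indicator UNIV x) +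
             ennreal (E n) * indicator {x. body_norm x \<le> real n} x"
        proof (cases "body_norm x \<le> real n")
          case True
          have "cmod (Q n x) powr q \<le> (cmod (F x) + A * exp (- \<kappa> * real n)) powr q"
            using Qle[OF n True] q by (intro powr_mono2) auto
          also have "\<dots> \<le> (1 + \<delta>) powr q * cmod (F x) powr q + E n"
            unfolding E_def using A by (intro powr_add_le q \<delta>(1)) auto
          finally have "ennreal (cmod (Q n x) powr q) \<le> ennreal ((1 + \<delta>) powr q * cmod (F x) powr q + E n)" by (rule ennreal_leI)
          also have "\<dots> = ennreal ((1 + \<delta>) powr q) * ennreal (cmod (F x) powr q) + ennreal (E n)"
            by (simp add: ennreal_mult E_def)
          finally show ?thesis using True by simp
        qed simp
      qed
      also have "\<dots> = ennreal ((1 + \<delta>) powr q) * Lp_integral q UNIV F + ennreal (E n) * emeasure lborel {x. body_norm x \<le> real n}"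
      proof -
        have "(\<lambda>x. cmod (F x) powr q) \<in> borel_measurable borel" using Fm by measurable
        then have m1: "(\<lambda>x. ennreal (cmod (F x) powr q) * indicator UNIV x) \<in> borel_measurable lborel" by simp
        have m2: "{x. body_norm x \<le> real n} \<in> sets lborel" using sets_body by simp
        have m3: "(\<lambda>x. ennreal (E n) * indicator {x. body_norm x \<le> real n} x) \<in> borel_measurable lborel"
          using m2 by (intro borel_measurable_times_ennreal borel_measurable_const borel_measurable_indicator)
        have m4: "(\<lambda>x. ennreal ((1 + \<delta>) powr q) * (ennreal (cmod (F x) powr q) * indicator UNIV x)) \<in> borel_measurable lborel"
          by (intro borel_measurable_times_ennreal borel_measurable_const m1)
        show ?thesis unfolding Lp_integral_def
          by (simp only: nn_integral_add[OF m4 m3] nn_integral_cmult[OF m1] nn_integral_cmult_indicator[OF m2])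
      qed
      also have "\<dots> \<le> ennreal ((1 + \<delta>) powr q) * ennreal i + ennreal (E n) * ennreal (unit_ball_vol (real m) * (real n / r1) ^ m)"
        unfolding i(1) using vol by (intro add_left_mono mult_left_mono) auto
      also have "\<dots> = ennreal ((1 + \<delta>) powr q * i + E n * (unit_ball_vol (real m) * (real n / r1) ^ m))"
        using i(2) r1(1) by (simp add: ennreal_mult E_def)
      finally show ?thesis .
    qed
    have Elim: "(\<lambda>n. E n * (unit_ball_vol (real m) * (real n / r1) ^ m)) \<longlonglongrightarrow> 0"
    proof -
      have "filterlim (\<lambda>n. \<kappa> * q * real n) at_top sequentially" using \<kappa> q by real_asymp
      from filterlim_compose[OF tendsto_power_div_exp_0 this]
      have "(\<lambda>n. B * ((\<kappa> * q * real n) ^ m / exp (\<kappa> * q * real n))) \<longlonglongrightarrow> B * 0" by (intro tendsto_mult tendsto_const)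
      moreover have "E n * (unit_ball_vol (real m) * (real n / r1) ^ m) = B * ((\<kappa> * q * real n) ^ m / exp (\<kappa> * q * real n))" for n
      proof -
        have "(A * exp (- \<kappa> * real n)) powr q = A powr q / exp (\<kappa> * q * real n)"
        proof -
          have "exp (- \<kappa> * real n) powr q = exp ((- \<kappa> * real n) * q)" by (rule exp_powr_real)
          also have "(- \<kappa> * real n) * q = - (\<kappa> * q * real n)" by simp
          finally show ?thesis by (simp only: powr_mult exp_minus divide_inverse)
        qed
        then show ?thesis unfolding E_def B_def using \<kappa> q r1(1)
          by (simp add: power_mult_distrib power_divide mult_ac)
      qed
      ultimately show ?thesis by simp
    qed
    have "(\<lambda>n. (1 + \<delta>) powr q * i + E n * (unit_ball_vol (real m) * (real n / r1) ^ m)) \<longlonglongrightarrow> (1 + \<delta>) powr q * i + 0"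
      by (intro tendsto_add tendsto_const Elim)
    then have "\<forall>\<^sub>F n in sequentially. (1 + \<delta>) powr q * i + E n * (unit_ball_vol (real m) * (real n / r1) ^ m) < u powr q"
      by (rule order_tendstoD) (use \<delta>(2) in simp)
    with eventually_gt_at_top[of 0] show ?thesis
    proof eventually_elim
      case (elim n)
      have "Lp_integral q {x. body_norm x \<le> real n} (Q n) \<le> ennreal (u powr q)"
        using bound[OF elim(1)] elim(2) by (meson ennreal_leI less_imp_le order_trans)
      then show ?case unfolding q_def by (intro Lp_norm_finite_leI[OF p False sets_body u(2)])
    qed
  qed
qed

text \<open>On the body of radius \<open>L\<close> the function is exponentially close to a Taylor polynomial of degree
  \<open>8 L\<close>, so the Nikolskii inequality for polynomials passes to \<open>f\<close>.\<close>

lemma exp_type_Lp_bounded: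
  assumes f: "f \<in> exp_type V" and p: "0 < p" and Lp: "restrict_real f \<in> Lp_space p UNIV"
  obtains M where "\<And>x. cmod (f (cvec x)) \<le> M"
proof -
  have ent: "entire f" using f by (simp add: exp_type_def)
  obtain C where C: "\<And>z. cmod (f z) \<le> C * exp (2 * dual_norm V z)"
  proof -
    have "\<forall>\<epsilon>>0. \<exists>C. \<forall>z. cmod (f z) \<le> C * exp ((1 + \<epsilon>) * dual_norm V z)" using f by (simp add: exp_type_def)
    then have "\<exists>C. \<forall>z. cmod (f z) \<le> C * exp ((1 + 1) * dual_norm V z)" using zero_less_one by blast
    then show thesis using that by auto
  qed
  define P where "P L x = (\<Sum>j\<le>8 * L. hom_part f j x / fact j)" for L x
  have P: "P L \<in> polys (8 * L)" for L
  proof -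
    have "(\<lambda>x. \<Sum>j\<le>8 * L. (1 / fact j) * hom_part f j x) \<in> polys (8 * L)"
      using polys_mono[OF _ hom_part_polys[OF ent]] by (intro polys_sum polys_cmult) auto
    then show ?thesis unfolding P_def[abs_def] by simp
  qed
  have approx: "cmod (restrict_real f x - P n x) \<le> \<bar>C\<bar> * exp (- 1 * real n)" if "body_norm x \<le> real n" for n x
  proof -
    have "cmod (restrict_real f x - P n x) \<le> C * exp (- real n)"
      unfolding P_def restrict_real_def by (rule taylor_approximation[OF ent C that])
    also have "\<dots> \<le> \<bar>C\<bar> * exp (- real n)" by (intro mult_right_mono) auto
    finally show ?thesis by simp
  qed
  have "Lp_norm p UNIV (restrict_real f) < \<infinity>" using Lp by (simp add: Lp_space_def)
  then obtain s where s: "Lp_norm p UNIV (restrict_real f) = ennreal s" "0 \<le> s"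
    by (cases "Lp_norm p UNIV (restrict_real f)") auto
  have "\<forall>\<^sub>F n in sequentially. Lp_norm p {x. body_norm x \<le> real n} (P n) \<le> ennreal (s + 1)"
    by (rule Lp_norm_limsup[where F = "restrict_real f" and A = "\<bar>C\<bar>" and \<kappa> = 1])
      (use p s approx in \<open>auto intro!: entire_restrict_continuous[OF ent] polys_continuous[OF P] simp: ennreal_less_iff\<close>)
  then obtain n0 where n0: "\<And>n. n \<ge> n0 \<Longrightarrow> Lp_norm p {x. body_norm x \<le> real n} (P n) \<le> ennreal (s + 1)"
    unfolding eventually_sequentially by blast
  obtain D where D: "D > 0" "\<And>L d Q x. \<lbrakk>1 \<le> L; real d \<le> 8 * L; Q \<in> polys d; body_norm x \<le> (1/2) * L\<rbrakk> \<Longrightarrow>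
      ennreal (cmod (Q x)) \<le> ennreal D * Lp_norm p {x. body_norm x \<le> L} Q"
    by (rule polynomial_nikolskii[OF p, of 8 "1/2"]) auto
  have "cmod (f (cvec x)) \<le> D * (s + 1) + \<bar>C\<bar>" for x
  proof -
    obtain n1 :: nat where n1: "2 * body_norm x \<le> real n1" using real_arch_simple by blast
    \<comment> \<open>Large enough to put \<open>x\<close> into the inner half of the body, where
      the Nikolskii inequality holds, and to pass the index from which the norm bound holds.\<close>
    define n where "n = max (max n0 n1) 1"
    have n: "n \<ge> n0" "2 * body_norm x \<le> real n" "1 \<le> real n" using n1 by (auto simp: n_def)
    have "ennreal (cmod (P n x)) \<le> ennreal D * Lp_norm p {x. body_norm x \<le> real n} (P n)"
      using n by (intro D(2)[OF _ _ P]) auto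
    also have "\<dots> \<le> ennreal D * ennreal (s + 1)" by (intro mult_left_mono n0 n) simp
    also have "\<dots> = ennreal (D * (s + 1))" using D(1) s(2) by (simp add: ennreal_mult)
    finally have 1: "cmod (P n x) \<le> D * (s + 1)" using D(1) s(2) by (simp add: ennreal_le_iff)
    have "body_norm x \<le> real n" using n(2) body_norm_nonneg[of x] by linarith
    from approx[OF this] have "cmod (f (cvec x) - P n x) \<le> \<bar>C\<bar> * exp (- 1 * real n)" by (simp only: restrict_real_def)
    also have "\<dots> \<le> \<bar>C\<bar> * 1" by (intro mult_left_mono) auto
    finally show ?thesis using 1 norm_triangle_sub[of "f (cvec x)" "P n x"] by linarith
  qed
  then show thesis using that by blast
qed

section \<open>Growth and local bounds of normalised polynomials\<close>

text \<open>Bernstein--Walsh at \<zeta> = i on the line through x in direction y. The last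
  hypothesis keeps the segment |t| \<le> T in the smaller body, where the Nikolskii inequality
  bounds the polynomial. \<open>T\<close> stays free: local bounds need only T proportional to n,
  the exact type needs T nearly maximal.\<close>

lemma polynomial_growth:
  assumes p: "0 < p" and lam: "0 < lam" "lam < 1"
  obtains C where "C > 0"
    "\<And>n f M x y T. \<lbrakk>0 < n; cpoly_fun n f; restrict_real f \<in> polys n;
       Lp_norm p {x. body_norm x \<le> real n} (restrict_real f) \<le> ennreal M; 0 \<le> M; 0 < T;
       body_norm x + T * body_norm y \<le> lam * real n\<rbrakk> \<Longrightarrow>
       cmod (f (cvec x + \<i> *s cvec y)) \<le> C * M * exp (real n / T)"
proof -
  obtain C where C: "C > 0" "\<And>L d Q x. \<lbrakk>1 \<le> L; real d \<le> 1 * L; Q \<in> polys d; body_norm x \<le> lam * L\<rbrakk> \<Longrightarrow>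
      ennreal (cmod (Q x)) \<le> ennreal C * Lp_norm p {x. body_norm x \<le> L} Q"
    by (rule polynomial_nikolskii[OF p, of 1 lam]) (use lam in auto)
  have "cmod (f (cvec x + \<i> *s cvec y)) \<le> C * M * exp (real n / T)"
    if n: "0 < n" and f: "cpoly_fun n f" "restrict_real f \<in> polys n"
      and M: "Lp_norm p {x. body_norm x \<le> real n} (restrict_real f) \<le> ennreal M" "0 \<le> M"
      and T: "0 < T" and le: "body_norm x + T * body_norm y \<le> lam * real n" for n f M x y T
  proof -
    have "cmod (f (cvec (x + t *\<^sub>R y))) \<le> C * M" if t: "\<bar>t\<bar> \<le> T" for t
    proof -
      have "body_norm (x + t *\<^sub>R y) \<le> body_norm x + \<bar>t\<bar> * body_norm y"
        using body_norm_triangle[of x "t *\<^sub>R y"] by (simp add: body_norm_scaleR)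
      also have "\<dots> \<le> body_norm x + T * body_norm y" using t by (intro add_left_mono mult_right_mono body_norm_nonneg)
      finally have b: "body_norm (x + t *\<^sub>R y) \<le> lam * real n" using le by linarith
      have "ennreal (cmod (restrict_real f (x + t *\<^sub>R y))) \<le> ennreal C * Lp_norm p {x. body_norm x \<le> real n} (restrict_real f)"
        using n by (intro C(2)[OF _ _ f(2) b]) auto
      also have "\<dots> \<le> ennreal C * ennreal M" by (intro mult_left_mono M) simp
      also have "\<dots> = ennreal (C * M)" using C(1) M(2) by (simp add: ennreal_mult)
      finally show ?thesis using C(1) M(2) by (simp add: restrict_real_def ennreal_le_iff)
    qed
    from cpoly_fun_line_bound[OF f(1) T this, of \<i>] show ?thesis by simp
  qed
  then show thesis using that[OF C(1)] by blast
qed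

text \<open>In \<open>polynomial_growth\<close> a \<open>T\<close> proportional to n makes the
  exponent n / T independent of the degree.\<close>

lemma polynomial_local_bound:
  assumes p: "0 < p"
  shows "\<exists>C n0. C > 0 \<and> n0 > 0 \<and> (\<forall>n\<ge>n0. \<forall>f M. cpoly_fun n f \<longrightarrow> restrict_real f \<in> polys n \<longrightarrow>
      Lp_norm p {x. body_norm x \<le> real n} (restrict_real f) \<le> ennreal M \<longrightarrow> 0 \<le> M \<longrightarrow>
      (\<forall>z. norm z \<le> R \<longrightarrow> cmod (f z) \<le> C * M))"
proof -
  obtain r2 where r2: "r2 > 0" "\<And>x. body_norm x \<le> r2 * norm x" using body_norm_equiv_norm by metis
  obtain C where C: "C > 0" "\<And>n f M x y T. \<lbrakk>0 < n; cpoly_fun n f; restrict_real f \<in> polys n;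
       Lp_norm p {x. body_norm x \<le> real n} (restrict_real f) \<le> ennreal M; 0 \<le> M; 0 < T;
       body_norm x + T * body_norm y \<le> (1/2) * real n\<rbrakk> \<Longrightarrow>
       cmod (f (cvec x + \<i> *s cvec y)) \<le> C * M * exp (real n / T)"
    by (rule polynomial_growth[OF p, of "1/2"]) auto
  \<comment> \<open>S / 4 bounds the body norms of real and imaginary part. With T = n / S and n
    \<ge> S each of them uses at most n / 4 of the available n / 2.\<close>
  define S where "S = 4 * (r2 * \<bar>R\<bar> + 1)"
  have S: "S > 0" using r2(1) by (simp add: S_def add_nonneg_pos)
  obtain n1 :: nat where n1: "S \<le> real n1" using real_arch_simple by blast
  have "cmod (f z) \<le> C * exp S * M"
    if n: "n \<ge> max n1 1" and f: "cpoly_fun n f" "restrict_real f \<in> polys n"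
      "Lp_norm p {x. body_norm x \<le> real n} (restrict_real f) \<le> ennreal M" "0 \<le> M" and z: "norm z \<le> R" for n f M z
  proof -
    have n0: "n > 0" using n by auto
    define x y where "x = (\<chi> j. Re (z $ j))" and "y = (\<chi> j. Im (z $ j))"
    have z': "z = cvec x + \<i> *s cvec y" unfolding x_def y_def by (rule cvec_Re_Im)
    have "norm x \<le> \<bar>R\<bar>" "norm y \<le> \<bar>R\<bar>" unfolding x_def y_def using norm_Re_Im_vec_le[of z] z by linarith+
    then have "r2 * norm x \<le> r2 * \<bar>R\<bar>" "r2 * norm y \<le> r2 * \<bar>R\<bar>" using r2(1) by (simp_all add: mult_left_mono)
    then have hx: "body_norm x \<le> S / 4" and hy: "body_norm y \<le> S / 4"
      using r2(2)[of x] r2(2)[of y] by (simp_all add: S_def)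
    define T where "T = real n / S"
    have T: "T > 0" using n0 S by (simp add: T_def)
    have "T * body_norm y \<le> T * (S / 4)" using hy T by (intro mult_left_mono) auto
    also have "\<dots> = real n / 4" using S by (simp add: T_def)
    finally have "body_norm x + T * body_norm y \<le> (1/2) * real n" using hx n1 n by simp
    from C(2)[OF n0 f T this] have "cmod (f z) \<le> C * M * exp (real n / T)" unfolding z' .
    also have "real n / T = S" using n0 S by (simp add: T_def)
    finally show ?thesis by (simp add: mult_ac)
  qed
  moreover have "C * exp S > 0" using C(1) by simp
  ultimately show ?thesis by (intro exI[of _ "C * exp S"] exI[of _ "max n1 1"]) auto
qed

lemma polynomial_diff_op_bound:
  assumes p: "0 < p"
  obtains C n0 where "C > 0" "n0 > 0" "\<And>n Q M. \<lbrakk>n \<ge> n0; Q \<in> polys n;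
      Lp_norm p {x. body_norm x \<le> real n} Q \<le> ennreal M; 0 \<le> M\<rbrakk> \<Longrightarrow> cmod (diff_op N b Q 0) \<le> C * M"
proof -
  obtain C n0 where C: "C > 0" "n0 > 0" "\<And>n f M z. n \<ge> n0 \<Longrightarrow> cpoly_fun n f \<Longrightarrow> restrict_real f \<in> polys n \<Longrightarrow>
      Lp_norm p {x. body_norm x \<le> real n} (restrict_real f) \<le> ennreal M \<Longrightarrow> 0 \<le> M \<Longrightarrow>
      norm z \<le> real N \<Longrightarrow> cmod (f z) \<le> C * M"
    using polynomial_local_bound[OF p, of "real N"] by blast
  define k where "k = (\<Sum>\<alpha> | mi_size \<alpha> = N. cmod (b \<alpha>))"
  have k: "k \<ge> 0" by (simp add: k_def sum_nonneg)
  \<comment> \<open>Taking k + 1 keeps the constant positive when all coefficients \<open>b\<close>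
    vanish.\<close>
  have "cmod (diff_op N b Q 0) \<le> ((k + 1) * C) * M"
    if n: "n \<ge> n0" and Q: "Q \<in> polys n" and M: "Lp_norm p {x. body_norm x \<le> real n} Q \<le> ennreal M" "0 \<le> M" for n Q M
  proof -
    obtain f where f: "cpoly_fun n f" "Q = restrict_real f" using polys_complexify[OF Q] .
    have "cmod (diff_op N b Q 0) \<le> k * (C * M)"
      unfolding f(2) k_def using f(1) by (intro diff_op_bound C(3)[OF n f(1)]) (use Q M f(2) in \<open>auto simp: cpoly_fun_def\<close>)
    also have "\<dots> \<le> (k + 1) * (C * M)" using C(1) M(2) by (intro mult_right_mono) auto
    finally show ?thesis by (simp add: mult.assoc)
  qed
  moreover have "(k + 1) * C > 0" using k C(1) by (simp add: add_nonneg_pos)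
  ultimately show thesis using that C(2) by blast
qed

end

section \<open>Sharp constants\<close>

lemma polys_scale:
  fixes P :: "real^'n::finite \<Rightarrow> complex"
  assumes "P \<in> polys n"
  shows "(\<lambda>x. P (c *\<^sub>R x)) \<in> polys n"
proof -
  obtain d where d: "P = (\<lambda>x. \<Sum>\<alpha> | mi_size \<alpha> \<le> n. d \<alpha> * mono_fun \<alpha> x)"
    using assms unfolding polys_iff by blast
  have "mono_fun \<alpha> (c *\<^sub>R x) = of_real c ^ mi_size \<alpha> * mono_fun \<alpha> x" for \<alpha> :: "nat^'n" and x
    unfolding mono_fun_def mi_size_def by (simp add: power_mult_distrib prod.distrib power_sum)
  then have "(\<lambda>x. P (c *\<^sub>R x)) = (\<lambda>x. \<Sum>\<alpha> | mi_size \<alpha> \<le> n. (d \<alpha> * of_real c ^ mi_size \<alpha>) * mono_fun \<alpha> x)"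
    unfolding d by (simp add: mult.assoc)
  then show ?thesis unfolding polys_iff by (rule exI[of _ "\<lambda>\<alpha>. d \<alpha> * of_real c ^ mi_size \<alpha>"])
qed

lemma diff_op_polys_scale:
  fixes P :: "real^'n::{finite,linorder} \<Rightarrow> complex"
  assumes "P \<in> polys n"
  shows "diff_op N b (\<lambda>x. P (c *\<^sub>R x)) 0 = of_real c ^ N * diff_op N b P 0"
proof -
  obtain f where f: "cpoly_fun n f" "P = restrict_real f" using polys_complexify[OF assms] .
  have e: "entire f" using f(1) by (simp add: cpoly_fun_def)
  have "(\<lambda>x. P (c *\<^sub>R x)) = restrict_real (\<lambda>z. 1 * f (cvec 0 + of_real c *s z))"
    unfolding f(2) restrict_real_def[abs_def] cvec_scaleR cvec_0 by simp
  then have "diff_op N b (\<lambda>x. P (c *\<^sub>R x)) 0 = 1 * of_real c ^ N * diff_op N b (restrict_real f) (0 + c *\<^sub>R 0)"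
    by (simp only: diff_op_affine[OF e])
  then show ?thesis unfolding f(2) by simp
qed

lemma diff_op_polys_cmult:
  fixes P :: "real^'n::{finite,linorder} \<Rightarrow> complex"
  assumes "P \<in> polys n"
  shows "diff_op N b (\<lambda>x. k * P x) 0 = k * diff_op N b P 0"
proof -
  obtain f where f: "cpoly_fun n f" "P = restrict_real f" using polys_complexify[OF assms] .
  have e: "entire f" using f(1) by (simp add: cpoly_fun_def)
  have "(\<lambda>x. k * P x) = restrict_real (\<lambda>z. k * f (cvec 0 + of_real 1 *s z))"
    unfolding f(2) restrict_real_def[abs_def] cvec_0 by simp
  then have "diff_op N b (\<lambda>x. k * P x) 0 = k * of_real 1 ^ N * diff_op N b (restrict_real f) (0 + 1 *\<^sub>R 0)"
    by (simp only: diff_op_affine[OF e])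
  then show ?thesis unfolding f(2) by simp
qed

text \<open>As \<open>c\<close> is positive and finite, this covers X = 0 and X = \<infinity> as
  well, so no norm has to be known to be positive or finite.\<close>

lemma ennreal_divide_mult_real:
  assumes "0 < c"
  shows "d / (ennreal c * X) = ennreal (1 / c) * (d / X)"
proof -
  have "inverse (ennreal c * X) = inverse (ennreal c) * inverse X"
  proof (cases X)
    case (real r)
    show ?thesis
    proof (cases "r = 0")
      case True
      then show ?thesis using real assms by (simp add: inverse_ennreal ennreal_mult_top)
    next
      case False
      with real have r: "r > 0" by simp
      have "ennreal c * ennreal r = ennreal (c * r)" using assms r by (simp add: ennreal_mult)
      then show ?thesis unfolding real(2)
        using assms r by (simp add: inverse_ennreal ennreal_mult[symmetric] inverse_mult_distrib)
    qed
  next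
    case top
    then show ?thesis using assms by (simp add: ennreal_mult_top)
  qed
  then show ?thesis using assms
    by (simp add: divide_ennreal_def inverse_ennreal inverse_eq_divide mult_ac)
qed

context symmetric_body
begin

definition scaled_ratio :: "ennreal \<Rightarrow> nat \<Rightarrow> (nat^'m::{finite,linorder} \<Rightarrow> complex) \<Rightarrow> nat \<Rightarrow> (real^'m::{finite,linorder} \<Rightarrow> complex) \<Rightarrow> ennreal" where
  "scaled_ratio p N b n Q = ennreal (cmod (diff_op N b Q 0)) / Lp_norm p {x. body_norm x \<le> real n} Q"

text \<open>Passing from Q(x) to Q(n x) multiplies the derivative at 0 by n^N and the norm by
  n^(-m/p), which cancels the normalising power in \<open>M_const\<close>.\<close>

lemma M_const_scaled:
  assumes p: "0 < p" and n: "0 < n"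
  shows "M_const p N b n V = (SUP Q \<in> polys n - {\<lambda>_. 0}. scaled_ratio p N b n Q)"
proof -
  define e where "e = (if p = \<infinity> then 0 else real CARD('m) / enn2real p)"
  have n0: "real n > 0" using n by simp
  have ratio: "ennreal (real n powr (- real N - e)) * (ennreal (cmod (diff_op N b (\<lambda>x. Q (real n *\<^sub>R x)) 0)) / Lp_norm p (polar V) (\<lambda>x. Q (real n *\<^sub>R x)))
      = scaled_ratio p N b n Q" if Q: "Q \<in> polys n" for Q
  proof -
    have "Lp_norm p {x. body_norm x \<le> real n} Q = ennreal (real n powr e) * Lp_norm p (polar V) (\<lambda>x. Q (0 + real n *\<^sub>R x))"
      unfolding e_def
    proof (rule Lp_norm_affine[OF p polys_continuous[OF Q] n0 sets_body body_regular[OF n0]])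
      show "polar V = {x. 0 + real n *\<^sub>R x \<in> {x. body_norm x \<le> real n}}"
        using n0 by (simp add: polar_eq body_norm_scaleR mult_le_cancel_left1)
      show "polar V \<subseteq> closure (interior (polar V))" unfolding polar_eq by (rule body_regular) simp
    qed
    then have X: "Lp_norm p {x. body_norm x \<le> real n} Q = ennreal (real n powr e) * Lp_norm p (polar V) (\<lambda>x. Q (real n *\<^sub>R x))"
      by simp
    have d: "cmod (diff_op N b (\<lambda>x. Q (real n *\<^sub>R x)) 0) = real n ^ N * cmod (diff_op N b Q 0)"
      unfolding diff_op_polys_scale[OF Q] by (simp add: norm_mult norm_power)
    have "scaled_ratio p N b n Q = ennreal (1 / real n powr e) * (ennreal (cmod (diff_op N b Q 0)) / Lp_norm p (polar V) (\<lambda>x. Q (real n *\<^sub>R x)))"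
      unfolding scaled_ratio_def X using n0 by (intro ennreal_divide_mult_real) simp
    also have "ennreal (1 / real n powr e) = ennreal (real n powr (- real N - e)) * ennreal (real n ^ N)"
      using n0 by (simp add: ennreal_mult[symmetric] powr_diff powr_minus powr_realpow divide_inverse)
    finally show ?thesis
      unfolding d by (simp add: ennreal_mult ennreal_times_divide mult.assoc)
  qed
  have "M_const p N b n V = (SUP P \<in> polys n - {\<lambda>_. 0}. ennreal (real n powr (- real N - e)) * (ennreal (cmod (diff_op N b P 0)) / Lp_norm p (polar V) P))"
    unfolding M_const_def e_def[symmetric] by (rule SUP_mult_left_ennreal)
  also have "\<dots> = (SUP Q \<in> polys n - {\<lambda>_. 0}. scaled_ratio p N b n Q)"
  proof (rule SUP_eq)
    fix P :: "real^'m::{finite,linorder} \<Rightarrow> complex" assume P: "P \<in> polys n - {\<lambda>_. 0}"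
    define Q where "Q x = P ((1 / real n) *\<^sub>R x)" for x
    have PQ: "(\<lambda>x. Q (real n *\<^sub>R x)) = P" using n0 by (simp add: Q_def)
    have "Q \<in> polys n" unfolding Q_def[abs_def] using P by (intro polys_scale) auto
    moreover from this have "Q \<noteq> (\<lambda>_. 0)" using P PQ by auto
    ultimately show "\<exists>Q\<in>polys n - {\<lambda>_. 0}. ennreal (real n powr (- real N - e)) * (ennreal (cmod (diff_op N b P 0)) / Lp_norm p (polar V) P) \<le> scaled_ratio p N b n Q"
      using ratio[of Q] unfolding PQ by (intro bexI[of _ Q]) auto
  next
    fix Q :: "real^'m::{finite,linorder} \<Rightarrow> complex" assume Q: "Q \<in> polys n - {\<lambda>_. 0}"
    define P where "P x = Q (real n *\<^sub>R x)" for x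
    have QP: "(\<lambda>x. P ((1 / real n) *\<^sub>R x)) = Q" using n0 by (simp add: P_def)
    have "P \<in> polys n" unfolding P_def[abs_def] using Q by (intro polys_scale) auto
    moreover have "P \<noteq> (\<lambda>_. 0)" using Q QP by auto
    ultimately show "\<exists>P\<in>polys n - {\<lambda>_. 0}. scaled_ratio p N b n Q \<le> ennreal (real n powr (- real N - e)) * (ennreal (cmod (diff_op N b P 0)) / Lp_norm p (polar V) P)"
      using ratio[of Q] Q unfolding P_def[abs_def, symmetric] by (intro bexI[of _ P]) auto
  qed
  finally show ?thesis .
qed

lemma scaled_ratio_le:
  assumes "\<And>M. 0 \<le> M \<Longrightarrow> Lp_norm p {x. body_norm x \<le> real n} Q \<le> ennreal M \<Longrightarrow> cmod (diff_op N b Q 0) \<le> C * M" and C: "0 \<le> C"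
  shows "scaled_ratio p N b n Q \<le> ennreal C"
proof (cases "Lp_norm p {x. body_norm x \<le> real n} Q")
  case (real M)
  have d: "cmod (diff_op N b Q 0) \<le> C * M" using assms(1)[of M] real by simp
  show ?thesis
  proof (cases "M = 0")
    \<comment> \<open>The hypothesis forces the numerator to vanish, and 0 / 0 is 0 in
      \<open>ennreal\<close>.\<close>
    case True
    then show ?thesis using d real by (simp add: scaled_ratio_def)
  next
    case False
    then have "M > 0" using real by simp
    then show ?thesis using d unfolding scaled_ratio_def real
      by (subst divide_ennreal) (auto intro!: ennreal_leI simp: divide_simps)
  qed
qed (simp add: scaled_ratio_def)

text \<open>The product form of the constant also speaks about polynomials of norm 0: for them the a
  priori bound forces the derivative at 0 to vanish.\<close>

lemma M_const_bounds:
  assumes p: "0 < p"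
  obtains C n0 where "C > 0" "n0 > 0" "\<And>n. n \<ge> n0 \<Longrightarrow> M_const p N b n V \<le> ennreal C"
    "\<And>n Q M. n \<ge> n0 \<Longrightarrow> Q \<in> polys n \<Longrightarrow> Lp_norm p {x. body_norm x \<le> real n} Q \<le> ennreal M \<Longrightarrow> 0 \<le> M \<Longrightarrow>
       ennreal (cmod (diff_op N b Q 0)) \<le> M_const p N b n V * ennreal M"
proof -
  obtain C n0 where C: "C > 0" "n0 > 0" "\<And>n Q M. \<lbrakk>n \<ge> n0; Q \<in> polys n;
      Lp_norm p {x. body_norm x \<le> real n} Q \<le> ennreal M; 0 \<le> M\<rbrakk> \<Longrightarrow> cmod (diff_op N b Q 0) \<le> C * M"
    by (rule polynomial_diff_op_bound[OF p, where N = N and b = b]) blast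
  have 1: "M_const p N b n V \<le> ennreal C" if n: "n \<ge> n0" for n
  proof -
    have n': "n > 0" using n C(2) by simp
    show ?thesis unfolding M_const_scaled[OF p n']
      by (intro SUP_least scaled_ratio_le) (use C n in auto)
  qed
  have 2: "ennreal (cmod (diff_op N b Q 0)) \<le> M_const p N b n V * ennreal M"
    if n: "n \<ge> n0" and Q: "Q \<in> polys n" and M: "Lp_norm p {x. body_norm x \<le> real n} Q \<le> ennreal M" "0 \<le> M" for n Q M
  proof (cases "diff_op N b Q 0 = 0")
    case True
    then show ?thesis by simp
  next
    case False
    have n': "n > 0" using n C(2) by simp
    obtain k where k: "Lp_norm p {x. body_norm x \<le> real n} Q = ennreal k" "0 \<le> k"
      using M by (cases "Lp_norm p {x. body_norm x \<le> real n} Q") (auto simp: top_unique)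
    have kM: "k \<le> M" using k M by simp
    have "cmod (diff_op N b Q 0) \<le> C * k" using k by (intro C(3)[OF n Q]) auto
    moreover have "cmod (diff_op N b Q 0) > 0" using False by simp
    ultimately have k0: "k > 0" using C(1) k(2) by (smt (verit) mult_eq_0_iff)
    have "Q \<noteq> (\<lambda>_. 0)"
    proof
      assume "Q = (\<lambda>_. 0)"
      then have "Q = (\<lambda>x. 0 * Q x)" by simp
      then have "diff_op N b Q 0 = 0 * diff_op N b Q 0" using diff_op_polys_cmult[OF Q, of N b 0] by metis
      then show False using False by simp
    qed
    then have "scaled_ratio p N b n Q \<le> M_const p N b n V" unfolding M_const_scaled[OF p n'] using Q by (intro SUP_upper) auto
    then have "scaled_ratio p N b n Q * ennreal k \<le> M_const p N b n V * ennreal M"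
      using kM by (intro mult_mono) (auto intro: ennreal_leI)
    moreover have "scaled_ratio p N b n Q * ennreal k = ennreal (cmod (diff_op N b Q 0))"
      unfolding scaled_ratio_def k(1) using k0 by (simp add: divide_ennreal ennreal_mult[symmetric])
    ultimately show ?thesis by simp
  qed
  show thesis by (rule that[OF C(1,2) 1 2])
qed

lemma near_extremal_polynomial:
  assumes p: "0 < p" and n: "0 < n" and a: "M_const p N b n V = ennreal a" "0 \<le> a" and \<epsilon>: "0 < \<epsilon>"
    and bound: "\<And>Q M. Q \<in> polys n \<Longrightarrow> Lp_norm p {x. body_norm x \<le> real n} Q \<le> ennreal M \<Longrightarrow> 0 \<le> M \<Longrightarrow>
       ennreal (cmod (diff_op N b Q 0)) \<le> M_const p N b n V * ennreal M"
  obtains Q where "Q \<in> polys n" "Lp_norm p {x. body_norm x \<le> real n} Q \<le> ennreal 1"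
    "a - \<epsilon> \<le> cmod (diff_op N b Q 0)" "cmod (diff_op N b Q 0) \<le> a"
proof (cases "a - \<epsilon> \<le> 0")
  \<comment> \<open>The zero polynomial is near-extremal here; this covers in particular a = 0,
    where every ratio is 0 and none can be used for normalising.\<close>
  case True
  have Z: "(\<lambda>_. 0) \<in> polys n" by (rule polys_zero)
  have "Lp_norm p {x. body_norm x \<le> real n} (\<lambda>_. 0) \<le> ennreal 1"
  proof (cases "p = \<infinity>")
    case True
    have "real n > 0" using n by simp
    then show ?thesis unfolding True
      by (intro iffD2[OF Lp_norm_infinity_le_iff[OF continuous_on_const sets_body body_regular]]) auto
  next
    case False
    then show ?thesis using enn2real_pos[OF p False]
      by (intro Lp_norm_finite_leI[OF p False sets_body]) (auto simp: Lp_integral_def)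
  qed
  moreover have "diff_op N b (\<lambda>_. 0) 0 = 0" using diff_op_polys_cmult[OF Z, of N b 0] by simp
  ultimately show thesis using that[OF Z] True a(2) by simp
next
  case False
  have "ennreal (a - \<epsilon>) < (SUP Q \<in> polys n - {\<lambda>_. 0}. scaled_ratio p N b n Q)"
    unfolding M_const_scaled[OF p n, symmetric] a(1) using \<epsilon> False by (simp add: ennreal_less_iff)
  then obtain Q where Q: "Q \<in> polys n" "ennreal (a - \<epsilon>) < scaled_ratio p N b n Q" unfolding less_SUP_iff by blast
  define d where "d = cmod (diff_op N b Q 0)"
  have pos: "0 < scaled_ratio p N b n Q" using Q(2) by (rule le_less_trans[OF zero_le])
  then have "Lp_norm p {x. body_norm x \<le> real n} Q \<noteq> \<infinity>" by (auto simp: scaled_ratio_def)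
  then obtain k where k: "Lp_norm p {x. body_norm x \<le> real n} Q = ennreal k" "0 \<le> k"
    by (cases "Lp_norm p {x. body_norm x \<le> real n} Q") auto
  have d0: "d > 0" using pos unfolding scaled_ratio_def d_def[symmetric] by (cases "d = 0") (auto simp: d_def)
  have dk: "ennreal d \<le> ennreal a * ennreal k" using bound[OF Q(1) _ k(2)] k(1) unfolding a(1) d_def by simp
  then have dak: "d \<le> a * k" using a(2) k(2) by (simp add: ennreal_mult[symmetric])
  have k0: "k > 0" using dak d0 k(2) by (cases "k = 0") auto
  have "ennreal (a - \<epsilon>) < ennreal (d / k)"
    using Q(2) unfolding scaled_ratio_def k(1) d_def[symmetric] using k0 d0 by (simp add: divide_ennreal)
  then have low: "a - \<epsilon> < d / k" using False by (simp add: ennreal_less_iff)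
  define c where "c = complex_of_real (1 / k)"
  have cc: "cmod c = 1 / k" using k0 by (simp add: c_def norm_divide)
  have n0: "real n > 0" using n by simp
  show thesis
  proof (rule that[of "\<lambda>x. c * Q x"])
    show "(\<lambda>x. c * Q x) \<in> polys n" by (rule polys_cmult[OF Q(1)])
    have "Lp_norm p {x. body_norm x \<le> real n} (\<lambda>x. c * Q x) \<le> ennreal (cmod c * k)"
      using k by (intro Lp_norm_cmult_le[OF p polys_continuous[OF Q(1)] sets_body body_regular[OF n0]]) auto
    then show "Lp_norm p {x. body_norm x \<le> real n} (\<lambda>x. c * Q x) \<le> ennreal 1" using k0 by (simp add: cc)
    have "cmod (diff_op N b (\<lambda>x. c * Q x) 0) = d / k"
      unfolding diff_op_polys_cmult[OF Q(1)] norm_mult cc d_def by simp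
    then show "a - \<epsilon> \<le> cmod (diff_op N b (\<lambda>x. c * Q x) 0)" "cmod (diff_op N b (\<lambda>x. c * Q x) 0) \<le> a"
      using low dak k0 by (simp_all add: divide_le_eq)
  qed
qed

section \<open>The bound by the limit inferior and the extremal function for the limit
  superior\<close>

text \<open>The derivatives at 0 of the approximating polynomials converge by
  \<open>real_conv_diff_op\<close>, their norms are eventually below any number exceeding that of
  \<open>F\<close>, and the constants compare the two. Undoing the dilation leaves the factor
  \<tau>^(N + m/p).\<close>

lemma exp_type_diff_op_le:
  assumes p: "0 < p" and f: "f \<in> exp_type V" and Lp: "restrict_real f \<in> Lp_space p UNIV"
    and L: "liminf (\<lambda>n. M_const p N b n V) = ennreal l" "0 \<le> l"
    and s: "Lp_norm p UNIV (restrict_real f) = ennreal s" "0 \<le> s"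
  shows "cmod (diff_op N b (restrict_real f) x0) \<le> l * s"
proof -
  have ent: "entire f" using f by (simp add: exp_type_def)
  obtain M where M: "\<And>x. cmod (f (cvec x)) \<le> M" using exp_type_Lp_bounded[OF f p Lp] by blast
  define e where "e = (if p = \<infinity> then 0 else real CARD('m) / enn2real p)"
  have main: "\<tau> ^ N * cmod (diff_op N b (restrict_real f) x0) * \<tau> powr e \<le> l * s" if \<tau>: "0 < \<tau>" "\<tau> < 1" for \<tau>
  proof -
    define F where "F z = 1 * f (cvec x0 + of_real \<tau> *s z)" for z
    have F: "entire F" unfolding F_def[abs_def] by (intro entire_cmult entire_compose_affine ent)
    have rF: "restrict_real F = (\<lambda>x. restrict_real f (x0 + \<tau> *\<^sub>R x))"
      unfolding F_def[abs_def] restrict_real_def[abs_def] cvec_add cvec_scaleR by simp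
    \<comment> \<open>Chosen so that the type (1 + \<epsilon>) \<tau> is the midpoint of \<tau> and
      1.\<close>
    define \<epsilon> where "\<epsilon> = (1 - \<tau>) / (2 * \<tau>)"
    have \<epsilon>: "\<epsilon> > 0" using \<tau> by (simp add: \<epsilon>_def)
    define \<sigma> where "\<sigma> = (1 + \<epsilon>) * \<tau>"
    have \<sigma>': "\<sigma> = (1 + \<tau>) / 2" using \<tau> by (simp add: \<sigma>_def \<epsilon>_def field_simps)
    have \<sigma>: "0 < \<sigma>" "\<sigma> < 1" using \<tau> unfolding \<sigma>' by auto
    obtain C where C: "\<And>z. cmod (f z) \<le> C * exp ((1 + \<epsilon>) * dual_norm V z)"
      using f \<epsilon> unfolding exp_type_def by blast
    define C' where "C' = \<bar>C\<bar> * exp ((1 + \<epsilon>) * dual_norm V (cvec x0))"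
    have growth: "cmod (F z) \<le> C' * exp (\<sigma> * dual_norm V z)" for z
    proof -
      have "(1 + \<epsilon>) * dual_norm V (cvec x0 + of_real \<tau> *s z) \<le> (1 + \<epsilon>) * (dual_norm V (cvec x0) + \<tau> * dual_norm V z)"
        using dual_norm_triangle[of "cvec x0" "of_real \<tau> *s z"] \<epsilon> \<tau> unfolding dual_norm_smult
        by (intro mult_left_mono) auto
      also have "\<dots> = (1 + \<epsilon>) * dual_norm V (cvec x0) + \<sigma> * dual_norm V z" by (simp add: \<sigma>_def algebra_simps)
      finally have "exp ((1 + \<epsilon>) * dual_norm V (cvec x0 + of_real \<tau> *s z)) \<le> exp ((1 + \<epsilon>) * dual_norm V (cvec x0)) * exp (\<sigma> * dual_norm V z)"
        by (simp flip: exp_add)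
      then have "\<bar>C\<bar> * exp ((1 + \<epsilon>) * dual_norm V (cvec x0 + of_real \<tau> *s z)) \<le> \<bar>C\<bar> * (exp ((1 + \<epsilon>) * dual_norm V (cvec x0)) * exp (\<sigma> * dual_norm V z))"
        by (rule mult_left_mono) simp
      moreover have "C * exp ((1 + \<epsilon>) * dual_norm V (cvec x0 + of_real \<tau> *s z)) \<le> \<bar>C\<bar> * exp ((1 + \<epsilon>) * dual_norm V (cvec x0 + of_real \<tau> *s z))"
        by (rule mult_right_mono) auto
      moreover have "cmod (F z) \<le> C * exp ((1 + \<epsilon>) * dual_norm V (cvec x0 + of_real \<tau> *s z))"
        unfolding F_def mult_1 by (rule C)
      ultimately show ?thesis unfolding C'_def mult.assoc by linarith
    qed
    have FM: "cmod (F (cvec x)) \<le> M" for x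
      using M[of "x0 + \<tau> *\<^sub>R x"] unfolding F_def mult_1 cvec_add cvec_scaleR .
    obtain A \<kappa> Q where Q: "A > 0" "\<kappa> > 0" "\<And>n. n > 0 \<Longrightarrow> Q n \<in> polys n"
      "\<And>n x. n > 0 \<Longrightarrow> body_norm x \<le> real n \<Longrightarrow> cmod (F (cvec x) - Q n x) \<le> A * exp (- \<kappa> * real n)"
      by (rule polynomial_approximation[OF F \<sigma> growth FM]) blast
    have "\<forall>n. \<exists>g. n > 0 \<longrightarrow> cpoly_fun n g \<and> Q n = restrict_real g" using polys_complexify[OF Q(3)] by metis
    from choice[OF this] obtain g0 where g0: "\<And>n. n > 0 \<Longrightarrow> cpoly_fun n (g0 n) \<and> Q n = restrict_real (g0 n)" by blast
    \<comment> \<open>Approximants exist for positive degree only; the value at n = 0 makes the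
      whole sequence entire, as \<open>real_conv\<close> demands.\<close>
    define g where "g n = (if n > 0 then g0 n else (\<lambda>_. 0))" for n
    have g: "cpoly_fun n (g n)" "Q n = restrict_real (g n)" if "n > 0" for n using g0[OF that] that by (simp_all add: g_def)
    have ge: "entire (g n)" for n using g0[of n] by (auto simp: g_def entire_const cpoly_fun_def)
    have tN: "Lp_norm p UNIV (restrict_real f) = ennreal (\<tau> powr e) * Lp_norm p UNIV (restrict_real F)"
      unfolding rF e_def using \<tau> by (intro Lp_norm_affine[OF p entire_restrict_continuous[OF ent]]) auto
    have te: "\<tau> powr e > 0" using \<tau> by simp
    have "Lp_norm p UNIV (restrict_real F) \<noteq> \<infinity>"
    proof
      assume "Lp_norm p UNIV (restrict_real F) = \<infinity>"
      then show False using tN te unfolding s(1) by (simp add: ennreal_mult_top)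
    qed
    then obtain r where r: "Lp_norm p UNIV (restrict_real F) = ennreal r" "0 \<le> r"
      by (cases "Lp_norm p UNIV (restrict_real F)") auto
    have sr: "s = \<tau> powr e * r" using tN te r(2) s(2) unfolding s(1) r(1) by (simp flip: ennreal_mult)
    \<comment> \<open>\<open>Lp_norm_limsup\<close> needs a bound strictly above the norm; k tends
      to infinity at the end.\<close>
    define u where "u k = r + 1 / real (Suc k)" for k
    have ev: "\<forall>\<^sub>F n in sequentially. Lp_norm p {x. body_norm x \<le> real n} (Q n) \<le> ennreal (u k)" for k
    proof (rule Lp_norm_limsup[OF p, where F = "restrict_real F" and A = A and \<kappa> = \<kappa>])
      show "continuous_on UNIV (restrict_real F)" by (rule entire_restrict_continuous[OF F])
      show "continuous_on UNIV (Q n)" if "n > 0" for n by (rule polys_continuous[OF Q(3)[OF that]])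
      show "cmod (restrict_real F x - Q n x) \<le> A * exp (- \<kappa> * real n)" if "n > 0" "body_norm x \<le> real n" for n x
        unfolding restrict_real_def by (rule Q(4)[OF that])
      show "Lp_norm p UNIV (restrict_real F) < ennreal (u k)" unfolding r(1) u_def using r(2) by (simp add: ennreal_less_iff)
      show "0 \<le> u k" using r(2) by (simp add: u_def)
    qed (use Q in auto)
    have rc: "real_conv g F"
      unfolding real_conv_def
    proof (intro conjI allI ge F)
      fix R
      obtain D n0 where D: "\<And>n f M z. n \<ge> n0 \<Longrightarrow> cpoly_fun n f \<Longrightarrow> restrict_real f \<in> polys n \<Longrightarrow>
        Lp_norm p {x. body_norm x \<le> real n} (restrict_real f) \<le> ennreal M \<Longrightarrow> 0 \<le> M \<Longrightarrow> norm z \<le> R \<Longrightarrow> cmod (f z) \<le> D * M"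
        using polynomial_local_bound[OF p, of R] by blast
      have "\<forall>\<^sub>F n in sequentially. \<forall>z. norm z \<le> R \<longrightarrow> cmod (g n z) \<le> D * u 0"
        using ev[of 0] eventually_ge_at_top[of n0] eventually_gt_at_top[of 0]
      proof eventually_elim
        case (elim n)
        have "0 \<le> u 0" using r(2) by (simp add: u_def)
        then show ?case using D[OF elim(2) g(1)[OF elim(3)], of "u 0"] elim(1) Q(3)[OF elim(3)] unfolding g(2)[OF elim(3)] by blast
      qed
      then show "\<exists>C. \<forall>\<^sub>F n in sequentially. \<forall>z. norm z \<le> R \<longrightarrow> cmod (g n z) \<le> C" ..
    next
      fix x
      obtain n1 :: nat where n1: "body_norm x \<le> real n1" using real_arch_simple by blast
      have "(\<lambda>n. A * exp (- \<kappa> * real n)) \<longlonglongrightarrow> A * 0" using Q(2) by (intro tendsto_mult tendsto_const) real_asymp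
      then have "(\<lambda>n. A * exp (- \<kappa> * real n)) \<longlonglongrightarrow> 0" by simp
      moreover have "\<forall>\<^sub>F n in sequentially. cmod (g n (cvec x) - F (cvec x)) \<le> A * exp (- \<kappa> * real n)"
        using eventually_ge_at_top[of n1] eventually_gt_at_top[of 0]
      proof eventually_elim
        case (elim n)
        have "body_norm x \<le> real n" using n1 elim(1) by linarith
        from Q(4)[OF elim(2) this] show ?case unfolding g(2)[OF elim(2)] restrict_real_def by (simp add: norm_minus_commute)
      qed
      ultimately have "(\<lambda>n. g n (cvec x) - F (cvec x)) \<longlonglongrightarrow> 0" by (rule Lim_null_comparison[rotated])
      then show "(\<lambda>n. g n (cvec x)) \<longlonglongrightarrow> F (cvec x)" by (simp add: LIM_zero_iff)
    qed
    define d where "d = \<tau> ^ N * cmod (diff_op N b (restrict_real f) x0)"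
    have "diff_op N b (restrict_real F) 0 = 1 * of_real \<tau> ^ N * diff_op N b (restrict_real f) (x0 + \<tau> *\<^sub>R 0)"
      unfolding F_def[abs_def] by (rule diff_op_affine[OF ent])
    then have d: "cmod (diff_op N b (restrict_real F) 0) = d"
      using \<tau> by (simp add: d_def norm_mult norm_power)
    have dlim: "(\<lambda>n. ennreal (cmod (diff_op N b (restrict_real (g n)) 0))) \<longlonglongrightarrow> ennreal d"
      unfolding d[symmetric] by (intro tendsto_ennrealI tendsto_norm real_conv_diff_op rc)
    \<comment> \<open>Along a subsequence realising the limit inferior the constants converge, while
      the derivatives keep their limit \<open>d\<close>.\<close>
    obtain \<rho> where \<rho>: "strict_mono \<rho>" "((\<lambda>n. M_const p N b n V) \<circ> \<rho>) \<longlonglongrightarrow> liminf (\<lambda>n. M_const p N b n V)"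
      using liminf_subseq_lim by blast
    obtain D n0 where Dn: "n0 > 0" "\<And>n Q M. n \<ge> n0 \<Longrightarrow> Q \<in> polys n \<Longrightarrow> Lp_norm p {x. body_norm x \<le> real n} Q \<le> ennreal M \<Longrightarrow> 0 \<le> M \<Longrightarrow>
       ennreal (cmod (diff_op N b Q 0)) \<le> M_const p N b n V * ennreal M"
      using M_const_bounds[OF p, of N b] by metis
    have du: "d \<le> l * u k" for k
    proof -
      have uk: "0 \<le> u k" using r(2) by (simp add: u_def)
      have "\<forall>\<^sub>F n in sequentially. ennreal (cmod (diff_op N b (restrict_real (g n)) 0)) \<le> ennreal (u k) * M_const p N b n V"
        using ev[of k] eventually_ge_at_top[of n0]
      proof eventually_elim
        case (elim n)
        then have n: "n > 0" using Dn(1) by simp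
        show ?case using Dn(2)[OF elim(2) Q(3)[OF n] elim(1) uk] unfolding g(2)[OF n] by (simp add: mult.commute)
      qed
      then have "\<forall>\<^sub>F n in sequentially. ennreal (cmod (diff_op N b (restrict_real (g (\<rho> n))) 0)) \<le> ennreal (u k) * M_const p N b (\<rho> n) V"
        using filterlim_subseq[OF \<rho>(1)] unfolding filterlim_iff by blast
      moreover have "(\<lambda>n. ennreal (cmod (diff_op N b (restrict_real (g (\<rho> n))) 0))) \<longlonglongrightarrow> ennreal d"
        using LIMSEQ_subseq_LIMSEQ[OF dlim \<rho>(1)] by (simp add: o_def)
      moreover have "(\<lambda>n. ennreal (u k) * M_const p N b (\<rho> n) V) \<longlonglongrightarrow> ennreal (u k) * ennreal l"
        using \<rho>(2) unfolding L(1) o_def by (intro ennreal_tendsto_cmult) auto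
      ultimately have "ennreal d \<le> ennreal (u k) * ennreal l" by (intro tendsto_le[OF sequentially_bot])
      then have "ennreal d \<le> ennreal (u k * l)" using uk L(2) by (simp add: ennreal_mult)
      then show ?thesis using uk L(2) by (simp add: mult.commute)
    qed
    have "(\<lambda>k. l * u k) \<longlonglongrightarrow> l * (r + 0)" unfolding u_def by (intro tendsto_mult tendsto_const tendsto_add) real_asymp
    then have "d \<le> l * (r + 0)" by (rule LIMSEQ_le_const) (use du in blast)
    then have "d * \<tau> powr e \<le> l * r * \<tau> powr e" using te by (intro mult_right_mono) auto
    then show ?thesis unfolding d_def sr by (simp add: mult_ac)
  qed
  \<comment> \<open>Dilation factors tending to 1 from below.\<close>
  define t where "t k = 1 - 1 / real (k + 2)" for k
  have t: "0 < t k" "t k < 1" for k by (auto simp: t_def)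
  have tlim: "t \<longlonglongrightarrow> 1" unfolding t_def[abs_def] by real_asymp
  have "(\<lambda>k. t k ^ N * cmod (diff_op N b (restrict_real f) x0) * t k powr e) \<longlonglongrightarrow>
      1 ^ N * cmod (diff_op N b (restrict_real f) x0) * 1 powr e"
    by (intro tendsto_mult tendsto_power tendsto_const tendsto_powr tlim) simp
  then have "1 ^ N * cmod (diff_op N b (restrict_real f) x0) * 1 powr e \<le> l * s"
    by (rule LIMSEQ_le_const2) (use main[OF t] in blast)
  then show ?thesis by simp
qed

text \<open>Fatou's lemma gives only norm at most 1, since mass may escape to infinity. For a
  positive limit of the constants, norm exactly 1 is recovered in
  \<open>sharp_ratio_attained\<close>.\<close>

lemma extremal_exists:
  assumes p: "0 < p" and L: "limsup (\<lambda>n. M_const p N b n V) = ennreal l" "0 \<le> l"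
  obtains f where "f \<in> exp_type V" "Lp_norm p UNIV (restrict_real f) \<le> ennreal 1"
    "cmod (diff_op N b (restrict_real f) 0) = l"
proof -
  define a where "a n = enn2real (M_const p N b n V)" for n
  obtain C n0 where C: "C > 0" "n0 > 0" "\<And>n. n \<ge> n0 \<Longrightarrow> M_const p N b n V \<le> ennreal C"
    "\<And>n Q M. n \<ge> n0 \<Longrightarrow> Q \<in> polys n \<Longrightarrow> Lp_norm p {x. body_norm x \<le> real n} Q \<le> ennreal M \<Longrightarrow> 0 \<le> M \<Longrightarrow>
       ennreal (cmod (diff_op N b Q 0)) \<le> M_const p N b n V * ennreal M"
    by (rule M_const_bounds[OF p, of N b]) blast
  have a: "M_const p N b n V = ennreal (a n)" if "n \<ge> n0" for n
    using C(3)[OF that] unfolding a_def by (metis ennreal_enn2real ennreal_less_top le_less_trans)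
  have "\<forall>n. \<exists>Q. n \<ge> n0 \<longrightarrow> (Q \<in> polys n \<and> Lp_norm p {x. body_norm x \<le> real n} Q \<le> ennreal 1 \<and>
    a n - 1 / real (Suc n) \<le> cmod (diff_op N b Q 0) \<and> cmod (diff_op N b Q 0) \<le> a n)"
  proof
    fix n show "\<exists>Q. n \<ge> n0 \<longrightarrow> (Q \<in> polys n \<and> Lp_norm p {x. body_norm x \<le> real n} Q \<le> ennreal 1 \<and>
    a n - 1 / real (Suc n) \<le> cmod (diff_op N b Q 0) \<and> cmod (diff_op N b Q 0) \<le> a n)"
    proof (cases "n \<ge> n0")
      case True
      have "n > 0" using True C(2) by simp
      then obtain Q where "Q \<in> polys n" "Lp_norm p {x. body_norm x \<le> real n} Q \<le> ennreal 1"
        "a n - 1 / real (Suc n) \<le> cmod (diff_op N b Q 0)" "cmod (diff_op N b Q 0) \<le> a n"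
        by (rule near_extremal_polynomial[OF p _ a[OF True], of "1 / real (Suc n)"]) (use C(4)[OF True] in \<open>auto simp: a_def\<close>)
      then show ?thesis by blast
    qed simp
  qed
  from choice[OF this] obtain Q where Q: "\<And>n. n \<ge> n0 \<Longrightarrow> Q n \<in> polys n"
    "\<And>n. n \<ge> n0 \<Longrightarrow> Lp_norm p {x. body_norm x \<le> real n} (Q n) \<le> ennreal 1"
    "\<And>n. n \<ge> n0 \<Longrightarrow> a n - 1 / real (Suc n) \<le> cmod (diff_op N b (Q n) 0)"
    "\<And>n. n \<ge> n0 \<Longrightarrow> cmod (diff_op N b (Q n) 0) \<le> a n" by blast
  have "\<forall>n. \<exists>g. n \<ge> n0 \<longrightarrow> cpoly_fun n g \<and> Q n = restrict_real g" using polys_complexify[OF Q(1)] by metis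
  from choice[OF this] obtain g where g: "\<And>n. n \<ge> n0 \<Longrightarrow> cpoly_fun n (g n)" "\<And>n. n \<ge> n0 \<Longrightarrow> Q n = restrict_real (g n)" by blast
  obtain \<rho> where \<rho>: "strict_mono \<rho>" "((\<lambda>n. M_const p N b n V) \<circ> \<rho>) \<longlonglongrightarrow> limsup (\<lambda>n. M_const p N b n V)"
    using limsup_subseq_lim by blast
  \<comment> \<open>The shift places every index in the range where the constants are finite and
    near-extremal polynomials have been chosen.\<close>
  define \<nu> where "\<nu> j = \<rho> (j + n0)" for j
  have \<nu>: "strict_mono \<nu>" using \<rho>(1) by (auto simp: \<nu>_def strict_mono_def)
  have \<nu>n0: "\<nu> j \<ge> n0" for j using seq_suble[OF \<rho>(1), of "j + n0"] by (simp add: \<nu>_def)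
  have alim: "(\<lambda>j. a (\<nu> j)) \<longlonglongrightarrow> l"
  proof -
    have "(\<lambda>j. M_const p N b (\<nu> j) V) \<longlonglongrightarrow> ennreal l"
      using LIMSEQ_ignore_initial_segment[OF \<rho>(2), of n0] unfolding L(1) by (simp add: \<nu>_def o_def)
    then have "(\<lambda>j. ennreal (a (\<nu> j))) \<longlonglongrightarrow> ennreal l" unfolding a[OF \<nu>n0] .
    then show ?thesis by (subst (asm) tendsto_ennreal_iff) (auto simp: a_def L(2))
  qed
  define G where "G j = g (\<nu> j)" for j
  have G: "cpoly_fun (\<nu> j) (G j)" "Q (\<nu> j) = restrict_real (G j)" "restrict_real (G j) \<in> polys (\<nu> j)"
    "Lp_norm p {x. body_norm x \<le> real (\<nu> j)} (restrict_real (G j)) \<le> ennreal 1" for j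
    using g[OF \<nu>n0] Q(1,2)[OF \<nu>n0, of j] by (simp_all add: G_def)
  have Ge: "entire (G j)" for j using G(1) by (simp add: cpoly_fun_def)
  obtain k f where k: "strict_mono k" and f: "entire f" and lim: "\<And>z. (\<lambda>n. G (k n) z) \<longlonglongrightarrow> f z"
    and rc: "real_conv (\<lambda>n. G (k n)) f"
  proof (rule montel_entire[OF Ge])
    fix R
    obtain D n1 where D: "\<And>n f M z. n \<ge> n1 \<Longrightarrow> cpoly_fun n f \<Longrightarrow> restrict_real f \<in> polys n \<Longrightarrow>
      Lp_norm p {x. body_norm x \<le> real n} (restrict_real f) \<le> ennreal M \<Longrightarrow> 0 \<le> M \<Longrightarrow> norm z \<le> R \<Longrightarrow> cmod (f z) \<le> D * M"
      using polynomial_local_bound[OF p, of R] by blast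
    have "\<forall>\<^sub>F j in sequentially. \<forall>z. norm z \<le> R \<longrightarrow> cmod (G j z) \<le> D * 1"
      using eventually_ge_at_top[of n1]
    proof eventually_elim
      case (elim j)
      then have "\<nu> j \<ge> n1" using seq_suble[OF \<nu>, of j] by simp
      from D[OF this G(1,3,4)] show ?case by simp
    qed
    then show "\<exists>C. \<forall>\<^sub>F j in sequentially. \<forall>z. norm z \<le> R \<longrightarrow> cmod (G j z) \<le> C" ..
  qed blast
  define \<mu> where "\<mu> j = \<nu> (k j)" for j
  have \<mu>: "strict_mono \<mu>" using strict_mono_o[OF \<nu> k] by (simp add: \<mu>_def[abs_def] o_def)
  have \<mu>real: "filterlim (\<lambda>j. real (\<mu> j)) at_top sequentially"
    by (intro filterlim_compose[OF filterlim_real_sequentially] filterlim_subseq \<mu>)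
  have growth: "\<exists>C. \<forall>z. cmod (f z) \<le> C * exp ((1 + \<epsilon>) * dual_norm V z)" if \<epsilon>: "\<epsilon> > 0" for \<epsilon>
  proof -
    \<comment> \<open>Working in the smaller body multiplies the exponent by 1 / lam, which is
      exactly the admissible 1 + \<epsilon>.\<close>
    define lam where "lam = 1 / (1 + \<epsilon>)"
    have lam: "0 < lam" "lam < 1" using \<epsilon> by (auto simp: lam_def)
    obtain C where C: "C > 0" "\<And>n f M x y T. \<lbrakk>0 < n; cpoly_fun n f; restrict_real f \<in> polys n;
       Lp_norm p {x. body_norm x \<le> real n} (restrict_real f) \<le> ennreal M; 0 \<le> M; 0 < T;
       body_norm x + T * body_norm y \<le> lam * real n\<rbrakk> \<Longrightarrow>
       cmod (f (cvec x + \<i> *s cvec y)) \<le> C * M * exp (real n / T)"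
      by (rule polynomial_growth[OF p lam]) blast
    have "cmod (f z) \<le> (C * exp (1 + \<epsilon>)) * exp ((1 + \<epsilon>) * dual_norm V z)" for z
    proof -
      define x y where "x = (\<chi> j. Re (z $ j))" and "y = (\<chi> j. Im (z $ j))"
      have z': "z = cvec x + \<i> *s cvec y" unfolding x_def y_def by (rule cvec_Re_Im)
      \<comment> \<open>Nearly the longest admissible segment. The added 1 avoids division by zero
        and costs only the constant factor exp (1 + \<epsilon>).\<close>
      define T where "T t = (lam * t - body_norm x) / (body_norm y + 1)" for t
      have y1: "body_norm y + 1 > 0" using body_norm_nonneg[of y] by linarith
      have "\<forall>\<^sub>F j in sequentially. cmod (G (k j) z) \<le> C * 1 * exp (real (\<mu> j) / T (real (\<mu> j)))"
      proof -
        have "\<forall>\<^sub>F j in sequentially. real (\<mu> j) > body_norm x / lam"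
          using \<mu>real by (simp add: filterlim_at_top_dense)
        then show ?thesis
        proof eventually_elim
          case (elim j)
          have Tp: "T (real (\<mu> j)) > 0" using elim lam y1 by (simp add: T_def field_simps)
          have "T (real (\<mu> j)) * body_norm y \<le> T (real (\<mu> j)) * (body_norm y + 1)" using Tp by simp
          also have "\<dots> = lam * real (\<mu> j) - body_norm x" using y1 by (simp add: T_def)
          finally have le: "body_norm x + T (real (\<mu> j)) * body_norm y \<le> lam * real (\<mu> j)" by simp
          have "0 < \<mu> j" using \<nu>n0[of "k j"] C(1) \<open>n0 > 0\<close> by (simp add: \<mu>_def)
          then show ?case unfolding z' using G[of "k j"] Tp le
            by (intro C(2)) (auto simp: \<mu>_def)
        qed
      qed
      moreover have "(\<lambda>j. C * 1 * exp (real (\<mu> j) / T (real (\<mu> j)))) \<longlonglongrightarrow> C * 1 * exp ((body_norm y + 1) / lam)"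
      proof -
        have "((\<lambda>t. t / T t) \<longlongrightarrow> inverse lam * (body_norm y + 1)) at_top"
          unfolding T_def using lam(1) y1 by real_asymp
        then have "((\<lambda>t. t / T t) \<longlongrightarrow> (body_norm y + 1) / lam) at_top"
          by (simp only: divide_inverse mult.commute)
        from filterlim_compose[OF this \<mu>real] show ?thesis by (intro tendsto_mult tendsto_const tendsto_exp)
      qed
      ultimately have "cmod (f z) \<le> C * 1 * exp ((body_norm y + 1) / lam)"
        by (intro tendsto_le[OF sequentially_bot _ tendsto_norm[OF lim[of z]]])
      also have "(body_norm y + 1) / lam = (1 + \<epsilon>) + (1 + \<epsilon>) * body_norm y" by (simp add: lam_def algebra_simps)
      also have "C * 1 * exp ((1 + \<epsilon>) + (1 + \<epsilon>) * body_norm y) \<le> C * 1 * exp ((1 + \<epsilon>) + (1 + \<epsilon>) * dual_norm V z)"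
        using body_norm_le_dual_norm(2)[of y x] C(1) \<epsilon> unfolding z'[symmetric] by simp
      finally show ?thesis by (simp add: exp_add mult.assoc)
    qed
    then show ?thesis by blast
  qed
  have "f \<in> exp_type V" unfolding exp_type_def using f growth by blast
  moreover have "Lp_norm p UNIV (restrict_real f) \<le> ennreal 1"
  proof -
    have inK: "\<forall>\<^sub>F j in sequentially. body_norm x \<le> real (\<mu> j)" for x
      using \<mu>real by (simp add: filterlim_at_top)
    have rlim: "(\<lambda>j. restrict_real (G (k j)) x) \<longlonglongrightarrow> restrict_real f x" for x
      unfolding restrict_real_def by (rule lim)
    have \<mu>pos: "0 < real (\<mu> j)" for j using \<nu>n0[of "k j"] \<open>n0 > 0\<close> by (simp add: \<mu>_def)
    show ?thesis
    proof (cases "p = \<infinity>")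
      case True
      have le1: "cmod (restrict_real f x) \<le> 1" for x
      proof (rule tendsto_le[OF sequentially_bot tendsto_const tendsto_norm[OF rlim]])
        show "\<forall>\<^sub>F j in sequentially. norm (restrict_real (G (k j)) x) \<le> 1"
          using inK[of x]
        proof eventually_elim
          case (elim j)
          have "\<forall>x\<in>{x. body_norm x \<le> real (\<mu> j)}. ennreal (cmod (restrict_real (G (k j)) x)) \<le> ennreal 1"
            using G(4)[of "k j"] unfolding True \<mu>_def[symmetric]
            by (intro iffD1[OF Lp_norm_infinity_le_iff[OF entire_restrict_continuous[OF Ge] sets_body body_regular[OF \<mu>pos]]])
          then show ?case using elim by simp
        qed
      qed
      then show ?thesis unfolding True
        by (intro iffD2[OF Lp_norm_infinity_le_iff[OF entire_restrict_continuous[OF f]]]) (auto intro: ennreal_leI)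
    next
      case False
      define q where "q = enn2real p"
      have q: "0 < q" unfolding q_def by (rule enn2real_pos[OF p False])
      \<comment> \<open>The bodies exhaust \<real>^m, so at each point the indicator is eventually 1
        and Fatou's lemma yields the integral over the whole space.\<close>
      define I where "I j x = ennreal (cmod (restrict_real (G (k j)) x) powr q) * indicator {x. body_norm x \<le> real (\<mu> j)} x" for j x
      have Im: "I j \<in> borel_measurable lborel" for j
      proof -
        have "restrict_real (G (k j)) \<in> borel_measurable borel" by (rule entire_borel_measurable[OF Ge])
        then have "(\<lambda>x. cmod (restrict_real (G (k j)) x) powr q) \<in> borel_measurable borel" by measurable
        moreover have "{x. body_norm x \<le> real (\<mu> j)} \<in> sets lborel" using sets_body by simp
        ultimately show ?thesis unfolding I_def[abs_def] by (intro borel_measurable_times_ennreal borel_measurable_indicator) auto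
      qed
      have I1: "(\<integral>\<^sup>+x. I j x \<partial>lborel) \<le> 1" for j
      proof -
        have le: "ennreal_powr (Lp_integral q {x. body_norm x \<le> real (\<mu> j)} (restrict_real (G (k j)))) (1 / q) \<le> ennreal 1"
          using G(4)[of "k j"] unfolding Lp_norm_finite[OF False sets_body] q_def \<mu>_def .
        define J where "J = Lp_integral q {x. body_norm x \<le> real (\<mu> j)} (restrict_real (G (k j)))"
        have "J \<noteq> \<infinity>" using le unfolding J_def[symmetric] by (auto simp: ennreal_powr_def top_unique)
        then obtain i where i: "J = ennreal i" "0 \<le> i" by (cases J) auto
        have "i powr (1 / q) \<le> 1" using le i unfolding J_def[symmetric] by (simp add: ennreal_powr_ennreal)
        then have "(i powr (1 / q)) powr q \<le> 1 powr q" using q by (intro powr_mono2) auto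
        then have "J \<le> 1" using i q by (simp add: powr_powr)
        then show ?thesis unfolding J_def Lp_integral_def I_def .
      qed
      have "(\<lambda>j. I j x) \<longlonglongrightarrow> ennreal (cmod (restrict_real f x) powr q)" for x
      proof -
        have "(\<lambda>j. ennreal (cmod (restrict_real (G (k j)) x) powr q)) \<longlonglongrightarrow> ennreal (cmod (restrict_real f x) powr q)"
          using q by (intro tendsto_ennrealI tendsto_powr' tendsto_norm rlim tendsto_const) auto
        moreover have "\<forall>\<^sub>F j in sequentially. ennreal (cmod (restrict_real (G (k j)) x) powr q) = I j x"
          using inK[of x] by eventually_elim (simp add: I_def)
        ultimately show ?thesis by (rule Lim_transform_eventually)
      qed
      then have "ennreal (cmod (restrict_real f x) powr q) = liminf (\<lambda>j. I j x)" for x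
        by (intro lim_imp_Liminf[OF sequentially_bot, symmetric])
      then have "Lp_integral q UNIV (restrict_real f) = (\<integral>\<^sup>+x. liminf (\<lambda>j. I j x) \<partial>lborel)"
        unfolding Lp_integral_def by simp
      also have "\<dots> \<le> liminf (\<lambda>j. \<integral>\<^sup>+x. I j x \<partial>lborel)" by (rule nn_integral_liminf[OF Im])
      also have "\<dots> \<le> 1" by (rule Liminf_le[OF sequentially_bot], rule always_eventually, rule allI, rule I1)
      finally show ?thesis unfolding q_def by (intro Lp_norm_finite_leI[OF p False]) auto
    qed
  qed
  moreover have "cmod (diff_op N b (restrict_real f) 0) = l"
  proof (rule LIMSEQ_unique)
    show "(\<lambda>j. cmod (diff_op N b (restrict_real (G (k j))) 0)) \<longlonglongrightarrow> cmod (diff_op N b (restrict_real f) 0)"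
      by (intro tendsto_norm real_conv_diff_op rc)
    have al: "(\<lambda>j. a (\<mu> j)) \<longlonglongrightarrow> l" using LIMSEQ_subseq_LIMSEQ[OF alim k] by (simp add: \<mu>_def o_def)
    have "(\<lambda>j. 1 / real (Suc (\<mu> j))) \<longlonglongrightarrow> 0"
    proof -
      have "((\<lambda>t::real. 1 / (t + 1)) \<longlongrightarrow> 0) at_top" by real_asymp
      from filterlim_compose[OF this \<mu>real] show ?thesis by (simp add: add.commute)
    qed
    from tendsto_diff[OF al this] have low: "(\<lambda>j. a (\<mu> j) - 1 / real (Suc (\<mu> j))) \<longlonglongrightarrow> l" by simp
    show "(\<lambda>j. cmod (diff_op N b (restrict_real (G (k j))) 0)) \<longlonglongrightarrow> l"
    proof (rule tendsto_sandwich[OF always_eventually always_eventually low al])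
      show "\<forall>j. a (\<mu> j) - 1 / real (Suc (\<mu> j)) \<le> cmod (diff_op N b (restrict_real (G (k j))) 0)"
        using Q(3)[OF \<nu>n0] unfolding G(2)[symmetric] \<mu>_def by blast
      show "\<forall>j. cmod (diff_op N b (restrict_real (G (k j))) 0) \<le> a (\<mu> j)"
        using Q(4)[OF \<nu>n0] unfolding G(2)[symmetric] \<mu>_def by blast
    qed
  qed
  ultimately show thesis by (rule that)
qed

end

section \<open>A nontrivial function of type \<open>V\<close> in L_p\<close>

lemma one_plus_sum_le_prod:
  fixes a :: "'i \<Rightarrow> real"
  assumes "\<And>i. i \<in> I \<Longrightarrow> 0 \<le> a i"
  shows "1 + (\<Sum>i\<in>I. a i) \<le> (\<Prod>i\<in>I. 1 + a i)"
  using assms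
proof (induction I rule: infinite_finite_induct)
  case (insert i I)
  have s: "0 \<le> (\<Sum>i\<in>I. a i)" by (rule sum_nonneg) (simp add: insert.prems)
  have i: "0 \<le> a i" by (simp add: insert.prems)
  have "1 + (a i + (\<Sum>i\<in>I. a i)) \<le> (1 + a i) * (1 + (\<Sum>i\<in>I. a i))"
    using mult_nonneg_nonneg[OF i s] by (simp add: algebra_simps)
  also have "\<dots> \<le> (1 + a i) * (\<Prod>i\<in>I. 1 + a i)"
    using i by (intro mult_left_mono insert.IH) (auto simp: insert.prems)
  finally show ?case using insert.hyps by simp
qed auto

text \<open>The integrand is dominated by a series of weighted indicators of balls, where x is
  covered by the index i = floor (\<delta> |x|). The ball of radius (i + 1) / \<delta> has volume of
  order (i + 1)^m, so the exponent m + 2 leaves a sum of inverse squares.\<close>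

lemma Lp_integral_decay:
  fixes F :: "real^'m::finite \<Rightarrow> complex"
  assumes q: "0 < q" and \<delta>: "0 < \<delta>" and C: "0 \<le> C" and a: "real CARD('m) + 2 \<le> a * q"
    and F: "\<And>x. cmod (F x) \<le> C * (1 + \<delta> * norm x) powr - a"
  shows "Lp_integral q UNIV F < \<infinity>"
proof -
  define m where "m = CARD('m)"
  define g where "g i x = ennreal (C powr q * real (Suc i) powr - (real m + 2)) * indicator (cball 0 (real (Suc i) / \<delta>)) x"
    for i and x :: "real^'m"
  have pt: "ennreal (cmod (F x) powr q) \<le> (\<Sum>i. g i x)" for x
  proof -
    define i where "i = nat \<lfloor>\<delta> * norm x\<rfloor>"
    have nn: "0 \<le> \<delta> * norm x" using \<delta> by simp
    then have i: "real i \<le> \<delta> * norm x" "\<delta> * norm x \<le> real (Suc i)" unfolding i_def by linarith+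
    have "cmod (F x) powr q \<le> (C * (1 + \<delta> * norm x) powr - a) powr q"
      using q by (intro powr_mono2 F) auto
    also have "\<dots> = C powr q * (1 + \<delta> * norm x) powr - (a * q)"
      using C nn by (simp add: powr_mult powr_powr)
    also have "\<dots> \<le> C powr q * (1 + \<delta> * norm x) powr - (real m + 2)"
      using nn a by (intro mult_left_mono powr_mono) (auto simp: m_def)
    also have "\<dots> \<le> C powr q * real (Suc i) powr - (real m + 2)"
      using i by (intro mult_left_mono powr_mono2') auto
    finally have "ennreal (cmod (F x) powr q) \<le> ennreal (C powr q * real (Suc i) powr - (real m + 2))"
      by (rule ennreal_leI)
    also have "\<dots> = g i x"
    proof -
      have "x \<in> cball 0 (real (Suc i) / \<delta>)" using i(2) \<delta> by (simp add: field_simps)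
      then show ?thesis unfolding g_def by simp
    qed
    also have "g i x \<le> (\<Sum>i. g i x)"
      using sum_le_suminf[of "\<lambda>i. g i x" "{i}"] by simp
    finally show ?thesis .
  qed
  have gm: "g i \<in> borel_measurable lborel" for i
    unfolding g_def[abs_def] by (intro borel_measurable_times_ennreal borel_measurable_const borel_measurable_indicator) simp
  have gi: "(\<integral>\<^sup>+x. g i x \<partial>lborel) = ennreal (C powr q * unit_ball_vol (real m) / \<delta> ^ m * (1 / real (Suc i) ^ 2))" for i
  proof -
    have "(\<integral>\<^sup>+x. g i x \<partial>lborel) = ennreal (C powr q * real (Suc i) powr - (real m + 2)) *
        emeasure lborel (cball (0 :: real^'m) (real (Suc i) / \<delta>))"
      unfolding g_def by (subst nn_integral_cmult_indicator) auto
    also have "emeasure lborel (cball (0 :: real^'m) (real (Suc i) / \<delta>)) = ennreal (unit_ball_vol (real m) * (real (Suc i) / \<delta>) ^ m)"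
      using \<delta> by (subst emeasure_cball) (auto simp: m_def)
    also have "ennreal (C powr q * real (Suc i) powr - (real m + 2)) * ennreal (unit_ball_vol (real m) * (real (Suc i) / \<delta>) ^ m)
        = ennreal (C powr q * real (Suc i) powr - (real m + 2) * (unit_ball_vol (real m) * (real (Suc i) / \<delta>) ^ m))"
      using \<delta> by (intro ennreal_mult[symmetric]) auto
    also have "C powr q * real (Suc i) powr - (real m + 2) * (unit_ball_vol (real m) * (real (Suc i) / \<delta>) ^ m)
        = C powr q * unit_ball_vol (real m) / \<delta> ^ m * (1 / real (Suc i) ^ 2)"
    proof -
      have t: "real (Suc i) > 0" by simp
      have "real (Suc i) powr (real m + 2) = real (Suc i) ^ m * real (Suc i) ^ 2"
        using powr_realpow[OF t, of "m + 2"] unfolding power_add by (simp only: of_nat_add of_nat_numeral)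
      then have "real (Suc i) powr - (real m + 2) = 1 / (real (Suc i) ^ m * real (Suc i) ^ 2)"
        by (simp only: powr_minus inverse_eq_divide)
      moreover have "c * (1 / (T * s)) * (u * (T / d)) = c * u / d * (1 / s)" if "T \<noteq> 0" for c T s u d :: real
        using that by simp
      ultimately show ?thesis unfolding power_divide using t by simp
    qed
    finally show ?thesis .
  qed
  have "Lp_integral q UNIV F \<le> (\<integral>\<^sup>+x. (\<Sum>i. g i x) \<partial>lborel)"
    unfolding Lp_integral_def by (intro nn_integral_mono) (simp add: pt)
  also have "\<dots> = (\<Sum>i. \<integral>\<^sup>+x. g i x \<partial>lborel)" by (rule nn_integral_suminf[OF gm])
  also have "\<dots> = (\<Sum>i. ennreal (C powr q * unit_ball_vol (real m) / \<delta> ^ m * (1 / real (Suc i) ^ 2)))"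
    unfolding gi ..
  also have "\<dots> < \<infinity>"
  proof -
    have "summable (\<lambda>n. inverse (real n ^ 2))" by (rule inverse_power_summable) simp
    then have "summable (\<lambda>n. inverse (real (Suc n) ^ 2))"
      by (rule iffD2[OF summable_Suc_iff[of "\<lambda>n. inverse (real n ^ 2)"]])
    then have "summable (\<lambda>n. 1 / real (Suc n) ^ 2)" unfolding inverse_eq_divide .
    then have "summable (\<lambda>i. C powr q * unit_ball_vol (real m) / \<delta> ^ m * (1 / real (Suc i) ^ 2))"
      by (rule summable_mult)
    then have "(\<Sum>i. ennreal (C powr q * unit_ball_vol (real m) / \<delta> ^ m * (1 / real (Suc i) ^ 2)))
        = ennreal (\<Sum>i. C powr q * unit_ball_vol (real m) / \<delta> ^ m * (1 / real (Suc i) ^ 2))"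
      using \<delta> by (intro suminf_ennreal2) auto
    then show ?thesis by simp
  qed
  finally show ?thesis .
qed

definition csinc :: "complex \<Rightarrow> complex" where
  "csinc z = (if z = 0 then 1 else sin z / z)"

lemma csinc_holomorphic: "csinc holomorphic_on UNIV"
proof (rule pole_theorem_open_0)
  show "sin holomorphic_on (UNIV :: complex set)" by (intro holomorphic_intros)
  have "deriv sin (0::complex) = 1" by (intro DERIV_imp_deriv) (auto intro!: derivative_eq_intros)
  then show "csinc 0 = deriv sin 0" by (simp add: csinc_def)
qed (auto simp: csinc_def)

lemma csinc_bounds:
  obtains C where "C \<ge> 1" "\<And>z. cmod (csinc z) \<le> C * exp \<bar>Im z\<bar>" "\<And>x. cmod (csinc (of_real x)) \<le> C / (1 + \<bar>x\<bar>)"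
proof -
  have "compact (csinc ` cball 0 1)"
    by (intro compact_continuous_image holomorphic_on_imp_continuous_on holomorphic_on_subset[OF csinc_holomorphic]) auto
  from compact_imp_bounded[OF this] obtain B where B': "\<forall>w\<in>csinc ` cball 0 1. cmod w \<le> B"
    unfolding bounded_iff by (rule exE)
  have B: "cmod (csinc z) \<le> B" if "z \<in> cball 0 1" for z using that by (rule bspec[OF B' imageI])
  \<comment> \<open>\<open>2 * B\<close> serves the unit disc and 2 serves real arguments of modulus
    greater than 1, where 1 / |x| \<le> 2 / (1 + |x|).\<close>
  define C where "C = max 2 (2 * B)"
  have B0: "0 \<le> B" using order_trans[OF norm_ge_zero B[of 0]] by simp
  show thesis
  proof
    show "C \<ge> 1" by (simp add: C_def)
    fix z
    show "cmod (csinc z) \<le> C * exp \<bar>Im z\<bar>"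
    proof (cases "cmod z \<le> 1")
      case True
      then have "cmod (csinc z) \<le> B" by (intro B) simp
      also have "B \<le> C * 1" using B0 by (simp add: C_def)
      also have "\<dots> \<le> C * exp \<bar>Im z\<bar>" by (intro mult_left_mono) (auto simp: C_def)
      finally show ?thesis .
    next
      case False
      then have "cmod (csinc z) = cmod (sin z) / cmod z" by (auto simp: csinc_def norm_divide)
      also have "\<dots> \<le> cmod (sin z) / 1" using False by (intro divide_left_mono) auto
      also have "\<dots> \<le> 1 * exp \<bar>Im z\<bar>" using cmod_sin_le_exp[of 1 z] by simp
      also have "\<dots> \<le> C * exp \<bar>Im z\<bar>" by (intro mult_right_mono) (auto simp: C_def)
      finally show ?thesis .
    qed
  next
    fix x :: real
    show "cmod (csinc (of_real x)) \<le> C / (1 + \<bar>x\<bar>)"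
    proof (cases "\<bar>x\<bar> \<le> 1")
      case True
      then have "cmod (csinc (of_real x)) \<le> B" by (intro B) simp
      also have "B \<le> C / 2" by (simp add: C_def)
      also have "\<dots> \<le> C / (1 + \<bar>x\<bar>)" using True by (intro divide_left_mono) (auto simp: C_def)
      finally show ?thesis .
    next
      case False
      then have "cmod (csinc (of_real x)) = \<bar>sin x\<bar> / \<bar>x\<bar>"
        by (auto simp: csinc_def norm_divide sin_of_real)
      also have "\<dots> \<le> 1 / \<bar>x\<bar>" by (intro divide_right_mono) auto
      also have "\<dots> = 2 / (2 * \<bar>x\<bar>)" by simp
      also have "\<dots> \<le> 2 / (1 + \<bar>x\<bar>)" using False by (intro divide_left_mono mult_pos_pos) auto
      also have "\<dots> \<le> C / (1 + \<bar>x\<bar>)" by (intro divide_right_mono) (auto simp: C_def)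
      finally show ?thesis .
    qed
  qed
qed

context symmetric_body
begin

text \<open>For finite p a product of dilated sinc functions is raised to a power k > (m + 2) / p,
  which gives the decay required by \<open>Lp_integral_decay\<close>. The function is used when the
  constants tend to 0 and the extremal limit may vanish.\<close>

lemma exp_type_Lp_nontrivial:
  assumes p: "0 < p"
  obtains f where "f \<in> exp_type V" "restrict_real f \<in> Lp_space p UNIV" "f \<noteq> (\<lambda>_. 0)"
proof (cases "p = \<infinity>")
  case True
  define f :: "complex^'m::{finite,linorder} \<Rightarrow> complex" where "f = (\<lambda>_. 1)"
  show thesis
  proof
    have "\<exists>C. \<forall>z. cmod (f z) \<le> C * exp ((1 + \<epsilon>) * dual_norm V z)" if "\<epsilon> > 0" for \<epsilon> :: real
      using that dual_norm_nonneg by (intro exI[of _ 1]) (simp add: f_def)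
    moreover have e: "entire f" unfolding f_def by (rule entire_const)
    ultimately show "f \<in> exp_type V" by (simp add: exp_type_def)
    have c: "continuous_on UNIV (restrict_real f)" by (rule entire_restrict_continuous[OF e])
    have "Lp_norm \<infinity> UNIV (restrict_real f) \<le> 1"
      by (subst Lp_norm_infinity_le_iff[OF c]) (auto simp: f_def restrict_real_def)
    then have "Lp_norm \<infinity> UNIV (restrict_real f) < \<infinity>" using le_less_trans[OF _ ennreal_one_less_top] by auto
    then show "restrict_real f \<in> Lp_space p UNIV"
      unfolding Lp_space_def True using continuous_Lp_measurable[OF c] by simp
    show "f \<noteq> (\<lambda>_. 0)" by (auto simp: f_def fun_eq_iff)
  qed
next
  case False
  define q where "q = enn2real p"
  have q: "q > 0" unfolding q_def by (rule enn2real_pos[OF p False])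
  obtain C where C: "C \<ge> 1" "\<And>z. cmod (csinc z) \<le> C * exp \<bar>Im z\<bar>" "\<And>x. cmod (csinc (of_real x)) \<le> C / (1 + \<bar>x\<bar>)"
    using csinc_bounds by blast
  obtain r r2 where r: "r > 0" "r2 > 0" "\<And>x. r * norm x \<le> body_norm x" "\<And>x. body_norm x \<le> r2 * norm x"
    using body_norm_equiv_norm by blast
  obtain k :: nat where k: "(real CARD('m) + 2) / q < real k" using reals_Archimedean2 by blast
  have k0: "k > 0" using k q by (cases k) (auto simp: field_simps)
  \<comment> \<open>The k m sinc factors have total growth exponent k m \<delta> |Im z| = r |Im z|,
    which is at most the dual norm because \<open>V\<close> contains a ball.\<close>
  define \<delta> where "\<delta> = r / (real k * real CARD('m))"
  have \<delta>: "\<delta> > 0" using r(1) k0 by (simp add: \<delta>_def)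
  define f :: "complex^'m::{finite,linorder} \<Rightarrow> complex" where "f z = (\<Prod>j\<in>UNIV. csinc (of_real \<delta> * z $ j)) ^ k" for z
  have ent: "entire f"
    unfolding f_def[abs_def]
    by (intro entire_power entire_prod entire_compose_holomorphic[OF _ csinc_holomorphic] entire_cmult entire_nth)
  define D where "D = (C ^ CARD('m)) ^ k"
  have D: "D > 0" using C(1) by (simp add: D_def)
  have growth: "cmod (f z) \<le> D * exp (dual_norm V z)" for z
  proof -
    define y where "y = (\<chi> j. Im (z $ j))"
    have "r * norm y \<le> body_norm y" by (rule r(3))
    also have "\<dots> \<le> dual_norm V z" using body_norm_le_dual_norm(2)[of y "\<chi> j. Re (z $ j)"]
      unfolding y_def cvec_Re_Im[of z, symmetric] .
    finally have ry: "r * norm y \<le> dual_norm V z" .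
    have "cmod (csinc (of_real \<delta> * z $ j)) \<le> C * exp (\<delta> * norm y)" for j
    proof -
      have "\<bar>Im (of_real \<delta> * z $ j)\<bar> = \<delta> * \<bar>y $ j\<bar>" using \<delta> by (simp add: y_def abs_mult)
      also have "\<dots> \<le> \<delta> * norm y" using \<delta> by (intro mult_left_mono component_le_norm_cart) auto
      finally have "C * exp \<bar>Im (of_real \<delta> * z $ j)\<bar> \<le> C * exp (\<delta> * norm y)" using C(1) by simp
      then show ?thesis by (rule order_trans[OF C(2)])
    qed
    then have "(\<Prod>j\<in>UNIV. cmod (csinc (of_real \<delta> * z $ j))) \<le> (\<Prod>j\<in>(UNIV::'m set). C * exp (\<delta> * norm y))"
      by (intro prod_mono) auto
    also have "\<dots> = (C * exp (\<delta> * norm y)) ^ CARD('m)" by simp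
    finally have "cmod (f z) \<le> ((C * exp (\<delta> * norm y)) ^ CARD('m)) ^ k"
      unfolding f_def norm_power prod_norm[symmetric] by (intro power_mono prod_nonneg) auto
    also have "\<dots> = D * exp (real k * (real CARD('m) * (\<delta> * norm y)))"
      unfolding D_def power_mult_distrib exp_of_nat_mult ..
    also have "real k * (real CARD('m) * (\<delta> * norm y)) = r * norm y" using k0 by (simp add: \<delta>_def)
    also have "D * exp (r * norm y) \<le> D * exp (dual_norm V z)" using ry D by simp
    finally show ?thesis .
  qed
  have decay: "cmod (restrict_real f x) \<le> D * (1 + \<delta> * norm x) powr - real k" for x
  proof -
    have nn: "0 \<le> \<delta> * norm x" using \<delta> by simp
    have "1 + \<delta> * norm x \<le> 1 + (\<Sum>j\<in>UNIV. \<delta> * \<bar>x $ j\<bar>)"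
      unfolding sum_distrib_left[symmetric] using \<delta> norm_le_l1_cart[of x] by simp
    also have "\<dots> \<le> (\<Prod>j\<in>UNIV. 1 + \<delta> * \<bar>x $ j\<bar>)" using \<delta> by (intro one_plus_sum_le_prod) auto
    finally have P: "1 + \<delta> * norm x \<le> (\<Prod>j\<in>UNIV. 1 + \<delta> * \<bar>x $ j\<bar>)" .
    have "cmod (csinc (of_real \<delta> * cvec x $ j)) \<le> C / (1 + \<delta> * \<bar>x $ j\<bar>)" for j
      using C(3)[of "\<delta> * x $ j"] \<delta> by (simp add: abs_mult)
    then have "(\<Prod>j\<in>UNIV. cmod (csinc (of_real \<delta> * cvec x $ j))) \<le> (\<Prod>j\<in>UNIV. C / (1 + \<delta> * \<bar>x $ j\<bar>))"
      by (intro prod_mono) auto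
    also have "\<dots> = C ^ CARD('m) / (\<Prod>j\<in>UNIV. 1 + \<delta> * \<bar>x $ j\<bar>)" unfolding prod_dividef by simp
    also have "\<dots> \<le> C ^ CARD('m) / (1 + \<delta> * norm x)"
      using P nn C(1) by (intro divide_left_mono mult_pos_pos) auto
    finally have "cmod (restrict_real f x) \<le> (C ^ CARD('m) / (1 + \<delta> * norm x)) ^ k"
      unfolding restrict_real_def f_def norm_power prod_norm[symmetric] by (intro power_mono prod_nonneg) auto
    also have "\<dots> = D * (1 + \<delta> * norm x) powr - real k"
      using powr_realpow[of "1 + \<delta> * norm x" k] nn by (simp add: D_def power_divide powr_minus_divide)
    finally show ?thesis .
  qed
  show thesis
  proof
    have "\<exists>C. \<forall>z. cmod (f z) \<le> C * exp ((1 + \<epsilon>) * dual_norm V z)" if e: "\<epsilon> > 0" for \<epsilon> :: real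
    proof (intro exI allI)
      fix z
      have "D * exp (dual_norm V z) \<le> D * exp ((1 + \<epsilon>) * dual_norm V z)"
        using D mult_nonneg_nonneg[OF less_imp_le[OF e] dual_norm_nonneg[of z]]
        by (intro mult_left_mono) (auto simp: distrib_right)
      then show "cmod (f z) \<le> D * exp ((1 + \<epsilon>) * dual_norm V z)" by (rule order_trans[OF growth])
    qed
    with ent show "f \<in> exp_type V" by (simp add: exp_type_def)
    have "Lp_integral q UNIV (restrict_real f) < \<infinity>"
    proof (rule Lp_integral_decay[OF q \<delta> _ _ decay])
      show "real CARD('m) + 2 \<le> real k * q" using k q by (simp add: field_simps)
    qed (use D in simp)
    moreover have U: "(UNIV :: (real^'m::{finite,linorder}) set) \<in> sets borel" by simp
    ultimately have "Lp_norm p UNIV (restrict_real f) < \<infinity>"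
      unfolding Lp_norm_less_top_iff[OF False U] q_def by blast
    then show "restrict_real f \<in> Lp_space p UNIV"
      unfolding Lp_space_def using continuous_Lp_measurable[OF entire_restrict_continuous[OF ent]] by simp
    have "f 0 = 1" by (simp add: f_def csinc_def)
    then show "f \<noteq> (\<lambda>_. 0)" by auto
  qed
qed

end

section \<open>Convergence of the constants and attainment\<close>

lemma Lp_norm_zero:
  assumes "0 < p"
  shows "Lp_norm p UNIV (\<lambda>_ :: real^'m::finite. 0) = 0"
proof (cases "p = \<infinity>")
  case True
  have "Lp_norm \<infinity> UNIV (\<lambda>_ :: real^'m. 0) \<le> 0"
    by (subst Lp_norm_infinity_le_iff) auto
  then show ?thesis using True by simp
next
  case False
  have "Lp_norm p UNIV (\<lambda>_ :: real^'m. 0) \<le> ennreal 0"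
    by (rule Lp_norm_finite_leI[OF assms False]) (auto simp: Lp_integral_def)
  then show ?thesis by simp
qed

lemma diff_op_restrict_real_continuous:
  assumes "entire f"
  shows "continuous_on A (diff_op N b (restrict_real f))"
proof -
  have "diff_op N b (restrict_real f) = (\<lambda>x. \<Sum>\<alpha> | mi_size \<alpha> = N. b \<alpha> * restrict_real (cmd \<alpha> f) x)"
    by (rule ext) (simp add: diff_op_restrict_real[OF assms] restrict_real_def)
  then show ?thesis
    by (simp only:) (intro continuous_on_sum continuous_on_mult continuous_on_const entire_restrict_continuous entire_cmd assms)
qed

context symmetric_body
begin

lemma M_const_converges:
  assumes p: "0 < p"
  obtains l where "0 \<le> l" "(\<lambda>n. M_const p N b n V) \<longlonglongrightarrow> ennreal l"
proof -
  let ?a = "\<lambda>n. M_const p N b n V"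
  obtain C n0 where C: "\<And>n. n \<ge> n0 \<Longrightarrow> ?a n \<le> ennreal C"
    by (rule M_const_bounds[OF p, of N b]) blast
  have "limsup ?a \<le> ennreal C"
    by (rule Limsup_bounded) (use C in \<open>auto simp: eventually_sequentially\<close>)
  then have "limsup ?a < \<infinity>" using le_less_trans[OF _ ennreal_less_top] by auto
  moreover have le: "liminf ?a \<le> limsup ?a" by (rule Liminf_le_Limsup) simp
  ultimately obtain l l' where l: "limsup ?a = ennreal l" "0 \<le> l" and l': "liminf ?a = ennreal l'" "0 \<le> l'"
    by (cases "limsup ?a"; cases "liminf ?a") (auto simp: top_unique)
  obtain f where f: "f \<in> exp_type V" "Lp_norm p UNIV (restrict_real f) \<le> ennreal 1"
    "cmod (diff_op N b (restrict_real f) 0) = l"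
    using extremal_exists[OF p l] by blast
  obtain s where s: "Lp_norm p UNIV (restrict_real f) = ennreal s" "0 \<le> s" "s \<le> 1"
    using f(2) by (cases "Lp_norm p UNIV (restrict_real f)") (auto simp: top_unique)
  have ent: "entire f" using f(1) by (simp add: exp_type_def)
  have "restrict_real f \<in> Lp_space p UNIV"
    unfolding Lp_space_def using s(1) continuous_Lp_measurable[OF entire_restrict_continuous[OF ent]] by simp
  from exp_type_diff_op_le[OF p f(1) this l' s(1,2), of 0]
  have "l \<le> l' * s" unfolding f(3) .
  also have "\<dots> \<le> l' * 1" using l'(2) s by (intro mult_left_mono) auto
  finally have "l \<le> l'" by simp
  moreover have "l' \<le> l" using le l l' by simp
  ultimately have "l' = l" by simp
  then have "?a \<longlonglongrightarrow> ennreal l"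
    using l l' by (subst tendsto_iff_Liminf_eq_Limsup) auto
  with l(2) show thesis by (rule that)
qed

lemma diff_op_sup_le:
  assumes p: "0 < p" and f: "f \<in> exp_type V" and Lp: "restrict_real f \<in> Lp_space p UNIV"
    and lim: "(\<lambda>n. M_const p N b n V) \<longlonglongrightarrow> ennreal l" and l: "0 \<le> l"
  shows "Lp_norm \<infinity> UNIV (diff_op N b (restrict_real f)) \<le> ennreal l * Lp_norm p UNIV (restrict_real f)"
proof -
  obtain s where s: "Lp_norm p UNIV (restrict_real f) = ennreal s" "0 \<le> s"
    using Lp by (cases "Lp_norm p UNIV (restrict_real f)") (auto simp: Lp_space_def)
  have "liminf (\<lambda>n. M_const p N b n V) = ennreal l" by (rule lim_imp_Liminf[OF sequentially_bot lim])
  from exp_type_diff_op_le[OF p f Lp this l s]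
  have *: "\<forall>x\<in>UNIV. ennreal (cmod (diff_op N b (restrict_real f) x)) \<le> ennreal (l * s)" by (blast intro: ennreal_leI)
  have "continuous_on UNIV (diff_op N b (restrict_real f))"
    using f by (intro diff_op_restrict_real_continuous) (simp add: exp_type_def)
  then have "Lp_norm \<infinity> UNIV (diff_op N b (restrict_real f)) \<le> ennreal (l * s)"
    using * by (subst Lp_norm_infinity_le_iff) auto
  then show ?thesis using l s by (simp add: ennreal_mult)
qed

lemma sharp_ratio_le:
  assumes "0 < p" "f \<in> exp_type V" "restrict_real f \<in> Lp_space p UNIV"
    and "(\<lambda>n. M_const p N b n V) \<longlonglongrightarrow> ennreal l" "0 \<le> l"
  shows "Lp_norm \<infinity> UNIV (diff_op N b (restrict_real f)) / Lp_norm p UNIV (restrict_real f) \<le> ennreal l"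
proof -
  obtain s where s: "Lp_norm p UNIV (restrict_real f) = ennreal s" "0 \<le> s"
    using assms(3) by (cases "Lp_norm p UNIV (restrict_real f)") (auto simp: Lp_space_def)
  have le: "Lp_norm \<infinity> UNIV (diff_op N b (restrict_real f)) \<le> ennreal l * ennreal s"
    using diff_op_sup_le[OF assms] unfolding s(1) .
  show ?thesis
  proof (cases "s = 0")
    \<comment> \<open>The numerator is 0 as well, and the quotient 0 / 0 is 0 in
      \<open>ennreal\<close>.\<close>
    case True
    then show ?thesis using le s by simp
  next
    case False
    have "Lp_norm \<infinity> UNIV (diff_op N b (restrict_real f)) / ennreal s \<le> ennreal l * ennreal s / ennreal s"
      by (rule divide_right_mono_ennreal[OF le])
    also have "\<dots> = ennreal l" using False s assms(5) by (simp add: divide_ennreal flip: ennreal_mult)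
    finally show ?thesis unfolding s(1) .
  qed
qed

text \<open>For positive l the function of \<open>extremal_exists\<close> satisfies l \<le> ||D_N
  f|| \<le> l ||f||_p \<le> l, so its norm is exactly 1; this also shows that it does not vanish.
  For l = 0 the upper bound makes every nontrivial member of the class extremal.\<close>

lemma sharp_ratio_attained:
  assumes p: "0 < p" and lim: "(\<lambda>n. M_const p N b n V) \<longlonglongrightarrow> ennreal l" and l: "0 \<le> l"
  obtains f where "f \<in> exp_type V" "restrict_real f \<in> Lp_space p UNIV" "f \<noteq> (\<lambda>_. 0)"
    "Lp_norm \<infinity> UNIV (diff_op N b (restrict_real f)) / Lp_norm p UNIV (restrict_real f) = ennreal l"
proof (cases "l = 0")
  case True
  obtain f where f: "f \<in> exp_type V" "restrict_real f \<in> Lp_space p UNIV" "f \<noteq> (\<lambda>_. 0)"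
    using exp_type_Lp_nontrivial[OF p] by blast
  have "Lp_norm \<infinity> UNIV (diff_op N b (restrict_real f)) / Lp_norm p UNIV (restrict_real f) = ennreal l"
    using sharp_ratio_le[OF p f(1,2) lim l] True by simp
  with f show thesis by (rule that)
next
  case False
  have "limsup (\<lambda>n. M_const p N b n V) = ennreal l" by (rule lim_imp_Limsup[OF sequentially_bot lim])
  then obtain f where f: "f \<in> exp_type V" "Lp_norm p UNIV (restrict_real f) \<le> ennreal 1"
    "cmod (diff_op N b (restrict_real f) 0) = l"
    using extremal_exists[OF p _ l] by blast
  have ent: "entire f" using f(1) by (simp add: exp_type_def)
  have Lp: "restrict_real f \<in> Lp_space p UNIV"
    unfolding Lp_space_def using continuous_Lp_measurable[OF entire_restrict_continuous[OF ent]]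
      le_less_trans[OF f(2) ennreal_less_top] by simp
  define D where "D = Lp_norm \<infinity> UNIV (diff_op N b (restrict_real f))"
  have "\<forall>x\<in>UNIV. ennreal (cmod (diff_op N b (restrict_real f) x)) \<le> D"
    using Lp_norm_infinity_le_iff[OF diff_op_restrict_real_continuous[OF ent], of UNIV N b D] by (simp add: D_def)
  from bspec[OF this UNIV_I, of 0] have lD: "ennreal l \<le> D" unfolding f(3) .
  have Dl: "D \<le> ennreal l * Lp_norm p UNIV (restrict_real f)"
    unfolding D_def by (rule diff_op_sup_le[OF p f(1) Lp lim l])
  have "Lp_norm p UNIV (restrict_real f) = 1"
  proof -
    obtain s where s: "Lp_norm p UNIV (restrict_real f) = ennreal s" "0 \<le> s" "s \<le> 1"
      using f(2) by (cases "Lp_norm p UNIV (restrict_real f)") (auto simp: top_unique)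
    have "ennreal l \<le> ennreal (l * s)" using order_trans[OF lD Dl] l s by (simp add: ennreal_mult)
    then have "l * 1 \<le> l * s" using l s by simp
    then have "1 \<le> s" using False l by simp
    then show ?thesis using s by simp
  qed
  moreover from this have "D = ennreal l" using lD Dl by simp
  moreover have "f \<noteq> (\<lambda>_. 0)"
  proof
    assume "f = (\<lambda>_. 0)"
    then have "restrict_real f = (\<lambda>_. 0)" by (simp add: restrict_real_def fun_eq_iff)
    from calculation(1)[unfolded this Lp_norm_zero[OF p]] show False by simp
  qed
  ultimately show thesis using f(1) Lp using divide_ennreal[of l 1] l unfolding D_def by (intro that) auto
qed

end

theorem theorem1p2:
  fixes V :: "(real^'m::{finite,linorder}) set"
    and N :: nat
    and b :: "nat^'m::{finite,linorder} \<Rightarrow> complex"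
    and p :: ennreal
  assumes "compact V" and "convex V" and "interior V \<noteq> {}"
    and "\<forall>x\<in>V. - x \<in> V"
    and "N = 0 \<Longrightarrow> b 0 = 1"
    and "0 < p"
  shows "\<exists>L::ennreal. L < \<infinity> \<and>
    (\<lambda>n. M_const p N b n V) \<longlonglongrightarrow> L \<and>
    E_const p N b V = L \<and>
    (\<exists>f0 \<in> exp_type V. restrict_real f0 \<in> Lp_space p UNIV \<and> f0 \<noteq> (\<lambda>_. 0) \<and>
       Lp_norm \<infinity> UNIV (diff_op N b (restrict_real f0)) / Lp_norm p UNIV (restrict_real f0) = L)"
proof -
  interpret symmetric_body V by unfold_locales (fact assms)+
  obtain l where l: "0 \<le> l" "(\<lambda>n. M_const p N b n V) \<longlonglongrightarrow> ennreal l"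
    using M_const_converges[OF \<open>0 < p\<close>] by blast
  obtain f0 where f0: "f0 \<in> exp_type V" "restrict_real f0 \<in> Lp_space p UNIV" "f0 \<noteq> (\<lambda>_. 0)"
    "Lp_norm \<infinity> UNIV (diff_op N b (restrict_real f0)) / Lp_norm p UNIV (restrict_real f0) = ennreal l"
    using sharp_ratio_attained[OF \<open>0 < p\<close> l(2,1)] by blast
  have "E_const p N b V = ennreal l"
  proof (rule antisym)
    show "E_const p N b V \<le> ennreal l"
      unfolding E_const_def using sharp_ratio_le[OF \<open>0 < p\<close> _ _ l(2,1)] by (intro SUP_least) blast
    show "ennreal l \<le> E_const p N b V"
      unfolding E_const_def f0(4)[symmetric] using f0(1-3) by (intro SUP_upper) blast
  qed
  then show ?thesis using l(2) f0 by (intro exI[of _ "ennreal l"] conjI bexI[of _ f0]) auto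
qed

end
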